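(* Let $\mathfrak p\subset A=\mathbb F_q[T]$ be a nonzero prime ideal, $\mathbb F_{\mathfrak p}=A/\mathfrak p$, $d=\deg_T(\mathfrak p)$, and let $\phi$ be a supersingular Drinfeld module of rank $r\ge2$ over $\overline{\mathbb F}_{\mathfrak p}$. Let $\mathfrak q_1,\dots,\mathfrak q_\ell\in A$ be distinct monic irreducible polynomials of degree $m$, all different from $\mathfrak p$. Put $c=\frac{r(r-1)(d-1)}2$, let $t$ be an integer with $1\le t\le\ell r$, put $s=tm-1$, and assume $tm-1\ge\frac{r^2(r-1)(d-1)}{2}$. Let $\mathcal M_s=M_s(\phi)=\{0\}\cup\{u\in\operatorname{End}(\phi):u\neq0,\ \deg_\tau(u)\le s\}$ and $$\mathcal C=\mathcal C_{s,\mathfrak q_1,\dots,\mathfrak q_\ell}=\bigl\{(u|_{\phi[\mathfrak q_1]},\dots,u|_{\phi[\mathfrak q_\ell]}):u\in\mathcal M_s\bigr\}\subseteq\operatorname{Mat}_{r\times r}(\mathbb F_{q^m})^\ell .$$ Then the simultaneous restriction map $u\mapsto(u|_{\phi[\mathfrak q_i]})_i$ is injective on $\mathcal M_s$, and the additive code $\mathcal C$ satisfies $$\dim_{\mathbb F_q}\mathcal C=mrt-c,\qquad d_{SR}(\mathcal C)\ge\ell r-t+1 .$$ If $d_{\mathrm{act}}=d_{SR}(\mathcal C)$ denotes the actual minimum sum-rank distance and $\Delta_{\mathrm{act}}=mr(\ell r-d_{\mathrm{act}}+1)-(mrt-c)$, then $0\le\Delta_{\mathrm{act}}\le c$. Consequently,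 for fixed $r$ and $d$, $$0\le\frac{\Delta_{\mathrm{act}}}{mrt-c}\le\frac{c}{mrt-c}\longrightarrow0\qquad\text{whenever } mt\to\infty$$ (so the family is asymptotically MSRD, i.e. its normalized additive Singleton defect tends to $0$).
   Context: $q$ is a prime power, $A=\mathbb F_q[T]$. The same symbol is used for a nonzero ideal of $A$ and its monic generator. The field $k=\overline{\mathbb F}_{\mathfrak p}$ is an $A$-field via $\gamma:A\to A/\mathfrak p\hookrightarrow k$; its $A$-characteristic is $\ker\gamma=\mathfrak p$. The twisted polynomial ring $k\{\tau\}$ consists of polynomials $\sum a_i\tau^i$ with $(a\tau^i)(b\tau^j)=ab^{q^i}\tau^{i+j}$; an element acts on $\overline k$ by $\sum a_i\tau^i: x\mapsto\sum a_i x^{q^i}$. A Drinfeld module of rank $r$ over $k$ is an $\mathbb F_q$-algebra homomorphism $\phi:A\to k\{\tau\}$, $a\mapsto\phi_a$, with $\phi_T=\gamma(T)+g_1\tau+\dots+g_r\tau^r$, $g_r\neq 0$. Its height $h$ ($1\le h\le r$) is defined by: the lowest nonzero term of $\phi_{\mathfrak p}$ has $\tau$-degree $hd$; $\phi$ is supersingular if $h=r$. $\operatorname{End}(\phi)=\{u\in\overline k\{\tau\}: u\phi_a=\phi_a u\ \forall a\in A\}$ (geometric endomorphisms). For $a\in A$ nonzero, $\phi[a]=\{\alpha\in\overline k:\phi_a(\alpha)=0\}$, an $A$-module via $b\cdot\alpha=\phi_b(\alpha)$. Since $\mathfrak q_i$ is prime to $\mathfrak p$, $\phi[\mathfrak q_i]\cong(A/\mathfrak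 q_i)^r\cong\mathbb F_{q^m}^r$; endomorphisms of $\phi$ preserve $\phi[\mathfrak q_i]$ and act $A/\mathfrak q_i$-linearly. For each $i$ an isomorphism $A/\mathfrak q_i\cong\mathbb F_{q^m}$ and a basis of $\phi[\mathfrak q_i]$ are chosen, so that restrictions are represented as matrices in $\operatorname{Mat}_{r\times r}(\mathbb F_{q^m})$ (rank properties do not depend on these choices). For $X=(X_1,\dots,X_\ell)\in\operatorname{Mat}_{r\times r}(\mathbb F_{q^m})^\ell$, $\operatorname{wt}_{SR}(X)=\sum_i\operatorname{rk}(X_i)$ (ranks over $\mathbb F_{q^m}$). An additive sum-rank code is an $\mathbb F_q$-linear subspace $\mathcal C$; if nonzero, $d_{SR}(\mathcal C)=\min\{\operatorname{wt}_{SR}(X):0\ne X\in\mathcal C\}$. The additive Singleton bound is $\dim_{\mathbb F_q}\mathcal C\le mr(\ell r-d_{SR}(\mathcal C)+1)$; codes attaining it are called additive MSRD. *)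

theory Defs
  imports Complex_Main "HOL-Computational_Algebra.Computational_Algebra"
    "HOL-Library.Function_Algebras" "HOL-Library.Cardinality"
begin

text \<open>
  Throughout, \<open>'f\<close> is the finite field \<open>F\<^sub>q\<close> with \<open>q = CARD('f)\<close>, the ring \<open>A = F\<^sub>q[T]\<close> is
  \<open>'f poly\<close>, and a nonzero ideal of \<open>A\<close> is given by its monic generator.  The field \<open>k\<close> is the
  type \<open>'k\<close>.
\<close>

definition is_ring_hom :: "('a::comm_ring_1 \<Rightarrow> 'b::comm_ring_1) \<Rightarrow> bool" where
  "is_ring_hom h \<longleftrightarrow>
     h 1 = 1 \<and> (\<forall>x y. h (x + y) = h x + h y) \<and> (\<forall>x y. h (x * y) = h x * h y)"

text \<open>
  \<open>is_residue_closure \<pp> \<gamma>\<close>: the structure map \<open>\<gamma>: A \<rightarrow> k\<close> has kernel \<open>\<pp>\<close>, so its range is a copy of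
  \<open>A/\<pp>\<close>, and \<open>k\<close> is algebraic over that range.  Since \<open>'k\<close> is algebraically closed, it is an
  algebraic closure of \<open>A/\<pp>\<close>.
\<close>

definition is_residue_closure ::
    "'f::{field,finite} poly \<Rightarrow> ('f poly \<Rightarrow> 'k::alg_closed_field) \<Rightarrow> bool" where
  "is_residue_closure \<pp> \<gamma> \<longleftrightarrow>
     is_ring_hom \<gamma> \<and> (\<forall>a. \<gamma> a = 0 \<longleftrightarrow> \<pp> dvd a) \<and>
     (\<forall>x. \<exists>P. P \<noteq> 0 \<and> (\<forall>i. coeff P i \<in> range \<gamma>) \<and> poly P x = 0)"

text \<open>
  A twisted polynomial \<open>\<Sum> a\<^sub>i \<tau>\<^sup>i\<close> in \<open>k{\<tau>}\<close> is stored as the ordinary polynomial with coefficients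
  \<open>a\<^sub>i\<close>.  Addition, zero, one and \<open>degree\<close> (the \<open>\<tau>\<close>-degree) are those of \<open>'k poly\<close>, but the
  product is \<open>tmult q\<close> and evaluation is \<open>tapply q\<close>, never \<open>*\<close> and \<open>poly\<close>.
\<close>

definition tmult :: "nat \<Rightarrow> 'k::field poly \<Rightarrow> 'k poly \<Rightarrow> 'k poly" where
  "tmult q u v =
     (\<Sum>i\<le>degree u. \<Sum>j\<le>degree v. monom (coeff u i * coeff v j ^ (q ^ i)) (i + j))"

definition tapply :: "nat \<Rightarrow> 'k::field poly \<Rightarrow> 'k \<Rightarrow> 'k" where
  "tapply q u x = (\<Sum>i\<le>degree u. coeff u i * x ^ (q ^ i))"

text \<open>
  An \<open>F\<^sub>q\<close>-algebra homomorphism \<open>\<phi>: A \<rightarrow> k{\<tau>}\<close> with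
  \<open>\<phi>\<^sub>T = \<gamma>(T) + g\<^sub>1 \<tau> + \<dots> + g\<^sub>r \<tau>\<^sup>r\<close> and \<open>g\<^sub>r \<noteq> 0\<close>; the generator \<open>T\<close> is \<open>[:0, 1:]\<close>.
\<close>

definition drinfeld_module ::
    "('f::{field,finite} poly \<Rightarrow> 'k::field) \<Rightarrow> nat \<Rightarrow> ('f poly \<Rightarrow> 'k poly) \<Rightarrow> bool" where
  "drinfeld_module \<gamma> r \<phi> \<longleftrightarrow>
     1 \<le> r \<and>
     (\<forall>a b. \<phi> (a + b) = \<phi> a + \<phi> b) \<and>
     (\<forall>a b. \<phi> (a * b) = tmult CARD('f) (\<phi> a) (\<phi> b)) \<and>
     (\<forall>x. \<phi> [:x:] = [:\<gamma> [:x:]:]) \<and>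
     coeff (\<phi> [:0, 1:]) 0 = \<gamma> [:0, 1:] \<and> degree (\<phi> [:0, 1:]) = r"

definition has_height ::
    "'f::{field,finite} poly \<Rightarrow> ('f poly \<Rightarrow> 'k::field poly) \<Rightarrow> nat \<Rightarrow> bool" where
  "has_height \<pp> \<phi> h \<longleftrightarrow>
     \<phi> \<pp> \<noteq> 0 \<and> (LEAST i. coeff (\<phi> \<pp>) i \<noteq> 0) = h * degree \<pp>"

definition supersingular ::
    "'f::{field,finite} poly \<Rightarrow> nat \<Rightarrow> ('f poly \<Rightarrow> 'k::field poly) \<Rightarrow> bool" where
  "supersingular \<pp> r \<phi> \<longleftrightarrow> has_height \<pp> \<phi> r"

text \<open>
  Since \<open>'k\<close> will be algebraically closed, the geometric endomorphisms and all torsion points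
  already live over \<open>'k\<close>.
\<close>

definition End_ring :: "('f::{field,finite} poly \<Rightarrow> 'k::alg_closed_field poly) \<Rightarrow> 'k poly set" where
  "End_ring \<phi> = {u. \<forall>a. tmult CARD('f) u (\<phi> a) = tmult CARD('f) (\<phi> a) u}"

definition End_upto ::
    "('f::{field,finite} poly \<Rightarrow> 'k::alg_closed_field poly) \<Rightarrow> nat \<Rightarrow> 'k poly set" where
  "End_upto \<phi> s = {0} \<union> {u \<in> End_ring \<phi>. u \<noteq> 0 \<and> degree u \<le> s}"

definition torsion ::
    "('f::{field,finite} poly \<Rightarrow> 'k::alg_closed_field poly) \<Rightarrow> 'f poly \<Rightarrow> 'k set" where
  "torsion \<phi> a = {x. tapply CARD('f) (\<phi> a) x = 0}"

text \<open>
  The combination \<open>\<Sum>\<^sub>j a\<^sub>j \<cdot> b\<^sub>j\<close> of \<open>b\<^sub>0, \<dots>, b\<^sub>r\<^sub>-\<^sub>1\<close> for the \<open>A\<close>-module structure that \<open>\<phi>\<close> puts on \<open>k\<close>.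
\<close>

definition A_comb ::
    "('f::{field,finite} poly \<Rightarrow> 'k::field poly) \<Rightarrow> nat \<Rightarrow> (nat \<Rightarrow> 'k) \<Rightarrow> (nat \<Rightarrow> 'f poly) \<Rightarrow> 'k" where
  "A_comb \<phi> r b a = (\<Sum>j<r. tapply CARD('f) (\<phi> (a j)) (b j))"

text \<open>\<open>b\<^sub>0, \<dots>, b\<^sub>r\<^sub>-\<^sub>1\<close> is a basis of \<open>\<phi>[\<qq>]\<close> over \<open>A/\<qq>\<close>; scalars are represented by elements of \<open>A\<close>.\<close>

definition is_torsion_basis ::
    "('f::{field,finite} poly \<Rightarrow> 'k::alg_closed_field poly) \<Rightarrow> nat \<Rightarrow> 'f poly \<Rightarrow> (nat \<Rightarrow> 'k) \<Rightarrow> bool"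
  where
  "is_torsion_basis \<phi> r \<qq> b \<longleftrightarrow>
     (\<forall>j<r. b j \<in> torsion \<phi> \<qq>) \<and>
     (\<forall>x\<in>torsion \<phi> \<qq>. \<exists>a. x = A_comb \<phi> r b a) \<and>
     (\<forall>a. A_comb \<phi> r b a = 0 \<longrightarrow> (\<forall>j<r. \<qq> dvd a j))"

text \<open>
  The field with \<open>q\<^sup>m\<close> elements, taken as the subfield of \<open>k\<close> (an algebraic closure of \<open>F\<^sub>q\<close>) fixed by
  the \<open>q\<^sup>m\<close>-power map; \<open>F\<^sub>q\<close> sits inside it through \<open>\<gamma>\<close>.  This lets \<open>m\<close> vary inside a formula.
\<close>

definition Fqm :: "nat \<Rightarrow> nat \<Rightarrow> 'k::field set" where
  "Fqm q m = {x. x ^ (q ^ m) = x}"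

text \<open>\<open>\<theta>\<close> induces an isomorphism of \<open>F\<^sub>q\<close>-algebras from \<open>A/\<qq>\<close> onto \<open>Fqm q m\<close>.\<close>

definition is_residue_iso ::
    "('f::{field,finite} poly \<Rightarrow> 'k::field) \<Rightarrow> nat \<Rightarrow> 'f poly \<Rightarrow> ('f poly \<Rightarrow> 'k) \<Rightarrow> bool" where
  "is_residue_iso \<gamma> m \<qq> \<theta> \<longleftrightarrow>
     is_ring_hom \<theta> \<and> (\<forall>x. \<theta> [:x:] = \<gamma> [:x:]) \<and>
     (\<forall>a. \<theta> a = 0 \<longleftrightarrow> \<qq> dvd a) \<and> range \<theta> = Fqm CARD('f) m"

text \<open>
  An \<open>ell\<close>-tuple \<open>X\<close> of \<open>r \<times> r\<close> matrices over \<open>K\<close> is a function with \<open>X i j l\<close> the entry in row \<open>j\<close> and column \<open>l\<close> of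
  the \<open>i\<close>-th matrix; it vanishes outside the index range, so that equality and the pointwise
  group structure are those of the matrix space.
\<close>

type_synonym 'k mat_tuple = "nat \<Rightarrow> nat \<Rightarrow> nat \<Rightarrow> 'k"

definition mat_tuples :: "'k::field set \<Rightarrow> nat \<Rightarrow> nat \<Rightarrow> 'k mat_tuple set" where
  "mat_tuples K r ell =
     {X. (\<forall>i j l. X i j l \<in> K) \<and> (\<forall>i j l. \<not> (i < ell \<and> j < r \<and> l < r) \<longrightarrow> X i j l = 0)}"

text \<open>
  Coordinates of \<open>x \<in> \<phi>[\<qq>]\<close> in the basis \<open>b\<close>, transported to \<open>Fqm q m\<close> by \<open>\<theta>\<close>.  The coefficients
  in \<open>A\<close> are unique modulo \<open>\<qq>\<close>, the kernel of \<open>\<theta>\<close>, so the choice is immaterial.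
\<close>

definition torsion_coord ::
    "('f::{field,finite} poly \<Rightarrow> 'k::field poly) \<Rightarrow> nat \<Rightarrow> ('f poly \<Rightarrow> 'k) \<Rightarrow> (nat \<Rightarrow> 'k)
      \<Rightarrow> 'k \<Rightarrow> nat \<Rightarrow> 'k" where
  "torsion_coord \<phi> r \<theta> b x j = \<theta> ((SOME a. x = A_comb \<phi> r b a) j)"

definition restriction ::
    "('f::{field,finite} poly \<Rightarrow> 'k::field poly) \<Rightarrow> nat \<Rightarrow> nat
      \<Rightarrow> (nat \<Rightarrow> 'f poly \<Rightarrow> 'k) \<Rightarrow> (nat \<Rightarrow> nat \<Rightarrow> 'k) \<Rightarrow> 'k poly \<Rightarrow> 'k mat_tuple" where
  "restriction \<phi> r ell \<theta> \<beta> u = (\<lambda>i j l.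
     if i < ell \<and> j < r \<and> l < r
     then torsion_coord \<phi> r (\<theta> i) (\<beta> i) (tapply CARD('f) u (\<beta> i l)) j else 0)"

definition code ::
    "('f::{field,finite} poly \<Rightarrow> 'k::alg_closed_field poly) \<Rightarrow> nat \<Rightarrow> nat
      \<Rightarrow> (nat \<Rightarrow> 'f poly \<Rightarrow> 'k) \<Rightarrow> (nat \<Rightarrow> nat \<Rightarrow> 'k) \<Rightarrow> nat \<Rightarrow> 'k mat_tuple set" where
  "code \<phi> r ell \<theta> \<beta> s = restriction \<phi> r ell \<theta> \<beta> ` End_upto \<phi> s"

text \<open>
  The rank over a subfield \<open>K\<close> of an \<open>r \<times> r\<close> matrix: the largest number of columns that are
  linearly independent over \<open>K\<close>.
\<close>

definition rank_over :: "'k::field set \<Rightarrow> nat \<Rightarrow> (nat \<Rightarrow> nat \<Rightarrow> 'k) \<Rightarrow> nat" where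
  "rank_over K r M = Max {card J | J. J \<subseteq> {..<r} \<and>
     (\<forall>c. (\<forall>l\<in>J. c l \<in> K) \<and> (\<forall>j<r. (\<Sum>l\<in>J. c l * M j l) = 0) \<longrightarrow> (\<forall>l\<in>J. c l = 0))}"

definition wt_SR :: "'k::field set \<Rightarrow> nat \<Rightarrow> nat \<Rightarrow> 'k mat_tuple \<Rightarrow> nat" where
  "wt_SR K r ell X = (\<Sum>i<ell. rank_over K r (X i))"

text \<open>Meaningful for \<open>C \<noteq> {0}\<close> only.\<close>

definition d_SR :: "'k::field set \<Rightarrow> nat \<Rightarrow> nat \<Rightarrow> 'k mat_tuple set \<Rightarrow> nat" where
  "d_SR K r ell C = Min {wt_SR K r ell X | X. X \<in> C \<and> X \<noteq> 0}"

definition Fq_scale ::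
    "('f::{field,finite} poly \<Rightarrow> 'k::field) \<Rightarrow> 'f \<Rightarrow> 'k mat_tuple \<Rightarrow> 'k mat_tuple" where
  "Fq_scale \<gamma> x X = (\<lambda>i j l. \<gamma> [:x:] * X i j l)"

definition additive_code ::
    "('f::{field,finite} poly \<Rightarrow> 'k::field) \<Rightarrow> nat \<Rightarrow> nat \<Rightarrow> nat \<Rightarrow> 'k mat_tuple set \<Rightarrow> bool" where
  "additive_code \<gamma> m r ell C \<longleftrightarrow>
     C \<subseteq> mat_tuples (Fqm CARD('f) m) r ell \<and> module.subspace (Fq_scale \<gamma>) C"

abbreviation dim_Fq ::
    "('f::{field,finite} poly \<Rightarrow> 'k::field) \<Rightarrow> 'k mat_tuple set \<Rightarrow> nat" where
  "dim_Fq \<gamma> C \<equiv> vector_space.dim (Fq_scale \<gamma>) C"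

text \<open>
  The standing data: a supersingular Drinfeld module of rank \<open>r\<close> in characteristic \<open>\<pp>\<close> with
  \<open>deg \<pp> = d\<close>, evaluation primes \<open>\<qq> 0, \<dots>, \<qq> (ell - 1)\<close> of degree \<open>m\<close>, the chosen isomorphisms and
  torsion bases, and the restrictions on the parameter \<open>t\<close>.
\<close>

definition code_setup ::
    "nat \<Rightarrow> nat \<Rightarrow> 'f::{field,finite} poly \<Rightarrow> ('f poly \<Rightarrow> 'k::alg_closed_field)
      \<Rightarrow> ('f poly \<Rightarrow> 'k poly) \<Rightarrow> nat \<Rightarrow> nat \<Rightarrow> (nat \<Rightarrow> 'f poly)
      \<Rightarrow> (nat \<Rightarrow> 'f poly \<Rightarrow> 'k) \<Rightarrow> (nat \<Rightarrow> nat \<Rightarrow> 'k) \<Rightarrow> nat \<Rightarrow> bool" where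
  "code_setup r d \<pp> \<gamma> \<phi> m ell \<qq> \<theta> \<beta> t \<longleftrightarrow>
     irreducible \<pp> \<and> lead_coeff \<pp> = 1 \<and> degree \<pp> = d \<and>
     is_residue_closure \<pp> \<gamma> \<and> drinfeld_module \<gamma> r \<phi> \<and> supersingular \<pp> r \<phi> \<and>
     (\<forall>i<ell. irreducible (\<qq> i) \<and> lead_coeff (\<qq> i) = 1 \<and> degree (\<qq> i) = m \<and> \<qq> i \<noteq> \<pp>) \<and>
     inj_on \<qq> {..<ell} \<and>
     (\<forall>i<ell. is_residue_iso \<gamma> m (\<qq> i) (\<theta> i) \<and> is_torsion_basis \<phi> r (\<qq> i) (\<beta> i)) \<and>
     1 \<le> t \<and> t \<le> ell * r \<and>
     real (t * m) - 1 \<ge> real (r\<^sup>2 * (r - 1) * (d - 1)) / 2"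

end

theory Submission
  imports Defs "HOL-Library.FuncSet"
begin

text \<open>
  Put \<open>N = r d\<close>.  Supersingularity says that \<open>\<phi>\<^sub>\<pp> = \<epsilon> \<tau>\<^sup>N\<close>.  Endomorphisms of \<open>\<phi>\<close> are the fixed points of a
  Frobenius-semilinear operator on the \<open>k\<close>-space of those \<open>k\<close>-linear maps \<open>f\<close> of \<open>k{\<tau>}\<close> that commute with
  right multiplication by \<open>\<phi>\<^sub>T\<close> and preserve the chain of the subspaces \<open>\<tau>\<^sup>j k{\<tau>}\<close>, so by Lang's theorem
  it suffices to compute a \<open>k\<close>-dimension.  Without the chain condition \<open>f\<close> is determined by the arbitrary
  values \<open>f (\<tau>\<^sup>j)\<close>, \<open>j < r\<close>.  Modulo \<open>\<phi>\<^sub>\<pp>\<close> the operator \<open>T\<close> has \<open>d\<close> eigenspaces of dimension \<open>r\<close>, in each of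
  which the chain induces a full flag, so the chain condition has codimension \<open>d r (r - 1) / 2\<close>, at least
  in large degree.  The deficiency of the spaces of leading coefficients is non-increasing along
  arithmetic progressions of step \<open>r\<close>, which brings the exact count down to the degrees in the theorem.

  An endomorphism \<open>u\<close> of \<open>\<tau>\<close>-degree \<open>s\<close> has at most \<open>q\<^sup>s\<close> zeros, and its kernels on the \<open>\<phi>[\<qq>\<^sub>i]\<close> are
  independent; this bounds the sum of their dimensions and gives the distance.
\<close>

section \<open>Twisted polynomials\<close>

text \<open>Right multiplication by an endomorphism also commutes with left multiplication by
  \<tau>. That condition is only F_q-linear, so it is dropped at first, which leaves a k-space, and
  it returns as invariance under f -> \<tau>^(-1) f \<tau>. The chain condition is what makes this
  division by \<tau> possible. Under a degree bound s, the free value at \<tau>^j contributes j + s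
  + 1 coefficients, in total r (s + 1) + r (r - 1) / 2. The second summand cancels one of the d flag
  conditions, and this is the origin of the factor d - 1 in c. The flag conditions are shown to be
  independent only for s at least N - 1, because the test maps take values of degree up to N - 1.
  For smaller s they give just a lower bound on the number of endomorphisms, and the range allowed
  by the theorem can start below N - 1. Equality there is recovered from the F_q-structure alone: a
  gap in the leading coefficients at degree n forces gaps at n - r, n - 2r, and so on, while all
  gaps together amount to c.\<close>

lemma poly_monom_induct [case_names monom add]:
  assumes "\<And>a n. P (monom a n)" and "\<And>u v. P u \<Longrightarrow> P v \<Longrightarrow> P (u + v)"
  shows "P (u :: 'a::comm_ring_1 poly)"
proof -
  have "P (\<Sum>i\<le>n. monom (coeff u i) i)" for n
    by (induction n) (use assms in auto)
  then show ?thesis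
    by (metis poly_as_sum_of_monoms)
qed

lemma poly_eq_0_of_many_roots:
  fixes p :: "'a::idom poly"
  assumes "finite S" and "\<And>x. x \<in> S \<Longrightarrow> poly p x = 0" and "degree p < card S"
  shows "p = 0"
proof (rule ccontr)
  assume "p \<noteq> 0"
  then have "card S \<le> card {x. poly p x = 0}"
    using assms by (intro card_mono poly_roots_finite) auto
  also have "\<dots> \<le> degree p"
    using \<open>p \<noteq> 0\<close> by (rule card_poly_roots_bound)
  finally show False using assms by simp
qed

lemma finite_field_power_card:
  fixes x :: "'f::{field,finite}"
  shows "x ^ CARD('f) = x"
proof (cases "x = 0")
  case True
  then show ?thesis by (simp add: zero_power)
next
  case False
  let ?S = "UNIV - {0 :: 'f}"
  have "bij_betw ((*) x) ?S ?S"
    by (rule bij_betwI[where g = "\<lambda>y. y / x"]) (use False in auto)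
  then have "(\<Prod>y\<in>?S. x * y) = (\<Prod>y\<in>?S. y)"
    by (rule prod.reindex_bij_betw)
  then have "x ^ card ?S * \<Prod>?S = \<Prod>?S"
    by (simp add: prod.distrib)
  moreover have "\<Prod>?S \<noteq> 0" by simp
  ultimately have *: "x ^ card ?S = 1" by simp
  have "CARD('f) = Suc (card ?S)"
    by (simp add: card_Diff_singleton Suc_diff_1)
  with * show ?thesis by (simp only: power_Suc mult_1_right)
qed

lemma two_le_card_field: "2 \<le> CARD('f::{field,finite})"
proof -
  have "card {0, 1 :: 'f} \<le> CARD('f)" by (intro card_mono) auto
  then show ?thesis by simp
qed

section \<open>The field F_q inside k and the additivity of the q-power map\<close>

locale A_field =
  fixes \<gamma> :: "'f::{field,finite} poly \<Rightarrow> 'k::alg_closed_field" and q :: nat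
  assumes hom: "is_ring_hom \<gamma>" and q_eq: "q = CARD('f)"
begin

lemma q_ge_2: "2 \<le> q" unfolding q_eq by (rule two_le_card_field)

lemma q_gt_1: "1 < q" using q_ge_2 by simp

lemma \<gamma>_add: "\<gamma> (x + y) = \<gamma> x + \<gamma> y"
  and \<gamma>_mult: "\<gamma> (x * y) = \<gamma> x * \<gamma> y"
  and \<gamma>_1: "\<gamma> 1 = 1"
  using hom by (auto simp: is_ring_hom_def)

lemma \<gamma>_0 [simp]: "\<gamma> 0 = 0"
  using \<gamma>_add[of 0 0] by (metis add_0_right add_left_imp_eq)

definition emb :: "'f \<Rightarrow> 'k" where "emb x = \<gamma> [:x:]"

lemma emb_add: "emb (x + y) = emb x + emb y"
  and emb_mult: "emb (x * y) = emb x * emb y"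
  and emb_0 [simp]: "emb 0 = 0"
  and emb_1 [simp]: "emb 1 = 1"
  using \<gamma>_add[of "[:x:]" "[:y:]"] \<gamma>_mult[of "[:x:]" "[:y:]"]
  by (auto simp: emb_def mult.commute \<gamma>_1 simp flip: one_pCons)

lemma emb_power: "emb (x ^ n) = emb x ^ n"
  by (induction n) (auto simp: emb_mult)

lemma emb_eq_0_iff [simp]: "emb x = 0 \<longleftrightarrow> x = 0"
proof
  assume *: "emb x = 0"
  show "x = 0"
  proof (rule ccontr)
    assume "x \<noteq> 0"
    then have "emb x * emb (1 / x) = 1" by (simp flip: emb_mult)
    with * show False by simp
  qed
qed auto

lemma emb_minus: "emb (- x) = - emb x"
  using emb_add[of x "-x"] by (simp add: eq_neg_iff_add_eq_0 add.commute)

lemma inj_emb: "inj emb"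
proof (rule injI)
  fix x y assume "emb x = emb y"
  then have "emb (x + - y) = 0" unfolding emb_add emb_minus by simp
  then show "x = y" unfolding emb_eq_0_iff by simp
qed

lemma emb_pow_q [simp]: "emb x ^ q = emb x"
  by (simp add: q_eq finite_field_power_card flip: emb_power)

lemma emb_pow_q_pow [simp]: "emb x ^ (q ^ i) = emb x"
  by (induction i) (auto simp: power_mult)

lemma card_range_emb: "card (range emb) = q"
  by (simp add: q_eq card_image[OF inj_emb])

text \<open>
  \<open>(X + Y)\<^sup>q - X\<^sup>q - Y\<^sup>q\<close> has degree below \<open>q\<close> in each variable and vanishes on \<open>F\<^sub>q \<times> F\<^sub>q\<close>.  This avoids
  showing that \<open>q\<close> is a power of the characteristic.
\<close>

lemma frob_add: "(x + y) ^ q = x ^ q + (y::'k) ^ q"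
proof -
  \<comment> \<open>Subtracting \<open>monom 1 q\<close> removes the leading term, so that vanishing
    at the \<open>q\<close> elements of F_q is enough to force zero.\<close>
  have deg: "degree ([:a, 1:] ^ q - monom 1 q - [:b:]) < q" for a b :: 'k
  proof -
    let ?P = "[:a, 1:] ^ q - monom 1 q"
    have "degree ?P \<le> q"
      by (intro degree_diff_le) (auto simp: degree_linear_power degree_monom_le)
    moreover have "coeff ?P q = 0"
      by (simp add: coeff_linear_power)
    ultimately have "degree ?P < q"
      using q_gt_1 by (metis degree_0 eq_zero_or_degree_less not_less_iff_gr_or_eq not_one_less_zero gr0I)
    then show ?thesis
      using q_gt_1 by (intro le_less_trans[OF degree_diff_le_max]) simp
  qed
  have *: "P = 0" if "degree P < q" "\<And>c. poly P (emb c) = 0" for P :: "'k poly"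
    by (rule poly_eq_0_of_many_roots[of "range emb"]) (use that card_range_emb in auto)
  \<comment> \<open>One variable at a time: for \<open>b\<close> in F_q the test points
    \<open>emb c\<close> only involve sums inside F_q. The result, now for every \<open>x\<close>,
    supplies the \<open>q\<close> roots of the polynomial in the second variable.\<close>
  have 1: "(x + emb b) ^ q = x ^ q + emb b" for x b
  proof -
    let ?P = "[:emb b, 1:] ^ q - monom 1 q - [:emb b:]"
    have "?P = 0"
    proof (rule *[OF deg])
      fix c
      show "poly ?P (emb c) = 0"
        using emb_pow_q[of "b + c"] by (simp add: poly_monom emb_add add.commute)
    qed
    then have "poly ?P x = 0" by simp
    then show ?thesis by (simp add: poly_monom algebra_simps)
  qed
  let ?P = "[:x, 1:] ^ q - monom 1 q - [:x ^ q:]"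
  have "?P = 0"
    by (rule *[OF deg]) (use 1[of x] in \<open>simp add: poly_monom\<close>)
  then have "poly ?P y = 0" by simp
  then show ?thesis by (simp add: poly_monom algebra_simps)
qed

lemma frob_add_pow: "(x + y) ^ (q ^ i) = x ^ (q ^ i) + (y::'k) ^ (q ^ i)"
proof (induction i)
  case (Suc i)
  have "z ^ (q ^ Suc i) = (z ^ (q ^ i)) ^ q" for z :: 'k
    by (simp add: mult.commute flip: power_mult)
  then show ?case by (simp only: Suc frob_add)
qed auto

lemma zero_pow_q_pow [simp]: "(0::'k) ^ (q ^ i) = 0"
  using q_gt_1 by (simp add: zero_power)

lemma frob_pow_pow: "((x::'k) ^ (q ^ i)) ^ (q ^ j) = x ^ (q ^ (i + j))"
  by (simp add: power_add flip: power_mult)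

lemma frob_diff: "(x - y) ^ (q ^ i) = x ^ (q ^ i) - (y::'k) ^ (q ^ i)"
  using frob_add_pow[of "x - y" y i] by (simp add: eq_diff_eq)

lemma frob_inj: "(x::'k) ^ (q ^ i) = y ^ (q ^ i) \<longleftrightarrow> x = y"
proof
  assume "x ^ (q ^ i) = y ^ (q ^ i)"
  then have "(x - y) ^ (q ^ i) = 0" by (simp add: frob_diff)
  then show "x = y" by simp
qed auto

lemma ex_root: "0 < n \<Longrightarrow> \<exists>y. y ^ n = (x::'k)"
proof -
  assume "0 < n"
  then have "0 < degree (monom 1 n - [:x:])"
    by (metis coeff_diff coeff_monom coeff_pCons_0 degree_0 degree_monom_eq degree_pCons_0 diff_0_right 
        gr0I le_degree leading_coeff_0_iff not_less zero_neq_one degree_of_nat nat_neq_iff coeff_eq_0)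
  then obtain y where "poly (monom 1 n - [:x:]) y = 0"
    using alg_closed_imp_poly_has_root by blast
  then show ?thesis by (auto simp: poly_monom)
qed

text \<open>X^q - X has at most \<open>q\<close> roots, and \<open>range emb\<close> already
  supplies that many.\<close>

lemma card_fixed_field: "card {c::'k. c ^ q = c} = q"
proof -
  let ?P = "monom 1 q - monom 1 1 :: 'k poly"
  have "coeff ?P q = 1" using q_gt_1 by simp
  then have "?P \<noteq> 0" by (metis coeff_0 zero_neq_one)
  have "degree ?P \<le> q"
    using q_gt_1 by (intro degree_diff_le) (auto simp: degree_monom_eq)
  have *: "{c::'k. c ^ q = c} = {c. poly ?P c = 0}"
    by (auto simp: poly_monom)
  have fin: "finite {c::'k. c ^ q = c}"
    unfolding * using \<open>?P \<noteq> 0\<close> by (rule poly_roots_finite)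
  have sub: "range emb \<subseteq> {c::'k. c ^ q = c}"
    by auto
  have "card {c::'k. c ^ q = c} \<le> q"
    unfolding * using card_poly_roots_bound[OF \<open>?P \<noteq> 0\<close>] \<open>degree ?P \<le> q\<close> by simp
  then show "card {c::'k. c ^ q = c} = q"
    using card_mono[OF fin sub] card_range_emb by simp
qed

section \<open>Multiplication and evaluation of twisted polynomials\<close>

lemma coeff_tmult: "coeff (tmult q u v) n = (\<Sum>i\<le>n. coeff u i * coeff v (n - i) ^ (q ^ i))"
  for u v :: "'k poly"
proof -
  let ?h = "\<lambda>i. coeff u i * coeff v (n - i) ^ (q ^ i)"
  have "coeff (tmult q u v) n = (\<Sum>i\<le>degree u. \<Sum>j\<le>degree v.
      if j = n - i \<and> i \<le> n then coeff u i * coeff v j ^ (q ^ i) else 0)"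
    unfolding tmult_def coeff_sum by (intro sum.cong refl) auto
  also have "\<dots> = (\<Sum>i\<le>degree u. if i \<le> n then ?h i else 0)"
    by (intro sum.cong refl) (auto simp: coeff_eq_0)
  also have "\<dots> = (\<Sum>i\<in>{..degree u} \<inter> {..n}. ?h i)"
    by (simp add: sum.inter_restrict del: Int_atMost)
  also have "\<dots> = (\<Sum>i\<le>n. ?h i)"
    by (intro sum.mono_neutral_left) (auto simp: coeff_eq_0)
  finally show ?thesis .
qed

lemma tmult_add_left: "tmult q (u + v) w = tmult q u w + tmult q v (w :: 'k poly)"
  and tmult_add_right: "tmult q w (u + v) = tmult q w u + tmult q w (v :: 'k poly)"
  by (auto simp: poly_eq_iff coeff_tmult algebra_simps sum.distrib frob_add_pow)

lemma tmult_smult_left: "tmult q (smult c u) v = smult c (tmult q u (v :: 'k poly))"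
  by (auto simp: poly_eq_iff coeff_tmult algebra_simps sum_distrib_left)

lemma tmult_0_left [simp]: "tmult q 0 v = (0 :: 'k poly)"
  and tmult_0_right [simp]: "tmult q v 0 = (0 :: 'k poly)"
  by (auto simp: poly_eq_iff coeff_tmult)

lemma tmult_diff_left: "tmult q (u - v) w = tmult q u w - tmult q v (w :: 'k poly)"
  using tmult_add_left[of "u - v" v w] by (simp add: eq_diff_eq)

lemma tmult_diff_right: "tmult q w (u - v) = tmult q w u - tmult q w (v :: 'k poly)"
  using tmult_add_right[of w "u - v" v] by (simp add: eq_diff_eq)

lemma tmult_sum_left: "tmult q (\<Sum>i\<in>S. f i) w = (\<Sum>i\<in>S. tmult q (f i) (w :: 'k poly))"
  by (induction S rule: infinite_finite_induct) (auto simp: tmult_add_left)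

lemma tmult_sum_right: "tmult q w (\<Sum>i\<in>S. f i) = (\<Sum>i\<in>S. tmult q w (f i :: 'k poly))"
  by (induction S rule: infinite_finite_induct) (auto simp: tmult_add_right)

lemma tmult_monom: "tmult q (monom a i) (monom b j) = monom (a * (b::'k) ^ (q ^ i)) (i + j)"
proof (rule poly_eqI)
  fix n
  have "coeff (tmult q (monom a i) (monom b j)) n =
      (\<Sum>l\<le>n. if l = i then a * coeff (monom b j) (n - l) ^ (q ^ l) else 0)"
    unfolding coeff_tmult by (intro sum.cong refl) simp
  also have "\<dots> = coeff (monom (a * b ^ (q ^ i)) (i + j)) n"
    using q_gt_1 by auto
  finally show "coeff (tmult q (monom a i) (monom b j)) n = \<dots>" .
qed

lemma tmult_assoc: "tmult q (tmult q u v) w = tmult q u (tmult q v (w :: 'k poly))"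
proof (induction u rule: poly_monom_induct)
  case (monom a i)
  show ?case
  proof (induction v rule: poly_monom_induct)
    case (monom b j)
    show ?case
    proof (induction w rule: poly_monom_induct)
      case (monom c l)
      show ?case
        by (simp add: tmult_monom frob_pow_pow power_mult_distrib algebra_simps)
    qed (simp add: tmult_add_right)
  qed (simp add: tmult_add_left tmult_add_right)
qed (simp add: tmult_add_left)

lemma tmult_const_left: "tmult q [:c:] u = smult c (u :: 'k poly)"
  by (induction u rule: poly_monom_induct)
     (auto simp: tmult_add_right smult_add_right tmult_monom smult_monom simp flip: monom_0)

text \<open>The q-power map fixes F_q, which is therefore central in k{\<tau>}.\<close>

lemma tmult_emb_right: "tmult q u [:emb c:] = smult (emb c) u"
  by (induction u rule: poly_monom_induct)
     (auto simp: tmult_add_left smult_add_right tmult_monom smult_monom mult.commute simp flip: monom_0)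

lemma tmult_1_left [simp]: "tmult q 1 u = (u :: 'k poly)"
  using tmult_const_left[of 1 u] by (simp flip: one_pCons)

lemma tmult_1_right [simp]: "tmult q u 1 = (u :: 'k poly)"
  using tmult_emb_right[of u 1] by (simp flip: one_pCons)

lemma coeff_tmult_bound:
  fixes u v :: "'k poly"
  assumes "degree u \<le> m" "degree v \<le> n"
  shows "coeff (tmult q u v) (m + n) = coeff u m * coeff v n ^ (q ^ m)"
proof -
  have "coeff (tmult q u v) (m + n) = (\<Sum>i\<in>{m}. coeff u i * coeff v (m + n - i) ^ (q ^ i))"
    unfolding coeff_tmult
  proof (intro sum.mono_neutral_right ballI)
    fix i assume "i \<in> {..m + n} - {m}"
    then consider "i < m" "n < m + n - i" | "m < i" by force
    then show "coeff u i * coeff v (m + n - i) ^ (q ^ i) = 0"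
      by cases (use assms in \<open>auto simp: coeff_eq_0\<close>)
  qed auto
  then show ?thesis by simp
qed

lemmas coeff_tmult_degree = coeff_tmult_bound[OF order_refl order_refl]

lemma degree_tmult_le: "degree (tmult q u v) \<le> degree u + degree (v :: 'k poly)"
proof (rule degree_le, intro allI impI)
  fix n assume n: "degree u + degree v < n"
  have "coeff u i * coeff v (n - i) ^ (q ^ i) = 0" for i
  proof (cases "i \<le> degree u")
    case True
    then have "coeff v (n - i) = 0" using n by (intro coeff_eq_0) simp
    then show ?thesis by simp
  qed (simp add: coeff_eq_0)
  then show "coeff (tmult q u v) n = 0"
    unfolding coeff_tmult by (intro sum.neutral) blast
qed

lemma degree_tmult:
  assumes "u \<noteq> 0" and "v \<noteq> (0 :: 'k poly)"
  shows "degree (tmult q u v) = degree u + degree v"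
proof (rule antisym[OF degree_tmult_le])
  have "coeff (tmult q u v) (degree u + degree v) \<noteq> 0"
    using assms by (simp add: coeff_tmult_degree)
  then show "degree u + degree v \<le> degree (tmult q u v)" by (rule le_degree)
qed

lemma tmult_eq_0_iff: "tmult q u v = 0 \<longleftrightarrow> u = 0 \<or> v = (0 :: 'k poly)"
proof (cases "u = 0 \<or> v = 0")
  case False
  then have "coeff (tmult q u v) (degree u + degree v) \<noteq> 0"
    by (simp add: coeff_tmult_degree)
  then show ?thesis using False by auto
qed auto

lemma tapply_bound:
  assumes "degree u \<le> n"
  shows "tapply q u x = (\<Sum>i\<le>n. coeff u i * (x::'k) ^ (q ^ i))"
  unfolding tapply_def by (intro sum.mono_neutral_left) (use assms in \<open>auto simp: coeff_eq_0\<close>)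

lemma tapply_add_left: "tapply q (u + v) x = tapply q u x + tapply q v (x::'k)"
proof -
  let ?n = "max (degree u) (degree v)"
  show ?thesis
    by (simp add: tapply_bound[of _ ?n] degree_add_le sum.distrib algebra_simps)
qed

lemma tapply_add: "tapply q u (x + y) = tapply q u x + tapply q u (y::'k)"
  by (simp add: tapply_def frob_add_pow algebra_simps sum.distrib)

lemma tapply_0 [simp]: "tapply q u 0 = (0::'k)"
  and tapply_0_left [simp]: "tapply q 0 x = (0::'k)"
  by (simp_all add: tapply_def)

lemma tapply_diff: "tapply q u (x - y) = tapply q u x - tapply q u (y::'k)"
  using tapply_add[of u "x - y" y] by (simp add: eq_diff_eq)

lemma tapply_diff_left: "tapply q (u - v) x = tapply q u x - tapply q v (x::'k)"
  using tapply_add_left[of "u - v" v x] by (simp add: eq_diff_eq)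

lemma tapply_sum: "tapply q u (\<Sum>i\<in>S. f i) = (\<Sum>i\<in>S. tapply q u (f i :: 'k))"
  by (induction S rule: infinite_finite_induct) (auto simp: tapply_add)

lemma tapply_monom: "tapply q (monom a n) x = a * (x::'k) ^ (q ^ n)"
proof -
  have "tapply q (monom a n) x = (\<Sum>i\<le>n. if i = n then a * x ^ (q ^ n) else 0)"
    unfolding tapply_bound[OF degree_monom_le] by (intro sum.cong) auto
  then show ?thesis by simp
qed

lemma tapply_const: "tapply q [:c:] x = c * (x::'k)"
  using tapply_monom[of c 0 x] by (simp add: monom_0)

lemma tapply_tmult: "tapply q (tmult q u v) x = tapply q u (tapply q v (x::'k))"
proof (induction u rule: poly_monom_induct)
  case (monom a i)
  show ?case
    by (induction v rule: poly_monom_induct)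
       (auto simp: tmult_monom tapply_monom tmult_add_right tapply_add_left frob_add_pow
          algebra_simps power_mult_distrib frob_pow_pow add.commute)
qed (simp add: tmult_add_left tapply_add_left)

text \<open>Written as an ordinary polynomial in x, a twisted polynomial of \<tau>-degree n has
  degree q^n. Every distance estimate for the code rests on this bound.\<close>

lemma card_tapply_roots:
  assumes "u \<noteq> 0"
  shows "finite {x::'k. tapply q u x = 0}" and "card {x::'k. tapply q u x = 0} \<le> q ^ degree u"
proof -
  let ?P = "\<Sum>i\<le>degree u. monom (coeff u i) (q ^ i)"
  have "coeff ?P (q ^ degree u) = (\<Sum>i\<le>degree u. if i = degree u then coeff u i else 0)"
    unfolding coeff_sum by (intro sum.cong) (use q_gt_1 in auto)
  then have "?P \<noteq> 0" using assms by auto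
  have eq: "{x::'k. tapply q u x = 0} = {x. poly ?P x = 0}"
    by (simp add: tapply_def poly_sum poly_monom)
  show "finite {x::'k. tapply q u x = 0}"
    unfolding eq using \<open>?P \<noteq> 0\<close> by (rule poly_roots_finite)
  have "degree ?P \<le> q ^ degree u"
  proof (rule degree_sum_le)
    fix i assume "i \<in> {..degree u}"
    then have "q ^ i \<le> q ^ degree u" using q_gt_1 by (intro power_increasing) auto
    then show "degree (monom (coeff u i) (q ^ i)) \<le> q ^ degree u"
      using degree_monom_le le_trans by blast
  qed simp
  then show "card {x::'k. tapply q u x = 0} \<le> q ^ degree u"
    unfolding eq using card_poly_roots_bound[OF \<open>?P \<noteq> 0\<close>] by simp
qed

end

section \<open>Drinfeld modules and their endomorphisms\<close>

locale drinfeld = A_field \<gamma> q for \<gamma> :: "'f::{field,finite} poly \<Rightarrow> 'k::alg_closed_field" and q +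
  fixes \<phi> :: "'f poly \<Rightarrow> 'k poly" and r :: nat
  assumes dm: "drinfeld_module \<gamma> r \<phi>"
begin

lemma r_pos: "0 < r"
  and \<phi>_add: "\<phi> (a + b) = \<phi> a + \<phi> b"
  and \<phi>_mult: "\<phi> (a * b) = tmult q (\<phi> a) (\<phi> b)"
  and \<phi>_const: "\<phi> [:x:] = [:emb x:]"
  and coeff_\<phi>T_0: "coeff (\<phi> [:0, 1:]) 0 = \<gamma> [:0, 1:]"
  and degree_\<phi>T: "degree (\<phi> [:0, 1:]) = r"
  using dm unfolding drinfeld_module_def emb_def q_eq by auto

lemma \<phi>_0 [simp]: "\<phi> 0 = 0"
  using \<phi>_const[of 0] by simp

lemma \<phi>_1 [simp]: "\<phi> 1 = 1"
  using \<phi>_const[of 1] by (simp flip: one_pCons)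

lemma \<phi>_diff: "\<phi> (a - b) = \<phi> a - \<phi> b"
  using \<phi>_add[of "a - b" b] by (simp add: eq_diff_eq)

definition P where "P = \<phi> [:0, 1:]"

lemma P_nonzero: "P \<noteq> 0"
  using r_pos degree_\<phi>T unfolding P_def by force

lemma degree_P: "degree P = r"
  by (simp add: P_def degree_\<phi>T)

lemma \<phi>_pCons: "\<phi> (pCons c a) = [:emb c:] + tmult q (\<phi> a) P"
proof -
  have "pCons c a = [:c:] + a * [:0, 1:]" by simp
  then show ?thesis by (simp only: \<phi>_add \<phi>_const \<phi>_mult P_def)
qed

lemma degree_\<phi>: "a \<noteq> 0 \<Longrightarrow> \<phi> a \<noteq> 0 \<and> degree (\<phi> a) = r * degree a"
proof (induction a)
  case (pCons c a)
  show ?case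
  proof (cases "a = 0")
    case True
    then show ?thesis using pCons by (simp add: \<phi>_const)
  next
    case False
    then have "degree (tmult q (\<phi> a) P) = r * degree a + r"
      using pCons by (simp add: degree_tmult P_nonzero degree_P)
    then have "degree (\<phi> (pCons c a)) = r * degree a + r"
      unfolding \<phi>_pCons using r_pos by (subst degree_add_eq_right) auto
    then show ?thesis using r_pos False by auto
  qed
qed auto

text \<open>T generates A over F_q, and constants from F_q are central, so commuting with
  \<open>P\<close> alone suffices.\<close>

lemma End_ring_iff: "u \<in> End_ring \<phi> \<longleftrightarrow> tmult q u P = tmult q P u"
proof
  assume "u \<in> End_ring \<phi>"
  then show "tmult q u P = tmult q P u"
    unfolding End_ring_def P_def q_eq by auto
next
  assume *: "tmult q u P = tmult q P u"
  have "tmult q u (\<phi> a) = tmult q (\<phi> a) u" for a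
  proof (induction a)
    case (pCons c a)
    have "tmult q u (tmult q (\<phi> a) P) = tmult q (tmult q (\<phi> a) P) u"
      by (metis tmult_assoc pCons.IH *)
    then show ?case
      by (simp add: \<phi>_pCons tmult_add_left tmult_add_right tmult_emb_right tmult_const_left)
  qed auto
  then show "u \<in> End_ring \<phi>" unfolding End_ring_def q_eq by auto
qed

end

section \<open>Linear algebra and semilinear maps\<close>

definition linear_form :: "('a::field \<Rightarrow> 'b::ab_group_add \<Rightarrow> 'b) \<Rightarrow> ('b \<Rightarrow> 'a) \<Rightarrow> bool" where
  "linear_form sc l \<longleftrightarrow> (\<forall>x y. l (x + y) = l x + l y) \<and> (\<forall>c x. l (sc c x) = c * l x)"

context vector_space
begin

lemma finite_basis_of_subspace:
  assumes "finite B" and "subspace V" and "V \<subseteq> span B"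
  obtains B' where "finite B'" "independent B'" "span B' = V"
proof -
  obtain B' where B': "B' \<subseteq> V" "independent B'" "V \<subseteq> span B'" "card B' = dim V"
    by (rule basis_exists)
  have "B' \<subseteq> span B" using B'(1) assms(3) by (rule subset_trans)
  from independent_span_bound[OF assms(1) B'(2) this] have "finite B'" ..
  moreover have "span B' = V"
    using B'(1,3) assms(2) by (rule span_subspace)
  ultimately show ?thesis using that[OF _ B'(2)] by simp
qed

lemma card_eq_of_span_eq:
  assumes "finite B" "independent B" "finite B'" "independent B'" "span B = span B'"
  shows "card B = card B'"
proof (rule antisym)
  have "B \<subseteq> span B'" unfolding assms(5)[symmetric] by (rule span_superset)
  from independent_span_bound[OF assms(3,2) this] show "card B \<le> card B'" ..
  have "B' \<subseteq> span B" unfolding assms(5) by (rule span_superset)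
  from independent_span_bound[OF assms(1,4) this] show "card B' \<le> card B" ..
qed

lemma linear_form_add: "linear_form scale l \<Longrightarrow> l (x + y) = l x + l y"
  and linear_form_scale: "linear_form scale l \<Longrightarrow> l (scale c x) = c * l x"
  by (auto simp: linear_form_def)

lemma linear_form_0: "linear_form scale l \<Longrightarrow> l 0 = 0"
  using linear_form_scale[of l 0 0] by simp

lemma linear_form_diff: "linear_form scale l \<Longrightarrow> l (x - y) = l x - l y"
  using linear_form_add[of l "x - y" y] unfolding diff_add_cancel eq_diff_eq by (rule sym)

lemma linear_form_sum:
  assumes "linear_form scale l"
  shows "l (\<Sum>i\<in>I. f i) = (\<Sum>i\<in>I. l (f i))"
  by (induction I rule: infinite_finite_induct)
    (auto simp: linear_form_0[OF assms] linear_form_add[OF assms])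

lemma kernel_of_functional:
  assumes B: "finite B" "independent B" and l: "linear_form scale l"
  obtains B' where "finite B'" "independent B'" "span B' = {x \<in> span B. l x = 0}"
    "card B \<le> Suc (card B')" "(\<exists>x\<in>span B. l x \<noteq> 0) \<longrightarrow> card B = Suc (card B')"
proof -
  let ?K = "{x \<in> span B. l x = 0}"
  have "subspace ?K"
    by (intro subspaceI)
      (auto simp: linear_form_0[OF l] linear_form_add[OF l] linear_form_scale[OF l] span_add span_scale span_zero)
  then obtain B' where B': "finite B'" "independent B'" "span B' = ?K"
    by (rule finite_basis_of_subspace[OF B(1)]) auto
  show ?thesis
  proof (cases "\<exists>x\<in>span B. l x \<noteq> 0")
    case False
    then have "card B' = card B"
      using B' by (intro card_eq_of_span_eq) (use B in auto)
    then show ?thesis using that B' False by auto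
  next
    case True
    then obtain b where b: "b \<in> span B" "l b \<noteq> 0" by blast
    then have nb: "b \<notin> span B'" using B' by auto
    then have "independent (insert b B')"
      using B' by (intro independent_insertI)
    moreover have "span (insert b B') = span B"
    proof
      show "span (insert b B') \<subseteq> span B"
        using b B' span_superset[of B'] by (intro span_minimal) auto
      show "span B \<subseteq> span (insert b B')"
      proof
        fix x assume x: "x \<in> span B"
        have "x - scale (l x / l b) b \<in> ?K"
          using b x by (auto simp: linear_form_diff[OF l] linear_form_scale[OF l] span_diff span_scale)
        then show "x \<in> span (insert b B')"
          unfolding B'(3)[symmetric] span_breakdown_eq by blast
      qed
    qed
    ultimately have "card (insert b B') = card B"
      using B B' by (intro card_eq_of_span_eq) auto
    moreover have "b \<notin> B'" using nb span_base by blast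
    ultimately show ?thesis using that B' by auto
  qed
qed

text \<open>Each functional lowers the dimension by at most one. The last clause is a triangularity
  criterion for independence: the witness for \<open>i\<close> is killed by every other functional
  whose weight does not exceed that of \<open>i\<close>. The induction therefore adds functionals in
  order of increasing weight.\<close>

lemma kernel_of_functionals:
  fixes l :: "'i \<Rightarrow> 'b \<Rightarrow> 'a" and w :: "'i \<Rightarrow> int"
  assumes B: "finite B" "independent B" and I: "finite I"
    and l: "\<And>i. i \<in> I \<Longrightarrow> linear_form scale (l i)"
  shows "\<exists>B'. finite B' \<and> independent B' \<and> span B' = {x \<in> span B. \<forall>i\<in>I. l i x = 0} \<and>
    card B \<le> card B' + card I \<and>
    ((\<forall>i\<in>I. \<exists>e\<in>span B. l i e \<noteq> 0 \<and> (\<forall>j\<in>I. j \<noteq> i \<longrightarrow> w j \<le> w i \<longrightarrow> l j e = 0))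
       \<longrightarrow> card B = card B' + card I)"
  using I l
proof (induction I rule: finite_ranking_induct[where f = w])
  case empty
  then show ?case using B by auto
next
  case (insert i I)
  have li: "linear_form scale (l i)" by (rule insert.prems) simp
  have IH: "\<exists>B'. finite B' \<and> independent B' \<and> span B' = {x \<in> span B. \<forall>i\<in>I. l i x = 0} \<and>
      card B \<le> card B' + card I \<and>
      ((\<forall>i\<in>I. \<exists>e\<in>span B. l i e \<noteq> 0 \<and> (\<forall>j\<in>I. j \<noteq> i \<longrightarrow> w j \<le> w i \<longrightarrow> l j e = 0))
         \<longrightarrow> card B = card B' + card I)"
    by (rule insert.IH) (rule insert.prems, simp)
  show ?case
  proof (cases "i \<in> I")
    case True
    then show ?thesis using IH by (simp only: insert_absorb)
  next
    case False
    from IH obtain C where C': "finite C \<and> independent C \<and> span C = {x \<in> span B. \<forall>i\<in>I. l i x = 0} \<and>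
      card B \<le> card C + card I \<and>
      ((\<forall>i\<in>I. \<exists>e\<in>span B. l i e \<noteq> 0 \<and> (\<forall>j\<in>I. j \<noteq> i \<longrightarrow> w j \<le> w i \<longrightarrow> l j e = 0))
         \<longrightarrow> card B = card C + card I)" ..
    note C = C'[THEN conjunct1] C'[THEN conjunct2, THEN conjunct1]
      C'[THEN conjunct2, THEN conjunct2, THEN conjunct1]
      C'[THEN conjunct2, THEN conjunct2, THEN conjunct2, THEN conjunct1]
      C'[THEN conjunct2, THEN conjunct2, THEN conjunct2, THEN conjunct2]
    obtain D where D: "finite D" "independent D" "span D = {x \<in> span C. l i x = 0}"
      "card C \<le> Suc (card D)" "(\<exists>x\<in>span C. l i x \<noteq> 0) \<longrightarrow> card C = Suc (card D)"
      by (rule kernel_of_functional[OF C(1,2) li])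
    have card_insert: "card (insert i I) = Suc (card I)"
      using False insert.hyps by simp
    show ?thesis
    proof (intro exI[of _ D] conjI impI)
      show "finite D" "independent D" by (rule D)+
      show "span D = {x \<in> span B. \<forall>i\<in>insert i I. l i x = 0}"
        unfolding D(3) C(3) by blast
      show "card B \<le> card D + card (insert i I)"
        using C(4) D(4) card_insert by simp
      assume e: "\<forall>i'\<in>insert i I. \<exists>e\<in>span B. l i' e \<noteq> 0 \<and>
        (\<forall>j\<in>insert i I. j \<noteq> i' \<longrightarrow> w j \<le> w i' \<longrightarrow> l j e = 0)"
      from bspec[OF this insertI1] obtain e0 where e0: "e0 \<in> span B" "l i e0 \<noteq> 0"
        "\<forall>j\<in>insert i I. j \<noteq> i \<longrightarrow> w j \<le> w i \<longrightarrow> l j e0 = 0" by blast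
      \<comment> \<open>\<open>i\<close> has the largest weight so far, so its witness lies in the
        common kernel of the functionals already imposed.\<close>
      have "l j e0 = 0" if "j \<in> I" for j
      proof -
        have "j \<noteq> i" using that False by auto
        then show ?thesis using e0(3) that insert.hyps(2)[OF that] by auto
      qed
      then have "e0 \<in> span C" unfolding C(3) using e0(1) by blast
      then have "card C = Suc (card D)" using D(5) e0(2) by blast
      moreover have "card B = card C + card I"
      proof (rule C(5)[THEN mp], rule ballI)
        fix i' assume "i' \<in> I"
        then show "\<exists>e\<in>span B. l i' e \<noteq> 0 \<and> (\<forall>j\<in>I. j \<noteq> i' \<longrightarrow> w j \<le> w i' \<longrightarrow> l j e = 0)"
          using bspec[OF e, of i'] by blast
      qed
      ultimately show "card B = card D + card (insert i I)"
        using card_insert by simp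
    qed
  qed
qed

lemma basis_of_dual_family:
  fixes l :: "'i \<Rightarrow> 'b \<Rightarrow> 'a"
  assumes V: "subspace V" and I: "finite I" and l: "\<And>i. i \<in> I \<Longrightarrow> linear_form scale (l i)"
    and e: "\<And>i. i \<in> I \<Longrightarrow> e i \<in> V"
      "\<And>i j. i \<in> I \<Longrightarrow> j \<in> I \<Longrightarrow> l i (e j) = (if i = j then 1 else 0)"
    and inj: "\<And>x. x \<in> V \<Longrightarrow> (\<And>i. i \<in> I \<Longrightarrow> l i x = 0) \<Longrightarrow> x = 0"
  shows "finite (e ` I)" "independent (e ` I)" "span (e ` I) = V" "card (e ` I) = card I"
proof -
  have inj_e: "inj_on e I"
  proof (rule inj_onI)
    fix i j assume ij: "i \<in> I" "j \<in> I" "e i = e j"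
    then show "i = j" using e(2)[of i i] e(2)[of i j] by (simp split: if_splits)
  qed
  then show "card (e ` I) = card I" by (rule card_image)
  show "finite (e ` I)" using I by simp
  show "independent (e ` I)"
  proof (rule independent_if_scalars_zero[OF \<open>finite (e ` I)\<close>])
    fix f x assume *: "(\<Sum>x\<in>e ` I. scale (f x) x) = 0" and "x \<in> e ` I"
    then obtain i where i: "i \<in> I" "x = e i" by auto
    from * have "l i (\<Sum>j\<in>I. scale (f (e j)) (e j)) = 0"
      using linear_form_0[OF l[OF i(1)]] by (simp add: sum.reindex[OF inj_e])
    then have "(\<Sum>j\<in>I. f (e j) * l i (e j)) = 0"
      by (simp add: linear_form_sum[OF l[OF i(1)]] linear_form_scale[OF l[OF i(1)]])
    moreover have "(\<Sum>j\<in>I. f (e j) * l i (e j)) = (\<Sum>j\<in>I. if j = i then f (e i) else 0)"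
      by (intro sum.cong) (use e(2) i in auto)
    ultimately show "f x = 0" using I i by simp
  qed
  show "span (e ` I) = V"
  proof
    show "span (e ` I) \<subseteq> V" using V e(1) by (intro span_minimal) auto
    show "V \<subseteq> span (e ` I)"
    proof
      fix x assume x: "x \<in> V"
      let ?y = "\<Sum>j\<in>I. scale (l j x) (e j)"
      have "?y \<in> V" using V e(1) by (intro subspace_sum) (auto intro: subspace_scale)
      have "x - ?y = 0"
      proof (rule inj)
        show "x - ?y \<in> V" using V x \<open>?y \<in> V\<close> by (rule subspace_diff)
        fix i assume i: "i \<in> I"
        have "l i ?y = (\<Sum>j\<in>I. l j x * l i (e j))"
          by (simp add: linear_form_sum[OF l[OF i]] linear_form_scale[OF l[OF i]])
        also have "\<dots> = (\<Sum>j\<in>I. if j = i then l i x else 0)"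
          by (intro sum.cong) (use e(2) i in auto)
        finally show "l i (x - ?y) = 0" using I i by (simp add: linear_form_diff[OF l[OF i]])
      qed
      then have "x = ?y" by simp
      also have "?y \<in> span (e ` I)" by (intro span_sum span_scale span_base) auto
      finally show "x \<in> span (e ` I)" .
    qed
  qed
qed

text \<open>\<open>K\<close> is left arbitrary: it is the fixed field when fixed vectors are
  counted, and the whole field when the size of a code is compared with its dimension.\<close>

lemma card_combinations:
  assumes "finite B" "independent B"
  shows "card ((\<lambda>u. \<Sum>b\<in>B. scale (u b) b) ` (B \<rightarrow>\<^sub>E K)) = card K ^ card B"
proof -
  have "inj_on (\<lambda>u. \<Sum>b\<in>B. scale (u b) b) (B \<rightarrow>\<^sub>E K)"
  proof (rule inj_onI)
    fix u v assume uv: "u \<in> B \<rightarrow>\<^sub>E K" "v \<in> B \<rightarrow>\<^sub>E K"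
      "(\<Sum>b\<in>B. scale (u b) b) = (\<Sum>b\<in>B. scale (v b) b)"
    then have "(\<Sum>b\<in>B. scale (u b - v b) b) = 0"
      by (simp add: scale_left_diff_distrib sum_subtractf)
    then have "u b - v b = 0" if "b \<in> B" for b
      using independentD[OF assms(2,1) subset_refl _ that, of "\<lambda>b. u b - v b"] by simp
    then show "u = v" using uv by (intro PiE_ext) auto
  qed
  then show ?thesis using assms by (simp add: card_image card_PiE)
qed

lemma card_subspace:
  assumes "finite S" "subspace S" "finite (UNIV :: 'a set)"
  shows "card S = CARD('a) ^ dim S"
proof -
  obtain B where B: "B \<subseteq> S" "independent B" "S \<subseteq> span B" "card B = dim S"
    by (rule basis_exists)
  have fB: "finite B" using B assms finite_subset by blast
  have "S = span B" using B assms by (simp add: span_subspace)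
  also have "\<dots> = (\<lambda>u. \<Sum>b\<in>B. scale (u b) b) ` (B \<rightarrow>\<^sub>E UNIV)"
  proof -
    have "(\<Sum>b\<in>B. scale (u b) b) \<in> (\<lambda>u. \<Sum>b\<in>B. scale (u b) b) ` (B \<rightarrow>\<^sub>E UNIV)" for u
      by (rule image_eqI[of _ _ "restrict u B"]) auto
    then show ?thesis unfolding span_finite[OF fB] by blast
  qed
  finally show ?thesis using card_combinations[OF fB B(2)] B(4) by simp
qed

end

section \<open>Lang's theorem for semilinear maps\<close>

context A_field
begin

text \<open>This solves \<open>\<rho> z - z = w\<close> one coordinate at a time on a span of fixed
  vectors.\<close>

lemma artin_schreier: "\<exists>t::'k. t - t ^ q = c"
proof -
  let ?P = "monom 1 q - monom 1 1 + [:c:] :: 'k poly"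
  have "coeff ?P q = 1" using q_gt_1 by (auto simp: coeff_pCons split: nat.splits)
  then have "0 < degree ?P" using q_gt_1 le_degree[of ?P q] by simp
  then obtain t where "poly ?P t = 0" using alg_closed_imp_poly_has_root by blast
  then show ?thesis by (intro exI[of _ t]) (simp add: poly_monom algebra_simps)
qed

text \<open>
  The fixed vector equation on a cyclic subspace, after eliminating all coordinates in favour of the last one.
\<close>

fun fixed_vector_poly :: "(nat \<Rightarrow> 'k) \<Rightarrow> nat \<Rightarrow> 'k poly" where
  "fixed_vector_poly c 0 = [:0, 1:]"
| "fixed_vector_poly c (Suc m) = fixed_vector_poly c m ^ q - smult (c m) [:0, 1:]"

lemma fixed_vector_poly_nonzero: "fixed_vector_poly c m \<noteq> 0 \<and> 0 < degree (fixed_vector_poly c m)"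
proof (induction m)
  case (Suc m)
  have "1 < degree (fixed_vector_poly c m ^ q)"
    using Suc mult_le_mono[of 2 q 1 "degree (fixed_vector_poly c m)"] q_ge_2 by (simp add: degree_power_eq)
  moreover have "degree (smult (c m) [:0, 1:]) \<le> 1"
    by (rule order_trans[OF degree_smult_le]) simp
  ultimately have "degree (fixed_vector_poly c (Suc m)) = degree (fixed_vector_poly c m ^ q)"
    using \<open>1 < degree (fixed_vector_poly c m ^ q)\<close> unfolding fixed_vector_poly.simps diff_conv_add_uminus
    by (intro degree_add_eq_left) simp
  then show ?case using \<open>1 < degree (fixed_vector_poly c m ^ q)\<close> by force
qed auto

lemma fixed_vector_poly_dvd: "[:0, 1:] dvd fixed_vector_poly c m"
proof (induction m)
  case (Suc m)
  then have "[:0, 1:] dvd fixed_vector_poly c m ^ q" using q_gt_1 by (meson dvd_power dvd_trans less_trans zero_less_one)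
  moreover have "[:0, 1:] dvd smult (c m) [:0, 1:]" by (rule dvd_smult) simp
  ultimately show ?case unfolding fixed_vector_poly.simps by (rule dvd_diff)
qed auto

text \<open>Zero is always a root. If the preceding polynomial is X H, the new one is X times
  X^(q-1) H^q - \<open>c m\<close>, and the second factor does not vanish at zero.\<close>

lemma fixed_vector_poly_root:
  assumes "c m \<noteq> 0"
  shows "\<exists>y. y \<noteq> 0 \<and> poly (fixed_vector_poly c (Suc m)) y = 0"
proof -
  obtain H where H: "fixed_vector_poly c m = [:0, 1:] * H" using fixed_vector_poly_dvd[of c m] by (rule dvdE)
  have "H \<noteq> 0" using H fixed_vector_poly_nonzero[of c m] by auto
  let ?P = "monom 1 (q - 1) * H ^ q - [:c m:]"
  have "degree (monom 1 (q - 1) * H ^ q) = q - 1 + degree (H ^ q)"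
    using \<open>H \<noteq> 0\<close> by (subst degree_mult_eq) (auto simp: degree_monom_eq)
  then have "0 < degree (monom 1 (q - 1) * H ^ q)" using q_gt_1 by simp
  then have "0 < degree ?P"
    unfolding diff_conv_add_uminus by (subst degree_add_eq_left) auto
  then obtain y where "poly ?P y = 0" using alg_closed_imp_poly_has_root by blast
  then have y: "y ^ (q - 1) * poly H y ^ q = c m" by (simp add: poly_monom)
  then have "y \<noteq> 0" using assms q_gt_1 by (auto simp: zero_power)
  have "poly (fixed_vector_poly c (Suc m)) y = y ^ q * poly H y ^ q - c m * y"
    by (simp add: H power_mult_distrib)
  also have "\<dots> = y * (y ^ (q - 1) * poly H y ^ q) - c m * y"
    using q_gt_1 by (cases q) auto
  also have "\<dots> = 0" unfolding y by simp
  finally show ?thesis using \<open>y \<noteq> 0\<close> by blast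
qed

end

text \<open>Division by \<tau> is semilinear for the inverse of Frobenius. Writing the scalar as
  \<open>c ^ q\<close> on the left-hand side expresses this without mentioning q-th roots.\<close>

locale semilinear_map = A_field \<gamma> q + vector_space sc
  for \<gamma> :: "'f::{field,finite} poly \<Rightarrow> 'k::alg_closed_field" and q
    and sc :: "'k \<Rightarrow> 'b::ab_group_add \<Rightarrow> 'b" +
  fixes V :: "'b set" and \<rho> :: "'b \<Rightarrow> 'b"
  assumes V: "subspace V"
    and \<rho>_in: "x \<in> V \<Longrightarrow> \<rho> x \<in> V"
    and \<rho>_add: "x \<in> V \<Longrightarrow> y \<in> V \<Longrightarrow> \<rho> (x + y) = \<rho> x + \<rho> y"
    and \<rho>_scale: "x \<in> V \<Longrightarrow> \<rho> (sc (c ^ q) x) = sc c (\<rho> x)"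
    and \<rho>_inj: "x \<in> V \<Longrightarrow> \<rho> x = 0 \<Longrightarrow> x = 0"
begin

lemma \<rho>_0: "\<rho> 0 = 0"
  using \<rho>_add[of 0 0] subspace_0[OF V] by (metis add_0_right add_left_imp_eq)

lemma \<rho>_eqD: "x \<in> V \<Longrightarrow> y \<in> V \<Longrightarrow> \<rho> x = \<rho> y \<Longrightarrow> x = y"
  using \<rho>_add[of "x - y" y] \<rho>_inj[of "x - y"] subspace_diff[OF V] by auto

lemma \<rho>_sum: "(\<And>i. i \<in> I \<Longrightarrow> f i \<in> V) \<Longrightarrow> \<rho> (\<Sum>i\<in>I. f i) = (\<Sum>i\<in>I. \<rho> (f i))"
proof (induction I rule: infinite_finite_induct)
  case (insert x F)
  then show ?case using \<rho>_add[of "f x" "sum f F"] subspace_sum[OF V, of F f] by auto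
qed (auto simp: \<rho>_0)

definition "Fix = {x \<in> V. \<rho> x = x}"

lemma span_Fix_subset: "span Fix \<subseteq> V"
  using V by (intro span_minimal) (auto simp: Fix_def)

lemma \<rho>_preimage_span_Fix: "y \<in> span Fix \<Longrightarrow> \<exists>x\<in>span Fix. \<rho> x = y"
proof (induction rule: span_induct_alt)
  case base
  then show ?case using \<rho>_0 span_zero by blast
next
  case (step c b y)
  then obtain x where x: "x \<in> span Fix" "\<rho> x = y" by blast
  have b: "b \<in> V" "\<rho> b = b" using step by (auto simp: Fix_def)
  have "\<rho> (sc (c ^ q) b + x) = sc c b + y"
    using b x span_Fix_subset by (subst \<rho>_add) (auto simp: \<rho>_scale subspace_scale[OF V])
  moreover have "sc (c ^ q) b + x \<in> span Fix"
    using step x by (auto intro: span_add span_scale span_base)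
  ultimately show ?case by blast
qed

text \<open>\<open>\<rho>\<close> is injective and already maps \<open>span Fix\<close> onto itself,
  so no vector from outside can enter it.\<close>

lemma \<rho>_in_span_Fix: "x \<in> V \<Longrightarrow> \<rho> x \<in> span Fix \<Longrightarrow> x \<in> span Fix"
  using \<rho>_preimage_span_Fix[of "\<rho> x"] \<rho>_eqD[of _ x] span_Fix_subset by blast

lemma \<rho>_minus_id_surj: "w \<in> span Fix \<Longrightarrow> \<exists>z\<in>span Fix. \<rho> z - z = w"
proof (induction rule: span_induct_alt)
  case base
  then show ?case using \<rho>_0 span_zero by (intro bexI[of _ 0]) auto
next
  case (step c b y)
  then obtain x where x: "x \<in> span Fix" "\<rho> x - x = y" by blast
  have b: "b \<in> V" "\<rho> b = b" using step by (auto simp: Fix_def)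
  obtain t where t: "t - t ^ q = c" using artin_schreier by blast
  have "\<rho> (sc (t ^ q) b + x) - (sc (t ^ q) b + x) = sc t b - sc (t ^ q) b + (\<rho> x - x)"
    using b x span_Fix_subset by (subst \<rho>_add) (auto simp: \<rho>_scale subspace_scale[OF V])
  also have "\<dots> = sc c b + y" using x t by (simp flip: scale_left_diff_distrib)
  finally have "\<rho> (sc (t ^ q) b + x) - (sc (t ^ q) b + x) = sc c b + y" .
  moreover have "sc (t ^ q) b + x \<in> span Fix"
    using step x by (auto intro: span_add span_scale span_base)
  ultimately show ?case by blast
qed

text \<open>
  A vector outside \<open>span Fix\<close> generates modulo \<open>span Fix\<close> a cyclic subspace, in which a root of
  \<open>fixed_vector_poly\<close> gives a nonzero vector fixed modulo \<open>span Fix\<close>; subtracting a suitable element of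
  \<open>span Fix\<close> makes it fixed.
\<close>

lemma span_Fix: "finite B \<Longrightarrow> V \<subseteq> span B \<Longrightarrow> span Fix = V"
proof (intro antisym span_Fix_subset subsetI, rule ccontr)
  assume B: "finite B" "V \<subseteq> span B"
  fix v assume v: "v \<in> V" "v \<notin> span Fix"
  define vs where "vs n = (\<rho> ^^ n) v" for n
  have vs_Suc: "vs (Suc n) = \<rho> (vs n)" for n by (simp add: vs_def)
  have vs_in: "vs n \<in> V" for n
    by (induction n) (auto simp: vs_Suc \<rho>_in, simp add: vs_def v)
  define S where "S n = span (Fix \<union> vs ` {..<n})" for n
  have S_Suc: "x \<in> S (Suc n) \<longleftrightarrow> (\<exists>k. x - sc k (vs n) \<in> S n)" for x n
  proof -
    have "Fix \<union> vs ` {..<Suc n} = insert (vs n) (Fix \<union> vs ` {..<n})"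
      by (auto simp: less_Suc_eq)
    then show ?thesis by (simp add: S_def span_breakdown_eq)
  qed
  have comb: "\<exists>a. x - (\<Sum>l<n. sc (a l) (vs l)) \<in> span Fix" if "x \<in> S n" for x n
    using that
  proof (induction n arbitrary: x)
    case 0
    then show ?case by (auto simp: S_def)
  next
    case (Suc n)
    then obtain k where "x - sc k (vs n) \<in> S n" using S_Suc by blast
    from Suc.IH[OF this] obtain a where a: "x - sc k (vs n) - (\<Sum>l<n. sc (a l) (vs l)) \<in> span Fix"
      by blast
    have "(\<Sum>l<n. sc ((a(n := k)) l) (vs l)) = (\<Sum>l<n. sc (a l) (vs l))"
      by (intro sum.cong) auto
    with a show ?case by (intro exI[of _ "a(n := k)"]) (simp add: algebra_simps)
  qed
  have S_mono: "S m \<subseteq> S n" if "m \<le> n" for m n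
    unfolding S_def using that by (intro span_mono) auto
  have Fix_S: "span Fix \<subseteq> S n" for n
    unfolding S_def by (intro span_mono) auto
  have S_combI: "(\<Sum>l<n. sc (a l) (vs l)) \<in> S n" for a n
    unfolding S_def by (intro span_sum span_scale span_base) auto
  have S_add: "x + y \<in> S n" if "x \<in> S n" "y \<in> S n" for x y n
    using that unfolding S_def by (rule span_add)
  have "\<exists>n. vs n \<in> S n"
  proof (rule ccontr)
    assume "\<not> ?thesis"
    then have no: "vs n \<notin> S n" for n by simp
    have *: "independent (vs ` {..<n}) \<and> card (vs ` {..<n}) = n" for n
    proof (induction n)
      case (Suc n)
      have "span (vs ` {..<n}) \<subseteq> S n" unfolding S_def by (rule span_mono) simp
      then have 1: "vs n \<notin> span (vs ` {..<n})"
        using no[of n] by (rule contra_subsetD)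
      then have "vs n \<notin> vs ` {..<n}" using span_superset by (rule contra_subsetD[rotated])
      then show ?case
        using Suc 1 by (simp add: lessThan_Suc independent_insertI)
    qed (simp add: independent_empty)
    have "vs ` {..<Suc (card B)} \<subseteq> span B"
      by (rule image_subsetI) (rule subsetD[OF B(2) vs_in])
    from independent_span_bound[OF B(1) _ this] *[of "Suc (card B)"] show False by simp
  qed
  define n where "n = (LEAST n. vs n \<in> S n)"
  have n: "vs n \<in> S n"
    unfolding n_def by (rule LeastI_ex) fact
  have least: "vs m \<notin> S m" if "m < n" for m
    using that unfolding n_def by (rule not_less_Least)
  have "n \<noteq> 0" using n v by (cases n) (auto simp: S_def vs_def)
  then obtain N where N: "n = Suc N" by (cases n) auto
  obtain a where a: "vs n - (\<Sum>l<n. sc (a l) (vs l)) \<in> span Fix"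
    using comb[OF n] by blast
  \<comment> \<open>Otherwise the relation is, modulo \<open>span Fix\<close>, the image under
    \<open>\<rho>\<close> of a relation that expresses \<open>vs N\<close> by its predecessors.
    Since \<open>\<rho>\<close> cannot carry an outside vector into \<open>span Fix\<close>, this
    contradicts the minimality of \<open>n\<close>.\<close>
  have "a 0 \<noteq> 0"
  proof
    assume a0: "a 0 = 0"
    define y where "y = (\<Sum>l<N. sc (a (Suc l) ^ q) (vs l))"
    have yV: "y \<in> V"
      unfolding y_def by (intro subspace_sum[OF V] subspace_scale[OF V] vs_in)
    have dV: "vs N - y \<in> V" using V vs_in yV by (rule subspace_diff)
    have "\<rho> (vs N - y) + \<rho> y = vs n"
      using \<rho>_add[OF dV yV] by (simp add: N vs_Suc)
    then have "\<rho> (vs N - y) = vs n - \<rho> y" unfolding eq_diff_eq .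
    moreover have "\<rho> y = (\<Sum>l<n. sc (a l) (vs l))"
      unfolding N sum.lessThan_Suc_shift y_def
      by (subst \<rho>_sum) (auto simp: a0 \<rho>_scale vs_in vs_Suc intro!: subspace_scale[OF V])
    ultimately have "\<rho> (vs N - y) \<in> span Fix"
      using a by simp
    then have "vs N - y \<in> span Fix"
      by (rule \<rho>_in_span_Fix[OF dV])
    then have "vs N - y + y \<in> S N"
      using Fix_S S_combI[of "\<lambda>l. a (Suc l) ^ q" N] by (intro S_add) (auto simp: y_def)
    then show False using least[of N] N by simp
  qed
  \<comment> \<open>For \<open>z\<close> with coordinates x_l and last coordinate y, comparing
    coefficients in \<open>\<rho> z = z\<close> modulo \<open>span Fix\<close> and taking q-th
    powers gives x_(l-1) = x_l^q - a_l^q y. The coordinates are thus computed from the last one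
    downwards, hence the reversed index; the equation at l = 0 says that y is a root.\<close>
  define c where "c m = a (N - m) ^ q" for m
  have "c N \<noteq> 0" using \<open>a 0 \<noteq> 0\<close> q_gt_1 by (simp add: c_def)
  then obtain y where y: "y \<noteq> 0" "poly (fixed_vector_poly c n) y = 0"
    using fixed_vector_poly_root[of c N] unfolding N by blast
  define x where "x l = poly (fixed_vector_poly c (N - l)) y" for l
  have x_N: "x N = y" by (simp add: x_def)
  have x_rec: "x l ^ q - a l ^ q * y = (if l = 0 then 0 else x (l - 1))" if "l \<le> N" for l
  proof -
    have "x l ^ q - a l ^ q * y = poly (fixed_vector_poly c (Suc (N - l))) y"
      using that by (simp add: x_def c_def poly_power algebra_simps)
    also have "\<dots> = (if l = 0 then 0 else x (l - 1))"
      using that y N by (auto simp: x_def Suc_diff_le)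
    finally show ?thesis .
  qed
  define z where "z = (\<Sum>l<n. sc (x l) (vs l))"
  have zV: "z \<in> V"
    unfolding z_def by (intro subspace_sum[OF V] subspace_scale[OF V] vs_in)
  obtain t where t: "t ^ q = y" using ex_root[of q y] q_gt_1 by auto
  have \<rho>z: "\<rho> z = (\<Sum>l<n. sc (x l) (vs l)) - sc t (\<Sum>l<n. sc (a l) (vs l)) + sc t (vs n)"
  proof -
    define x' where "x' l = (if l = 0 then 0 else x l - t * a l)" for l
    have root: "x l = (x (Suc l) - t * a (Suc l)) ^ q" if "l < N" for l
      using x_rec[of "Suc l"] that t frob_diff[of "x (Suc l)" "t * a (Suc l)" 1]
      by (simp add: power_mult_distrib mult.commute)
    have "x 0 ^ q = (t * a 0) ^ q"
      using x_rec[of 0] t by (simp add: power_mult_distrib mult.commute)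
    then have x0: "x 0 = t * a 0" using frob_inj[of "x 0" 1 "t * a 0"] by simp
    have "\<rho> z = (\<Sum>l<n. \<rho> (sc (x l) (vs l)))"
      unfolding z_def by (rule \<rho>_sum) (intro subspace_scale[OF V] vs_in)
    also have "\<dots> = (\<Sum>l<N. \<rho> (sc (x l) (vs l))) + \<rho> (sc y (vs N))"
      by (simp add: N x_N)
    also have "\<rho> (sc y (vs N)) = sc t (vs n)"
      using t vs_in \<rho>_scale[of "vs N" t] by (simp add: N vs_Suc)
    also have "(\<Sum>l<N. \<rho> (sc (x l) (vs l))) = (\<Sum>l<N. sc (x (Suc l) - t * a (Suc l)) (vs (Suc l)))"
      by (intro sum.cong refl) (use root vs_in in \<open>simp add: \<rho>_scale vs_Suc\<close>)
    also have "\<dots> = (\<Sum>l<n. sc (x l - t * a l) (vs l))"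
      unfolding N sum.lessThan_Suc_shift using x0 by simp
    also have "\<dots> = (\<Sum>l<n. sc (x l) (vs l)) - sc t (\<Sum>l<n. sc (a l) (vs l))"
      by (simp add: scale_left_diff_distrib sum_subtractf scale_sum_right)
    finally show ?thesis .
  qed
  have "\<rho> z - z = sc t (vs n - (\<Sum>l<n. sc (a l) (vs l)))"
    unfolding \<rho>z unfolding z_def by (simp add: scale_right_diff_distrib)
  then have "\<rho> z - z \<in> span Fix" using a span_scale by simp
  then have "- (\<rho> z - z) \<in> span Fix" by (rule span_neg)
  then obtain f where f: "f \<in> span Fix" "\<rho> f - f = - (\<rho> z - z)"
    using \<rho>_minus_id_surj by blast
  have fV: "f \<in> V" using f span_Fix_subset by blast
  have "\<rho> (z + f) = z + f"
    using f(2) zV fV by (simp add: \<rho>_add algebra_simps)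
  then have "z + f \<in> Fix" using subspace_add[OF V zV fV] by (simp add: Fix_def)
  then have "z + f - f \<in> span Fix" using f(1) by (rule span_diff[OF span_base])
  then have z: "z \<in> span Fix" by simp
  \<comment> \<open>Since \<open>y\<close> is nonzero, a vector \<open>z\<close> in
    \<open>span Fix\<close> would put \<open>vs N\<close> into \<open>S N\<close>, again
    contradicting minimality.\<close>
  have "vs N = sc (1 / y) z - (\<Sum>l<N. sc (x l / y) (vs l))"
    using y by (simp add: z_def N x_N scale_right_distrib scale_sum_right)
  also have "\<dots> = sc (1 / y) z + (\<Sum>l<N. sc (- (x l / y)) (vs l))"
    by (simp add: sum_negf)
  also have "\<dots> \<in> S N"
    using z Fix_S span_scale by (intro S_add S_combI) blast
  finally show False using least[of N] N by simp
qed

text \<open>By Lang's theorem \<open>V\<close> has a k-basis of fixed vectors, and a combination of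
  such a basis is fixed exactly when its coefficients lie in F_q.\<close>

lemma card_Fix:
  assumes "finite B" "independent B" "span B = V"
  shows "card {x \<in> V. \<rho> x = x} = q ^ card B"
proof -
  obtain C where C: "C \<subseteq> Fix" "independent C" "Fix \<subseteq> span C"
    by (rule maximal_independent_subset)
  have "span C = V"
    using C span_Fix[OF assms(1)] assms(3) span_mono[OF C(1)] span_mono[OF C(3)]
    by (simp add: span_span)
  have fC: "finite C"
    using independent_span_bound[OF assms(1) C(2)] \<open>span C = V\<close> assms(3) span_superset[of C] by simp
  have cC: "card C = card B"
    using \<open>span C = V\<close> assms fC C by (intro card_eq_of_span_eq) auto
  have CV: "c \<in> V" "\<rho> c = c" if "c \<in> C" for c using C that by (auto simp: Fix_def)
  let ?f = "\<lambda>u. \<Sum>b\<in>C. sc (u b) b"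
  have "{x \<in> V. \<rho> x = x} = ?f ` (C \<rightarrow>\<^sub>E {c. c ^ q = c})"
  proof (intro equalityI subsetI)
    fix x assume x: "x \<in> {x \<in> V. \<rho> x = x}"
    then have "x \<in> range ?f"
      unfolding span_finite[OF fC, symmetric] \<open>span C = V\<close> by simp
    then obtain u where u: "x = ?f u" by blast
    have "\<forall>b. \<exists>y. y ^ q = u b" using ex_root q_gt_1 by auto
    from choice[OF this] obtain w where w: "w b ^ q = u b" for b by blast
    have "\<rho> x = (\<Sum>b\<in>C. \<rho> (sc (u b) b))"
      unfolding u by (rule \<rho>_sum) (use CV subspace_scale[OF V] in auto)
    also have "\<dots> = ?f w"
    proof (intro sum.cong refl)
      fix b assume "b \<in> C"
      then show "\<rho> (sc (u b) b) = sc (w b) b"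
        using \<rho>_scale[of b "w b"] CV[of b] by (simp add: w)
    qed
    finally have "(\<Sum>b\<in>C. sc (w b - u b) b) = 0"
      using x u by (simp add: scale_left_diff_distrib sum_subtractf)
    then have "w b = u b" if "b \<in> C" for b
      using independentD[OF C(2) fC subset_refl _ that, of "\<lambda>b. w b - u b"] by simp
    then have "u b ^ q = u b" if "b \<in> C" for b using w[of b] that by simp
    then have "restrict u C \<in> C \<rightarrow>\<^sub>E {c. c ^ q = c}" by auto
    moreover have "x = ?f (restrict u C)" unfolding u by (intro sum.cong) auto
    ultimately show "x \<in> ?f ` (C \<rightarrow>\<^sub>E {c. c ^ q = c})" by blast
  next
    fix x assume "x \<in> ?f ` (C \<rightarrow>\<^sub>E {c. c ^ q = c})"
    then obtain u where u: "x = ?f u" "\<And>b. b \<in> C \<Longrightarrow> u b ^ q = u b" by (auto simp: PiE_iff)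
    have "x \<in> V" unfolding u(1) by (intro subspace_sum[OF V] subspace_scale[OF V] CV)
    moreover have "\<rho> x = (\<Sum>b\<in>C. \<rho> (sc (u b) b))"
      unfolding u(1) by (rule \<rho>_sum) (use CV subspace_scale[OF V] in auto)
    moreover have "\<dots> = x"
      unfolding u(1)
    proof (intro sum.cong refl)
      fix b assume "b \<in> C"
      then show "\<rho> (sc (u b) b) = sc (u b) b"
        using \<rho>_scale[of b "u b"] CV[of b] by (simp add: u(2))
    qed
    ultimately show "x \<in> {x \<in> V. \<rho> x = x}" by simp
  qed
  then show ?thesis
    using card_combinations[OF fC C(2)] cC card_fixed_field by simp
qed

end

section \<open>Supersingular Drinfeld modules\<close>

context A_field
begin

lemma q_pos [simp]: "0 < q" using q_gt_1 by simp

lemma card_Fqm_le: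
  assumes "0 < e"
  shows "finite (Fqm q e :: 'k set)" and "card (Fqm q e :: 'k set) \<le> q ^ e"
proof -
  let ?P = "monom 1 (q ^ e) - monom 1 1 :: 'k poly"
  have q1: "1 < q ^ e" using assms q_gt_1 by (rule one_less_power[rotated])
  then have "coeff ?P (q ^ e) = 1" by simp
  then have "?P \<noteq> 0" by (metis coeff_0 zero_neq_one)
  have deg: "degree ?P \<le> q ^ e"
    using q1 by (intro degree_diff_le) (auto simp: degree_monom_eq)
  have *: "Fqm q e = {c. poly ?P c = 0}"
    by (auto simp: poly_monom Fqm_def)
  show "finite (Fqm q e :: 'k set)"
    unfolding * using \<open>?P \<noteq> 0\<close> by (rule poly_roots_finite)
  show "card (Fqm q e :: 'k set) \<le> q ^ e"
    unfolding * using card_poly_roots_bound[OF \<open>?P \<noteq> 0\<close>] deg by simp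
qed

text \<open>Polynomials of degree below that of \<open>\<qq>\<close> have distinct images. With
  \<open>\<gamma>\<close> this shows that A/\<pp> is too large to be fixed by a low power of
  Frobenius; with \<open>\<theta> i\<close> it gives the size of \<open>Fqm q m\<close>.\<close>

lemma ex_residue_representatives:
  assumes \<theta>: "is_ring_hom \<theta>" and ker: "\<And>a. \<theta> a = (0::'k) \<longleftrightarrow> \<qq> dvd a" and "0 < degree \<qq>"
  shows "\<exists>S \<subseteq> range \<theta>. card S = q ^ degree (\<qq> :: 'f poly)"
proof -
  let ?d = "degree \<qq>"
  define g where "g f = (\<Sum>i<?d. monom (f i) i)" for f :: "nat \<Rightarrow> 'f"
  have coeff_g: "coeff (g f) i = f i" if "i < ?d" for f i
    using that by (simp add: g_def coeff_sum)
  have deg_g: "degree (g f - g f') < ?d" for f f'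
  proof -
    have "degree (g f) \<le> ?d - 1" for f
      unfolding g_def by (rule degree_sum_le) (auto intro: order_trans[OF degree_monom_le])
    then have "degree (g f - g f') \<le> ?d - 1" by (intro degree_diff_le)
    then show ?thesis using assms(3) by linarith
  qed
  have "inj_on (\<lambda>f. \<theta> (g f)) ({..<?d} \<rightarrow>\<^sub>E UNIV)"
  proof (rule inj_onI)
    fix f f' assume f: "f \<in> {..<?d} \<rightarrow>\<^sub>E UNIV" "f' \<in> {..<?d} \<rightarrow>\<^sub>E UNIV" and eq: "\<theta> (g f) = \<theta> (g f')"
    have "\<theta> (g f - g f' + g f') = \<theta> (g f - g f') + \<theta> (g f')"
      using \<theta> unfolding is_ring_hom_def by blast
    then have "\<theta> (g f - g f') = 0" using eq by simp
    then have "\<qq> dvd g f - g f'" unfolding ker .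
    then have "g f - g f' = 0"
      using dvd_imp_degree_le[of \<qq> "g f - g f'"] deg_g[of f f'] by linarith
    then have "f i = f' i" if "i < ?d" for i
      using coeff_g[OF that, of f] coeff_g[OF that, of f'] by simp
    then show "f = f'" using f by (intro PiE_ext) auto
  qed
  then have "card ((\<lambda>f. \<theta> (g f)) ` ({..<?d} \<rightarrow>\<^sub>E UNIV)) = card ({..<?d} \<rightarrow>\<^sub>E (UNIV :: 'f set))"
    by (rule card_image)
  also have "\<dots> = q ^ ?d"
    unfolding q_eq by (subst card_PiE) simp_all
  finally show ?thesis by (intro exI[of _ "(\<lambda>f. \<theta> (g f)) ` ({..<?d} \<rightarrow>\<^sub>E UNIV)"]) auto
qed

end

section \<open>Conjugates of \<gamma>(T) and right multiplication by \<phi>_T\<close>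

locale supersingular_drinfeld = drinfeld \<gamma> q \<phi> r
  for \<gamma> :: "'f::{field,finite} poly \<Rightarrow> 'k::alg_closed_field" and q \<phi> r +
  fixes \<pp> :: "'f poly" and d :: nat
  assumes irr: "irreducible \<pp>" and deg_\<pp>: "degree \<pp> = d"
    and \<gamma>_eq_0_iff: "\<gamma> a = 0 \<longleftrightarrow> \<pp> dvd a"
    and ss: "supersingular \<pp> r \<phi>"
begin

lemma \<pp>_nonzero: "\<pp> \<noteq> 0" using irr by auto

lemma d_pos: "0 < d"
proof (rule ccontr)
  assume "\<not> 0 < d"
  then have "is_unit \<pp>" using deg_\<pp> \<pp>_nonzero by (simp add: is_unit_iff_degree)
  then show False using irr by (simp add: irreducible_def)
qed

text \<open>The conjugates of \<gamma>(T). Moving \<gamma>(T) past \<tau>^n raises it to the power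
  \<open>q ^ n\<close>, so \<open>t n\<close> is the factor by which T acts on the coefficient of
  \<tau>^n when all lower coefficients vanish.\<close>

definition t :: "nat \<Rightarrow> 'k" where "t n = \<gamma> [:0, 1:] ^ (q ^ n)"

lemma t_add: "t (m + n) = t m ^ (q ^ n)"
  by (simp add: t_def frob_pow_pow)

lemma \<gamma>_eq_poly: "\<gamma> a = poly (map_poly emb a) (t 0)"
proof (induction a)
  case (pCons c a)
  have "pCons c a = [:c:] + [:0, 1:] * a" by simp
  then have "\<gamma> (pCons c a) = emb c + t 0 * \<gamma> a"
    by (simp only: \<gamma>_add \<gamma>_mult emb_def t_def) simp
  then show ?case using pCons by (simp add: map_poly_pCons)
qed auto

lemma poly_emb_frob: "poly (map_poly emb a) (x ^ (q ^ i)) = poly (map_poly emb a) x ^ (q ^ i)"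
  by (induction a) (auto simp: map_poly_pCons frob_add_pow power_mult_distrib)

text \<open>Otherwise the \<open>q ^ e\<close>-power map would fix all of
  \<open>range \<gamma>\<close>, which has at least \<open>q ^ d\<close> elements.\<close>

lemma t_neq_aux:
  assumes "0 < e" "e < d"
  shows "t e \<noteq> t 0"
proof
  assume te: "t e = t 0"
  have "t 0 ^ (q ^ e) = t 0" unfolding t_add[symmetric] add_0 by (rule te)
  then have "poly (map_poly emb a) (t 0) ^ (q ^ e) = poly (map_poly emb a) (t 0)" for a
    using poly_emb_frob[of a "t 0" e] by metis
  then have "range \<gamma> \<subseteq> Fqm q e"
    unfolding Fqm_def using \<gamma>_eq_poly by auto
  moreover from ex_residue_representatives[OF hom \<gamma>_eq_0_iff] obtain S
    where "S \<subseteq> range \<gamma>" "card S = q ^ d"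
    using d_pos deg_\<pp> by auto
  ultimately have "q ^ d \<le> q ^ e"
    using card_Fqm_le[OF assms(1)] card_mono[of "Fqm q e" S] by (simp add: subset_trans)
  then show False using assms q_gt_1 by simp
qed

definition \<pp>\<^sub>k :: "'k poly" where "\<pp>\<^sub>k = map_poly emb \<pp>"

lemma \<pp>\<^sub>k_root: "poly \<pp>\<^sub>k (t n) = 0"
proof -
  have "poly \<pp>\<^sub>k (t n) = poly \<pp>\<^sub>k (t 0) ^ (q ^ n)"
    unfolding \<pp>\<^sub>k_def poly_emb_frob[symmetric] using t_add[of 0 n] by simp
  also have "poly \<pp>\<^sub>k (t 0) = 0"
    using \<gamma>_eq_0_iff[of \<pp>] by (simp add: \<pp>\<^sub>k_def \<gamma>_eq_poly[of \<pp>])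
  finally show ?thesis by simp
qed

lemma degree_\<pp>\<^sub>k: "degree \<pp>\<^sub>k = d"
  by (simp add: \<pp>\<^sub>k_def degree_map_poly deg_\<pp>)

lemma \<pp>\<^sub>k_nonzero: "\<pp>\<^sub>k \<noteq> 0"
  using degree_\<pp>\<^sub>k d_pos by auto

lemma t_neq: "i < j \<Longrightarrow> j < d \<Longrightarrow> t i \<noteq> t j"
  using t_neq_aux[of "j - i"] t_add[of "j - i" i] t_add[of 0 i]
    frob_inj[of "t (j - i)" i "t 0"] by auto

lemma inj_t: "inj_on t {..<d}"
  by (rule linorder_inj_onI) (use t_neq in auto)

lemma \<pp>\<^sub>k_roots: "{x. poly \<pp>\<^sub>k x = 0} = t ` {..<d}"
proof (rule sym, rule card_subset_eq)
  show "finite {x. poly \<pp>\<^sub>k x = 0}" using \<pp>\<^sub>k_nonzero by (rule poly_roots_finite)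
  show *: "t ` {..<d} \<subseteq> {x. poly \<pp>\<^sub>k x = 0}" using \<pp>\<^sub>k_root by auto
  have "card {x. poly \<pp>\<^sub>k x = 0} \<le> d"
    using card_poly_roots_bound[OF \<pp>\<^sub>k_nonzero] degree_\<pp>\<^sub>k by simp
  moreover have "card (t ` {..<d}) = d" using inj_t by (simp add: card_image)
  moreover have "card (t ` {..<d}) \<le> card {x. poly \<pp>\<^sub>k x = 0}"
    by (rule card_mono[OF \<open>finite {x. poly \<pp>\<^sub>k x = 0}\<close> *])
  ultimately show "card (t ` {..<d}) = card {x. poly \<pp>\<^sub>k x = 0}" by simp
qed

text \<open>\<open>t d\<close> is a root of \<pp>, hence equal to some \<open>t i\<close> with
  \<open>i < d\<close>. Undoing \<open>i\<close> Frobenius steps excludes a positive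
  \<open>i\<close>.\<close>

lemma t_d: "t d = t 0"
proof -
  have "t d \<in> t ` {..<d}" using \<pp>\<^sub>k_root[of d] unfolding \<pp>\<^sub>k_roots[symmetric] by simp
  then obtain i where i: "i < d" "t d = t i" by auto
  show ?thesis
  proof (cases "i = 0")
    case False
    have "t (d - i) ^ (q ^ i) = t 0 ^ (q ^ i)"
      using i t_add[of "d - i" i] t_add[of 0 i] by simp
    then have "t (d - i) = t 0" by (simp add: frob_inj)
    then show ?thesis using t_neq_aux[of "d - i"] i False by simp
  qed (use i in simp)
qed

lemma t_mod: "t (n mod d) = t n"
proof -
  have "t (m + k * d) = t m" for m k
  proof (induction k)
    case (Suc k)
    have "t (m + Suc k * d) = t (d + (m + k * d))" by (simp add: algebra_simps)
    also have "\<dots> = t (0 + (m + k * d))" unfolding t_add t_d ..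
    finally show ?case using Suc by (simp only: add_0)
  qed simp
  from this[of "n mod d" "n div d"] show ?thesis by simp
qed

lemma t_eq_iff: "t m = t n \<longleftrightarrow> m mod d = n mod d"
  using inj_onD[OF inj_t, of "m mod d" "n mod d"] d_pos t_mod[of m] t_mod[of n] by auto

definition R :: "'k poly \<Rightarrow> 'k poly" where "R x = tmult q x P"

lemma R_add: "R (x + y) = R x + R y"
  and R_smult: "R (smult c x) = smult c (R x)"
  and R_0 [simp]: "R 0 = 0"
  by (simp_all add: R_def tmult_add_left tmult_smult_left)

lemma R_sum: "R (\<Sum>i\<in>S. f i) = (\<Sum>i\<in>S. R (f i))"
  by (simp add: R_def tmult_sum_left)

lemma degree_R_le: "degree (R x) \<le> degree x + r"
  unfolding R_def using degree_tmult_le[of x P] by (simp add: degree_P)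

text \<open>The action of k[X] on k{\<tau>} in which X acts as \<open>R\<close>; it is well defined
  because \<open>R\<close> commutes with left multiplication by scalars.\<close>

definition T_poly :: "'k poly \<Rightarrow> 'k poly \<Rightarrow> 'k poly" where
  "T_poly e x = (\<Sum>i\<le>degree e. smult (coeff e i) ((R ^^ i) x))"

lemma T_poly_bound:
  assumes "degree e \<le> n"
  shows "T_poly e x = (\<Sum>i\<le>n. smult (coeff e i) ((R ^^ i) x))"
  unfolding T_poly_def by (intro sum.mono_neutral_left) (use assms in \<open>auto simp: coeff_eq_0\<close>)

lemma T_poly_pCons: "T_poly (pCons c e) x = smult c x + R (T_poly e x)"
proof -
  have "T_poly (pCons c e) x = (\<Sum>i\<le>Suc (degree e). smult (coeff (pCons c e) i) ((R ^^ i) x))"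
    by (rule T_poly_bound) (rule degree_pCons_le)
  also have "\<dots> = smult c x + R (T_poly e x)"
    by (simp add: sum.atMost_Suc_shift T_poly_def R_sum R_smult del: sum.atMost_Suc)
  finally show ?thesis .
qed

lemma T_poly_0 [simp]: "T_poly 0 x = 0"
  by (simp add: T_poly_def)

lemma T_poly_add: "T_poly e (x + y) = T_poly e x + T_poly e y"
  and T_poly_smult: "T_poly e (smult c x) = smult c (T_poly e x)"
  and T_poly_R: "T_poly e (R x) = R (T_poly e x)"
  by (induction e) (auto simp: T_poly_pCons R_add R_smult smult_add_right mult.commute)

lemma T_poly_add_left: "T_poly (e + e') x = T_poly e x + T_poly e' x"
proof -
  let ?n = "max (degree e) (degree e')"
  show ?thesis
    by (simp add: T_poly_bound[of _ ?n] degree_add_le sum.distrib smult_add_left)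
qed

lemma T_poly_smult_left: "T_poly (smult c e) x = smult c (T_poly e x)"
  by (induction e) (auto simp: T_poly_pCons R_smult smult_add_right)

lemma T_poly_map_emb: "T_poly (map_poly emb a) x = tmult q x (\<phi> a)"
proof (induction a)
  case (pCons c a)
  then show ?case
    by (simp add: map_poly_pCons T_poly_pCons \<phi>_pCons tmult_add_right tmult_emb_right R_def tmult_assoc)
qed auto

definition N :: nat where "N = r * d"

lemma N_pos: "0 < N" using r_pos d_pos by (simp add: N_def)

definition \<epsilon> :: 'k where "\<epsilon> = coeff (\<phi> \<pp>) N"

text \<open>Supersingularity: the lowest and the highest term of \<open>\<phi>\<^sub>\<pp>\<close> coincide.\<close>

lemma \<phi>\<pp>: "\<phi> \<pp> = monom \<epsilon> N" and \<epsilon>_nonzero: "\<epsilon> \<noteq> 0"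
proof -
  have deg: "degree (\<phi> \<pp>) = N" "\<phi> \<pp> \<noteq> 0"
    using degree_\<phi>[OF \<pp>_nonzero] deg_\<pp> by (auto simp: N_def)
  show "\<epsilon> \<noteq> 0" using deg(2) unfolding \<epsilon>_def deg(1)[symmetric] by simp
  have "(LEAST i. coeff (\<phi> \<pp>) i \<noteq> 0) = N"
    using ss by (simp add: supersingular_def has_height_def deg_\<pp> N_def)
  then have *: "coeff (\<phi> \<pp>) i = 0" if "i < N" for i
    using not_less_Least[of i "\<lambda>i. coeff (\<phi> \<pp>) i \<noteq> 0"] that by auto
  have **: "coeff (\<phi> \<pp>) i = 0" if "N < i" for i
    using deg that by (intro coeff_eq_0) simp
  show "\<phi> \<pp> = monom \<epsilon> N"
  proof (intro poly_eqI)
    fix i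
    consider "i < N" | "i = N" | "N < i" by linarith
    then show "coeff (\<phi> \<pp>) i = coeff (monom \<epsilon> N) i"
      by cases (use * ** in \<open>auto simp: \<epsilon>_def\<close>)
  qed
qed

text \<open>This is the member \<tau>^j k{\<tau>} of the chain: k is perfect, so vanishing of the
  low coefficients is the same as divisibility by \<tau>^j on the left.\<close>

definition below :: "nat \<Rightarrow> 'k poly \<Rightarrow> bool" where
  "below j x \<longleftrightarrow> (\<forall>n<j. coeff x n = 0)"

lemma below_tmult: "below j x \<Longrightarrow> below j (tmult q x v)"
  by (auto simp: below_def coeff_tmult intro!: sum.neutral)

lemma below_tmult_monom: "below j x \<Longrightarrow> below (j + n) (tmult q x (monom c n))"
proof -
  assume x: "below j x"
  have "coeff x i * coeff (monom c n) (l - i) ^ (q ^ i) = 0" if "l < j + n" "i \<le> l" for i l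
    using that x by (cases "i < j") (auto simp: below_def)
  then show ?thesis unfolding below_def coeff_tmult by (intro allI impI sum.neutral) auto
qed

lemma below_add: "below j x \<Longrightarrow> below j y \<Longrightarrow> below j (x + y)"
  and below_smult: "below j x \<Longrightarrow> below j (smult c x)"
  and below_0: "below j 0"
  by (auto simp: below_def)

lemma below_mono: "below j x \<Longrightarrow> i \<le> j \<Longrightarrow> below i x"
  by (auto simp: below_def)

lemma below_monom: "j \<le> n \<Longrightarrow> below j (monom c n)"
  by (auto simp: below_def)

lemma below_R: "below j x \<Longrightarrow> below j (R x)"
  unfolding R_def by (rule below_tmult)

lemma coeff_R: "below j x \<Longrightarrow> coeff (R x) j = t j * coeff x j"
proof -
  assume x: "below j x"
  have "coeff (R x) j = (\<Sum>i\<in>{j}. coeff x i * coeff P (j - i) ^ (q ^ i))"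
    unfolding R_def coeff_tmult using x
    by (intro sum.mono_neutral_right) (auto simp: below_def)
  then show ?thesis by (simp add: P_def coeff_\<phi>T_0 t_def)
qed

lemma below_T_poly: "below j x \<Longrightarrow> below j (T_poly e x)"
  by (induction e) (auto simp: T_poly_pCons below_0 intro: below_add below_smult below_R)

lemma coeff_T_poly: "below j x \<Longrightarrow> coeff (T_poly e x) j = poly e (t j) * coeff x j"
  by (induction e) (auto simp: T_poly_pCons coeff_R below_T_poly algebra_simps)

section \<open>Eigenfunctionals of T\<close>

definition cofactor :: "nat \<Rightarrow> 'k poly" where "cofactor n = \<pp>\<^sub>k div [:- t n, 1:]"

lemma \<pp>\<^sub>k_eq: "\<pp>\<^sub>k = [:- t n, 1:] * cofactor n"
  using \<pp>\<^sub>k_root[of n] unfolding cofactor_def poly_eq_0_iff_dvd by (rule dvd_mult_div_cancel[symmetric])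

text \<open>A double root would leave all \<open>d\<close> distinct roots of \<pp> to the cofactor,
  whose degree is \<open>d - 1\<close>.\<close>

lemma poly_cofactor_nonzero: "poly (cofactor n) (t n) \<noteq> 0"
proof
  assume *: "poly (cofactor n) (t n) = 0"
  have nz: "cofactor n \<noteq> 0" using \<pp>\<^sub>k_eq[of n] \<pp>\<^sub>k_nonzero by auto
  have "degree ([:- t n, 1:] * cofactor n) = 1 + degree (cofactor n)"
    using nz by (subst degree_mult_eq) auto
  then have "degree \<pp>\<^sub>k = 1 + degree (cofactor n)" unfolding \<pp>\<^sub>k_eq[of n, symmetric] .
  moreover have "{x. poly \<pp>\<^sub>k x = 0} \<subseteq> {x. poly (cofactor n) x = 0}"
    using \<pp>\<^sub>k_eq[of n] * by auto
  then have "d \<le> card {x. poly (cofactor n) x = 0}"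
    using card_mono[OF poly_roots_finite[OF nz], of "t ` {..<d}"] card_image[OF inj_t]
    unfolding \<pp>\<^sub>k_roots by simp
  ultimately show False
    using card_poly_roots_bound[OF nz] degree_\<pp>\<^sub>k by simp
qed

text \<open>
  Up to a scalar, \<open>T_poly (cofactor n)\<close> projects \<open>k{\<tau>} / k{\<tau>}\<phi>\<^sub>\<pp>\<close> onto the eigenspace of \<open>T\<close> for \<open>t n\<close>; its
  \<open>n\<close>-th coefficient is an eigenfunctional that vanishes on \<open>\<tau>\<^sup>j k{\<tau>}\<close> for \<open>j > n\<close>.
\<close>

definition \<Lambda> :: "nat \<Rightarrow> 'k poly \<Rightarrow> 'k" where
  "\<Lambda> n x = coeff (T_poly (cofactor n) x) n / poly (cofactor n) (t n)"

lemma \<Lambda>_add: "\<Lambda> n (x + y) = \<Lambda> n x + \<Lambda> n y"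
  and \<Lambda>_smult: "\<Lambda> n (smult c x) = c * \<Lambda> n x"
  and \<Lambda>_0 [simp]: "\<Lambda> n 0 = 0"
  using T_poly_smult[of "cofactor n" 0 0]
  by (simp_all add: \<Lambda>_def T_poly_add T_poly_smult add_divide_distrib)

lemma \<Lambda>_sum: "\<Lambda> n (\<Sum>i\<in>S. f i) = (\<Sum>i\<in>S. \<Lambda> n (f i))"
  by (induction S rule: infinite_finite_induct) (auto simp: \<Lambda>_add)

text \<open>The cofactor times X - \<open>t n\<close> is \<pp>, and \<pp> acts as right
  multiplication by \<phi>_\<pp>. By supersingularity the result has no coefficient below
  \<open>N\<close>, in particular none at \<open>n\<close>.\<close>

lemma \<Lambda>_R:
  assumes "n < N"
  shows "\<Lambda> n (R x) = t n * \<Lambda> n x"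
proof -
  have "\<pp>\<^sub>k = pCons 0 (cofactor n) + smult (- t n) (cofactor n)"
    using \<pp>\<^sub>k_eq[of n] by simp
  then have "T_poly \<pp>\<^sub>k x = R (T_poly (cofactor n) x) + smult (- t n) (T_poly (cofactor n) x)"
    by (simp only: T_poly_add_left T_poly_smult_left T_poly_pCons) simp
  moreover have "T_poly \<pp>\<^sub>k x = tmult q x (monom \<epsilon> N)"
    by (simp add: \<pp>\<^sub>k_def T_poly_map_emb \<phi>\<pp>)
  moreover have "below N (tmult q x (monom \<epsilon> N))"
    using below_tmult_monom[of 0 x N] by (simp add: below_def)
  ultimately have "coeff (R (T_poly (cofactor n) x) + smult (- t n) (T_poly (cofactor n) x)) n = 0"
    using assms by (simp add: below_def)
  then show ?thesis by (simp add: \<Lambda>_def T_poly_R)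
qed

lemma \<Lambda>_below: "below n x \<Longrightarrow> \<Lambda> n x = coeff x n"
  by (simp add: \<Lambda>_def coeff_T_poly poly_cofactor_nonzero)

lemma \<Lambda>_below_Suc: "below j x \<Longrightarrow> n < j \<Longrightarrow> \<Lambda> n x = 0"
  using \<Lambda>_below[of n x] below_mono[of j x n] by (simp add: below_def)

text \<open>Once the lower coefficients vanish, \<open>\<Lambda> n\<close> is the n-th coefficient.
  This triangularity lets the eigenfunctionals describe the chain just as coefficients do.\<close>

lemma below_iff: "below j x \<longleftrightarrow> (\<forall>n<j. \<Lambda> n x = 0)"
proof
  assume *: "\<forall>n<j. \<Lambda> n x = 0"
  have "coeff x n = 0" if "n < j" for n
    using that
  proof (induction n rule: less_induct)
    case (less n)
    then have "below n x" by (auto simp: below_def)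
    then have "\<Lambda> n x = coeff x n" by (rule \<Lambda>_below)
    then show ?case using * less by simp
  qed
  then show "below j x" by (simp add: below_def)
next
  assume "below j x"
  then show "\<forall>n<j. \<Lambda> n x = 0" using \<Lambda>_below_Suc by simp
qed

lemma \<Lambda>_monom: "\<Lambda> n (monom c n) = c"
  using \<Lambda>_below[of n "monom c n"] by (simp add: below_monom)

lemma \<Lambda>_monom_less: "n < j \<Longrightarrow> \<Lambda> n (monom c j) = 0"
  using \<Lambda>_below_Suc[of j "monom c j" n] by (simp add: below_monom)

text \<open>By triangularity the coefficients can be corrected one after the other, the j-th
  correction leaving the earlier functionals unchanged. The degree \<open>N - 1\<close> reached here
  is the origin of the condition \<open>N - 1 \<le> s\<close> in the dimension count.\<close>

lemma ex_\<Lambda>: "\<exists>x. degree x \<le> N - 1 \<and> (\<forall>n<N. \<Lambda> n x = b n)"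
proof -
  have "\<exists>x. degree x \<le> N - 1 \<and> (\<forall>n<j. \<Lambda> n x = b n)" if "j \<le> N" for j
    using that
  proof (induction j)
    case 0
    show ?case by (intro exI[of _ 0]) auto
  next
    case (Suc j)
    then obtain x where x: "degree x \<le> N - 1" "\<forall>n<j. \<Lambda> n x = b n" by auto
    let ?y = "x + monom (b j - \<Lambda> j x) j"
    have "degree ?y \<le> N - 1"
      using x Suc by (intro degree_add_le) (auto intro: order_trans[OF degree_monom_le])
    moreover have "\<forall>n<Suc j. \<Lambda> n ?y = b n"
      using x by (auto simp: less_Suc_eq \<Lambda>_add \<Lambda>_monom \<Lambda>_monom_less)
    ultimately show ?case by blast
  qed
  then show ?thesis by blast
qed

end

section \<open>Counting endomorphisms of bounded degree\<close>

lemma smult_sum_right: "smult c (\<Sum>i\<in>S. f i) = (\<Sum>i\<in>S. smult c (f i))"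
  by (induction S rule: infinite_finite_induct) (auto simp: smult_add_right)

context supersingular_drinfeld
begin

definition g :: "nat \<Rightarrow> 'k" where "g k = coeff P k"

lemma g_r: "g r \<noteq> 0"
  using P_nonzero unfolding g_def degree_P[symmetric] by simp

text \<open>
  \<open>F j\<close> stands for the value at \<open>\<tau>\<^sup>j\<close> of a \<open>k\<close>-linear endomorphism of \<open>k{\<tau>}\<close> that commutes with
  right multiplication by \<open>\<phi>\<^sub>T\<close>.
\<close>

definition T_linear :: "(nat \<Rightarrow> 'k poly) \<Rightarrow> bool" where
  "T_linear F \<longleftrightarrow> (\<forall>j. (\<Sum>k\<le>r. smult (g k ^ (q ^ j)) (F (j + k))) = R (F j))"

lemma T_linear_step:
  assumes "T_linear F"
  shows "F (j + r) = smult (1 / g r ^ (q ^ j)) (R (F j) - (\<Sum>k<r. smult (g k ^ (q ^ j)) (F (j + k))))"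
proof -
  have "(\<Sum>k<r. smult (g k ^ (q ^ j)) (F (j + k))) + smult (g r ^ (q ^ j)) (F (j + r)) = R (F j)"
    using assms by (simp add: T_linear_def lessThan_Suc_atMost[symmetric])
  then have "smult (g r ^ (q ^ j)) (F (j + r)) = R (F j) - (\<Sum>k<r. smult (g k ^ (q ^ j)) (F (j + k)))"
    by (simp add: algebra_simps)
  then have "smult (1 / g r ^ (q ^ j)) (smult (g r ^ (q ^ j)) (F (j + r))) =
    smult (1 / g r ^ (q ^ j)) (R (F j) - (\<Sum>k<r. smult (g k ^ (q ^ j)) (F (j + k))))"
    by simp
  then show ?thesis using g_r by simp
qed

function extension :: "(nat \<Rightarrow> 'k poly) \<Rightarrow> nat \<Rightarrow> 'k poly" where
  "extension G j = (if j < r then G j else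
     smult (1 / g r ^ (q ^ (j - r)))
       (R (extension G (j - r)) - (\<Sum>k<r. smult (g k ^ (q ^ (j - r))) (extension G (j - r + k)))))"
  by auto
termination
  by (relation "measure snd") (use r_pos in auto)

declare extension.simps [simp del]

lemma extension_less: "j < r \<Longrightarrow> extension G j = G j"
  by (simp add: extension.simps)

lemma T_linear_extension: "T_linear (extension G)"
  unfolding T_linear_def
proof
  fix j
  have "extension G (j + r) = smult (1 / g r ^ (q ^ j))
       (R (extension G j) - (\<Sum>k<r. smult (g k ^ (q ^ j)) (extension G (j + k))))"
    by (subst extension.simps) simp
  then have "smult (g r ^ (q ^ j)) (extension G (j + r)) =
       R (extension G j) - (\<Sum>k<r. smult (g k ^ (q ^ j)) (extension G (j + k)))"
    using g_r by simp
  then show "(\<Sum>k\<le>r. smult (g k ^ (q ^ j)) (extension G (j + k))) = R (extension G j)"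
    by (simp add: lessThan_Suc_atMost[symmetric])
qed

lemma T_linear_induct:
  assumes "T_linear F" and "\<And>j. j < r \<Longrightarrow> S j (F j)"
    and "\<And>j. S j (F j) \<Longrightarrow> (\<And>k. k < r \<Longrightarrow> S (j + k) (F (j + k))) \<Longrightarrow>
      S (j + r) (smult (1 / g r ^ (q ^ j)) (R (F j) - (\<Sum>k<r. smult (g k ^ (q ^ j)) (F (j + k)))))"
  shows "S j (F j)"
proof (induction j rule: less_induct)
  case (less j)
  show ?case
  proof (cases "j < r")
    case False
    have "S (j - r + r) (F (j - r + r))"
      unfolding T_linear_step[OF assms(1), of "j - r"]
      by (rule assms(3)) (use less False r_pos in auto)
    then show ?thesis using False by simp
  qed (use assms in auto)
qed

lemma T_linear_eq_0:
  assumes "T_linear F" and "\<And>j. j < r \<Longrightarrow> F j = 0"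
  shows "F = 0"
proof
  fix j
  show "F j = 0 j"
    by (rule T_linear_induct[of F "\<lambda>_ x. x = 0 j"]) (use assms in \<open>auto simp: zero_fun_def intro!: sum.neutral\<close>)
qed

text \<open>The bound \<open>j + s\<close> is the one obeyed by right multiplication by an element
  of degree at most \<open>s\<close>. Applying \<open>R\<close> and shifting the index by
  \<open>r\<close> both cost \<open>r\<close>, so the bound propagates from the first
  \<open>r\<close> values.\<close>

lemma T_linear_degree:
  assumes "T_linear F" and "\<And>j. j < r \<Longrightarrow> degree (F j) \<le> j + s"
  shows "degree (F j) \<le> j + s"
proof (rule T_linear_induct[of F "\<lambda>j x. degree x \<le> j + s"])
  fix j
  assume 1: "degree (F j) \<le> j + s" and 2: "\<And>k. k < r \<Longrightarrow> degree (F (j + k)) \<le> j + k + s"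
  have "degree (R (F j)) \<le> j + r + s" using degree_R_le[of "F j"] 1 by simp
  moreover have "degree (\<Sum>k<r. smult (g k ^ (q ^ j)) (F (j + k))) \<le> j + r + s"
  proof (rule degree_sum_le)
    fix k assume "k \<in> {..<r}"
    then show "degree (smult (g k ^ (q ^ j)) (F (j + k))) \<le> j + r + s"
      using 2[of k] degree_smult_le[of "g k ^ (q ^ j)" "F (j + k)"] by simp
  qed simp
  ultimately have "degree (R (F j) - (\<Sum>k<r. smult (g k ^ (q ^ j)) (F (j + k)))) \<le> j + r + s"
    by (rule degree_diff_le)
  then show "degree (smult (1 / g r ^ (q ^ j)) (R (F j) - (\<Sum>k<r. smult (g k ^ (q ^ j)) (F (j + k))))) \<le> j + r + s"
    using degree_smult_le order_trans by blast
qed (use assms in auto)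

lemma P_sum: "P = (\<Sum>k\<le>r. monom (g k) k)"
  unfolding g_def using poly_as_sum_of_monoms[of P] by (simp add: degree_P)

lemma R_monom: "R (monom c j) = (\<Sum>k\<le>r. monom (c * g k ^ (q ^ j)) (j + k))"
  unfolding R_def by (subst P_sum) (simp add: tmult_sum_right tmult_monom)

definition lin_ext :: "(nat \<Rightarrow> 'k poly) \<Rightarrow> 'k poly \<Rightarrow> 'k poly" where
  "lin_ext F x = (\<Sum>i\<le>degree x. smult (coeff x i) (F i))"

lemma lin_ext_bound:
  assumes "degree x \<le> n"
  shows "lin_ext F x = (\<Sum>i\<le>n. smult (coeff x i) (F i))"
  unfolding lin_ext_def by (intro sum.mono_neutral_left) (use assms in \<open>auto simp: coeff_eq_0\<close>)

lemma lin_ext_add: "lin_ext F (x + y) = lin_ext F x + lin_ext F y"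
proof -
  let ?n = "max (degree x) (degree y)"
  show ?thesis
    by (simp add: lin_ext_bound[of _ ?n] degree_add_le sum.distrib smult_add_left)
qed

lemma lin_ext_0 [simp]: "lin_ext F 0 = 0"
  by (simp add: lin_ext_def)

lemma lin_ext_sum: "lin_ext F (\<Sum>i\<in>S. f i) = (\<Sum>i\<in>S. lin_ext F (f i))"
  by (induction S rule: infinite_finite_induct) (auto simp: lin_ext_add)

lemma lin_ext_monom: "lin_ext F (monom c j) = smult c (F j)"
proof -
  have "lin_ext F (monom c j) = (\<Sum>i\<le>j. if i = j then smult c (F j) else 0)"
    unfolding lin_ext_bound[OF degree_monom_le] by (intro sum.cong) auto
  then show ?thesis by simp
qed

lemma lin_ext_smult: "lin_ext F (smult c x) = smult c (lin_ext F x)"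
  by (induction x rule: poly_monom_induct)
     (auto simp: smult_add_right lin_ext_add lin_ext_monom smult_monom)

lemma lin_ext_R:
  assumes "T_linear F"
  shows "lin_ext F (R x) = R (lin_ext F x)"
proof (induction x rule: poly_monom_induct)
  case (monom c j)
  have "lin_ext F (R (monom c j)) = smult c (\<Sum>k\<le>r. smult (g k ^ (q ^ j)) (F (j + k)))"
    by (simp add: R_monom lin_ext_sum lin_ext_monom smult_sum_right)
  also have "\<dots> = R (lin_ext F (monom c j))"
    using assms by (simp add: T_linear_def lin_ext_monom R_smult)
  finally show ?case .
qed (simp add: R_add lin_ext_add)

lemma lin_ext_tmult:
  assumes "T_linear F"
  shows "lin_ext F (tmult q x (\<phi> a)) = tmult q (lin_ext F x) (\<phi> a)"
proof (induction a)
  case (pCons c a)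
  have "lin_ext F (tmult q x (tmult q (\<phi> a) P)) = tmult q (lin_ext F x) (tmult q (\<phi> a) P)"
    using lin_ext_R[OF assms, of "tmult q x (\<phi> a)"] pCons by (simp add: R_def tmult_assoc)
  then show ?case
    by (simp add: \<phi>_pCons tmult_add_right tmult_emb_right lin_ext_add lin_ext_smult)
qed auto

text \<open>A map that commutes with T commutes with \<phi>_\<pp>, here a monomial. The values at
  \<open>j\<close> and \<open>j + N\<close> are thereby tied together, which reduces the chain
  condition to finitely many indices.\<close>

lemma T_linear_add_N:
  assumes "T_linear F"
  shows "smult (\<epsilon> ^ (q ^ j)) (F (j + N)) = tmult q (F j) (monom \<epsilon> N)"
  using lin_ext_tmult[OF assms, of "monom 1 j" \<pp>]
  by (simp add: \<phi>\<pp> tmult_monom lin_ext_monom)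

lemma below_add_N:
  assumes "T_linear F" "below i (F j)"
  shows "below (i + N) (F (j + N))"
proof -
  have "below (i + N) (smult (\<epsilon> ^ (q ^ j)) (F (j + N)))"
    unfolding T_linear_add_N[OF assms(1)] using assms(2) by (rule below_tmult_monom)
  then show ?thesis using \<epsilon>_nonzero by (simp add: below_def)
qed

lemma T_linear_\<Lambda>:
  assumes "T_linear F" "n < N"
  shows "(\<Sum>k\<le>r. g k ^ (q ^ j) * \<Lambda> n (F (j + k))) = t n * \<Lambda> n (F j)"
proof -
  have "\<Lambda> n (\<Sum>k\<le>r. smult (g k ^ (q ^ j)) (F (j + k))) = \<Lambda> n (R (F j))"
    using assms by (simp add: T_linear_def)
  then show ?thesis by (simp add: \<Lambda>_sum \<Lambda>_smult \<Lambda>_R assms(2))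
qed

text \<open>
  \<open>T\<close> acts on \<open>\<tau>\<^sup>j k{\<tau>} / \<tau>\<^sup>j\<^sup>+\<^sup>1 k{\<tau>}\<close> as \<open>t j\<close>, so only the functionals with \<open>t n = t j\<close> give conditions.
\<close>

lemma chain_iff:
  assumes F: "T_linear F"
  shows "(\<forall>j. below j (F j)) \<longleftrightarrow> (\<forall>j<N. \<forall>n<j. n mod d = j mod d \<longrightarrow> \<Lambda> n (F j) = 0)"
proof
  assume "\<forall>j. below j (F j)"
  then show "\<forall>j<N. \<forall>n<j. n mod d = j mod d \<longrightarrow> \<Lambda> n (F j) = 0"
    using \<Lambda>_below_Suc by blast
next
  assume *: "\<forall>j<N. \<forall>n<j. n mod d = j mod d \<longrightarrow> \<Lambda> n (F j) = 0"
  \<comment> \<open>Downward induction on \<open>j\<close>, starting at \<open>N \<le> j\<close>,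
    where \<tau>^N already divides \<open>F j\<close>. For smaller \<open>j\<close> the terms with
    \<open>k > 0\<close> vanish by induction, which leaves
    \<open>t n * \<Lambda> n (F j) = t j * \<Lambda> n (F j)\<close>.\<close>
  have "\<Lambda> n (F j) = 0" if "n < N" "n < j" for n j
    using that
  proof (induction "N - j" arbitrary: j rule: less_induct)
    case less
    show ?case
    proof (cases "N \<le> j")
      case True
      have "below (0 + N) (F (j - N + N))"
        by (rule below_add_N[OF F]) (simp add: below_def)
      then show ?thesis using True \<Lambda>_below_Suc less by simp
    next
      case False
      show ?thesis
      proof (cases "n mod d = j mod d")
        case True
        then show ?thesis using * False less by simp
      next
        case neq: False
        have "t n * \<Lambda> n (F j) = (\<Sum>k\<le>r. g k ^ (q ^ j) * \<Lambda> n (F (j + k)))"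
          using T_linear_\<Lambda>[OF F less.prems(1)] by simp
        also have "\<dots> = (\<Sum>k\<in>{0}. g k ^ (q ^ j) * \<Lambda> n (F (j + k)))"
        proof (intro sum.mono_neutral_right ballI)
          fix k assume "k \<in> {..r} - {0}"
          then have "N - (j + k) < N - j" "n < j + k" using less.prems False by auto
          then have "\<Lambda> n (F (j + k)) = 0" using less.hyps[of "j + k"] less.prems by simp
          then show "g k ^ (q ^ j) * \<Lambda> n (F (j + k)) = 0" by simp
        qed auto
        also have "\<dots> = t j * \<Lambda> n (F j)"
          by (simp add: g_def P_def coeff_\<phi>T_0 t_def)
        finally have "\<Lambda> n (F j) = 0 \<or> t n = t j" by simp
        then show ?thesis using neq t_eq_iff by blast
      qed
    qed
  qed
  then have small: "below j (F j)" if "j \<le> N" for j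
    unfolding below_iff using that by auto
  show "\<forall>j. below j (F j)"
  proof
    fix j
    show "below j (F j)"
    proof (induction j rule: less_induct)
      case (less j)
      show ?case
      proof (cases "j \<le> N")
        case False
        then have "below (j - N + N) (F (j - N + N))"
          using less N_pos by (intro below_add_N[OF F]) simp
        then show ?thesis using False by simp
      qed (use small in simp)
    qed
  qed
qed

text \<open>The recursion in \<open>j\<close> obeyed by the numbers
  \<open>\<Lambda> n (F j)\<close>. It involves \<open>n\<close> only through \<open>t n\<close>, so
  indices congruent modulo \<open>d\<close> share their solutions.\<close>

definition eig :: "nat \<Rightarrow> (nat \<Rightarrow> 'k) \<Rightarrow> bool" where
  "eig n \<mu> \<longleftrightarrow> (\<forall>j. (\<Sum>k\<le>r. g k ^ (q ^ j) * \<mu> (j + k)) = t n * \<mu> j)"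

lemma eig_\<Lambda>:
  assumes "T_linear F" "n < N"
  shows "eig n (\<lambda>j. \<Lambda> n (F j))"
  using T_linear_\<Lambda>[OF assms] by (simp add: eig_def)

lemma eig_cong: "t n = t m \<Longrightarrow> eig n \<mu> \<longleftrightarrow> eig m \<mu>"
  by (simp add: eig_def)

lemma eig_unique:
  assumes "eig n \<mu>" "eig n \<nu>" and "\<And>j. j < r \<Longrightarrow> \<mu> j = \<nu> j"
  shows "\<mu> j = \<nu> j"
proof (induction j rule: less_induct)
  case (less j)
  show ?case
  proof (cases "j < r")
    case False
    define i where "i = j - r"
    have j: "j = i + r" using False by (simp add: i_def)
    have 1: "(\<Sum>k<r. g k ^ (q ^ i) * f (i + k)) + g r ^ (q ^ i) * f j = t n * f i" if "eig n f" for f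
      using that by (simp add: eig_def j lessThan_Suc_atMost[symmetric])
    have 2: "(\<Sum>k<r. g k ^ (q ^ i) * \<mu> (i + k)) = (\<Sum>k<r. g k ^ (q ^ i) * \<nu> (i + k))"
      by (intro sum.cong refl) (use less j in simp)
    have 3: "\<mu> i = \<nu> i" using less j r_pos by simp
    have "(\<Sum>k<r. g k ^ (q ^ i) * \<nu> (i + k)) + g r ^ (q ^ i) * \<mu> j =
        (\<Sum>k<r. g k ^ (q ^ i) * \<nu> (i + k)) + g r ^ (q ^ i) * \<nu> j"
      using 1[OF assms(1)] unfolding 2 3 1[OF assms(2)] .
    then have "g r ^ (q ^ i) * \<mu> j = g r ^ (q ^ i) * \<nu> j" by (rule add_left_imp_eq)
    then show ?thesis using g_r by simp
  qed (use assms in auto)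
qed

text \<open>Applying a functional \<open>\<Lambda> n\<close> with \<open>n < N\<close> to the
  identity map gives an explicit solution of \<open>eig n\<close>.\<close>

lemma T_linear_id: "T_linear (monom 1)"
  unfolding T_linear_def by (simp add: R_monom smult_monom)

section \<open>Dimensions of the spaces of maps of bounded degree\<close>

definition sc :: "'k \<Rightarrow> (nat \<Rightarrow> 'k poly) \<Rightarrow> nat \<Rightarrow> 'k poly" where
  "sc c F = (\<lambda>j. smult c (F j))"

sublocale sc: vector_space sc
  by unfold_locales (auto simp: sc_def fun_eq_iff smult_add_left smult_add_right)

definition maps_upto :: "nat \<Rightarrow> (nat \<Rightarrow> 'k poly) set" where
  "maps_upto s = {F. T_linear F \<and> (\<forall>j. degree (F j) \<le> j + s)}"

definition chain_maps_upto :: "nat \<Rightarrow> (nat \<Rightarrow> 'k poly) set" where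
  "chain_maps_upto s = {F. T_linear F \<and> (\<forall>j. degree (F j) \<le> j + s \<and> below j (F j))}"

lemma T_linear_add: "T_linear F \<Longrightarrow> T_linear G \<Longrightarrow> T_linear (F + G)"
  by (auto simp: T_linear_def smult_add_right sum.distrib R_add)

lemma T_linear_sc:
  assumes "T_linear F"
  shows "T_linear (sc c F)"
  unfolding T_linear_def
proof
  fix j
  have "(\<Sum>k\<le>r. smult (g k ^ (q ^ j)) (sc c F (j + k))) =
      smult c (\<Sum>k\<le>r. smult (g k ^ (q ^ j)) (F (j + k)))"
    by (simp add: sc_def smult_sum_right mult.commute)
  also have "\<dots> = R (sc c F j)"
    using assms by (simp add: T_linear_def sc_def R_smult)
  finally show "(\<Sum>k\<le>r. smult (g k ^ (q ^ j)) (sc c F (j + k))) = R (sc c F j)" .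
qed

lemma T_linear_0: "T_linear 0"
  by (simp add: T_linear_def)

lemma subspace_maps_upto: "sc.subspace (maps_upto s)"
proof (rule sc.subspaceI)
  fix F c assume "F \<in> maps_upto s"
  then show "sc c F \<in> maps_upto s"
    by (auto simp: maps_upto_def T_linear_sc) (auto simp: sc_def intro: order_trans[OF degree_smult_le])
qed (auto simp: maps_upto_def T_linear_0 T_linear_add intro: degree_add_le)

text \<open>The number r (r - 1) / 2 in two roles: the codimension of the stabilizer of a full flag
  in dimension \<open>r\<close>, and the surplus that the varying bounds \<open>j + s\<close>,
  \<open>j < r\<close>, add to r (s + 1).\<close>

definition flag_codim :: nat where "flag_codim = (\<Sum>i<r. i)"

lemma basis_maps_upto: "\<exists>B. finite B \<and> sc.independent B \<and> sc.span B = maps_upto s \<and> card B = r * (s + 1) + flag_codim"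
proof -
  define I where "I = (SIGMA i:{..<r}. {..i + s})"
  define l where "l = (\<lambda>(i, m) (F :: nat \<Rightarrow> 'k poly). coeff (F i) m)"
  define b where "b = (\<lambda>(i, m). extension (\<lambda>j. if j = i then monom 1 m else 0 :: 'k poly))"
  have fI: "finite I" by (simp add: I_def)
  have "card I = (\<Sum>i<r. i + (s + 1))"
    by (simp add: I_def card_SigmaI)
  then have cI: "card I = r * (s + 1) + flag_codim"
    unfolding sum.distrib flag_codim_def by simp
  have lin: "linear_form sc (l p)" for p
    by (cases p) (simp add: linear_form_def l_def sc_def)
  have bH: "b p \<in> maps_upto s" if "p \<in> I" for p
  proof -
    obtain i m where p: "p = (i, m)" by (cases p)
    then have m: "m \<le> i + s" using that by (simp add: I_def)
    show ?thesis
      unfolding maps_upto_def p b_def prod.case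
    proof (intro CollectI conjI allI T_linear_extension, rule T_linear_degree[OF T_linear_extension])
      fix j assume "j < r"
      then show "degree (extension (\<lambda>j. if j = i then monom 1 m else 0) j) \<le> j + s"
        using m degree_monom_le[of "1 :: 'k" m] by (simp add: extension_less)
    qed
  qed
  have dual: "l p (b p') = (if p = p' then 1 else 0)" if "p \<in> I" "p' \<in> I" for p p'
    using that by (cases p; cases p') (simp add: l_def b_def extension_less I_def)
  have inj: "F = 0" if "F \<in> maps_upto s" "\<And>p. p \<in> I \<Longrightarrow> l p F = 0" for F
  proof (rule T_linear_eq_0)
    show "T_linear F" using that by (simp add: maps_upto_def)
    fix j assume j: "j < r"
    show "F j = 0"
    proof (rule poly_eqI)
      fix n
      show "coeff (F j) n = coeff 0 n"
      proof (cases "n \<le> j + s")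
        case True
        then show ?thesis using that(2)[of "(j, n)"] j by (simp add: I_def l_def)
      next
        case False
        then have "degree (F j) < n" using that(1) by (auto simp: maps_upto_def not_le intro: le_less_trans)
        then show ?thesis by (simp add: coeff_eq_0)
      qed
    qed
  qed
  have "finite (b ` I)" "sc.independent (b ` I)" "sc.span (b ` I) = maps_upto s" "card (b ` I) = card I"
    by (rule sc.basis_of_dual_family[of "maps_upto s" I l b, OF subspace_maps_upto fI lin bH dual inj]; assumption)+
  then show ?thesis
    unfolding cI by blast
qed

definition flag_pairs :: "(nat \<times> nat) set" where
  "flag_pairs = (SIGMA j:{..<N}. {n. n < j \<and> n mod d = j mod d})"

lemma finite_flag_pairs: "finite flag_pairs"
  unfolding flag_pairs_def
proof (rule finite_SigmaI)
  show "finite {n. n < j \<and> n mod d = j mod d}" for j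
    by (rule finite_subset[of _ "{..<j}"]) auto
qed simp

text \<open>Each of the \<open>d\<close> residue classes has \<open>r\<close> members below
  \<open>N = r d\<close>, hence r (r - 1) / 2 pairs. Grouping by the larger member \<open>j\<close>
  gives the summand \<open>j div d\<close>.\<close>

lemma card_flag_pairs: "card flag_pairs = d * flag_codim"
proof -
  have 1: "card {n. n < j \<and> n mod d = j mod d} = j div d" for j
  proof -
    have "{n. n < j \<and> n mod d = j mod d} = (\<lambda>l. j mod d + l * d) ` {..<j div d}"
    proof (intro equalityI subsetI)
      fix n assume n: "n \<in> {n. n < j \<and> n mod d = j mod d}"
      then have nj: "n < j" "n mod d = j mod d" by auto
      have "n = j mod d + n div d * d" unfolding nj(2)[symmetric] by simp
      moreover have "n div d < j div d"
      proof (rule ccontr)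
        assume "\<not> n div d < j div d"
        then have "j div d * d \<le> n div d * d" by simp
        then have "j \<le> n"
          using nj(2) div_mult_mod_eq[of j d] div_mult_mod_eq[of n d] by linarith
        then show False using nj by simp
      qed
      ultimately show "n \<in> (\<lambda>l. j mod d + l * d) ` {..<j div d}" by blast
    next
      fix n assume "n \<in> (\<lambda>l. j mod d + l * d) ` {..<j div d}"
      then obtain l where l: "l < j div d" "n = j mod d + l * d" by auto
      have "l * d < j div d * d" using l d_pos by simp
      then have "n < j" using l div_mult_mod_eq[of j d] by linarith
      then show "n \<in> {n. n < j \<and> n mod d = j mod d}" using l by simp
    qed
    moreover have "inj_on (\<lambda>l. j mod d + l * d) {..<j div d}"
      using d_pos by (auto simp: inj_on_def)
    ultimately show ?thesis by (simp add: card_image)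
  qed
  have 2: "(\<Sum>j<n * d. j div d) = d * (\<Sum>i<n. i)" for n
  proof (induction n)
    case (Suc n)
    have "(\<Sum>j<Suc n * d. j div d) = (\<Sum>j<n * d. j div d) + (\<Sum>j=n*d..<n*d+d. j div d)"
      by (simp add: lessThan_atLeast0 add.commute sum.atLeastLessThan_concat)
    also have "(\<Sum>j=n*d..<n*d+d. j div d) = (\<Sum>j=n*d..<n*d+d. n)"
    proof (intro sum.cong refl)
      fix j assume j: "j \<in> {n*d..<n*d+d}"
      then show "j div d = n" by (intro div_nat_eqI) (auto simp: mult.commute)
    qed
    finally show ?case using Suc by (simp add: algebra_simps)
  qed simp
  have "card flag_pairs = (\<Sum>j<N. j div d)"
    unfolding flag_pairs_def by (subst card_SigmaI) (auto simp: 1)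
  then show ?thesis using 2[of r] by (simp add: N_def flag_codim_def)
qed

lemma chain_maps_upto_eq: "chain_maps_upto s = {F \<in> maps_upto s. \<forall>p\<in>flag_pairs. \<Lambda> (snd p) (F (fst p)) = 0}"
proof (intro set_eqI iffI)
  fix F assume "F \<in> chain_maps_upto s"
  then have F: "T_linear F" "\<And>j. degree (F j) \<le> j + s" "\<forall>j. below j (F j)" by (auto simp: chain_maps_upto_def)
  then show "F \<in> {F \<in> maps_upto s. \<forall>p\<in>flag_pairs. \<Lambda> (snd p) (F (fst p)) = 0}"
    using F(3)[unfolded chain_iff[OF F(1)]] by (auto simp: maps_upto_def flag_pairs_def)
next
  fix F assume "F \<in> {F \<in> maps_upto s. \<forall>p\<in>flag_pairs. \<Lambda> (snd p) (F (fst p)) = 0}"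
  then have F: "T_linear F" "\<And>j. degree (F j) \<le> j + s"
    "\<forall>j<N. \<forall>n<j. n mod d = j mod d \<longrightarrow> \<Lambda> n (F j) = 0"
    by (auto simp: maps_upto_def flag_pairs_def)
  from F(3) have "\<forall>j. below j (F j)" unfolding chain_iff[OF F(1)] .
  then show "F \<in> chain_maps_upto s" using F by (auto simp: chain_maps_upto_def)
qed

text \<open>For the pair (m', m), take the map that modulo \<phi>_\<pp> is x -> \<Lambda>_m'(x) y,
  where y is dual to \<Lambda>_m. It respects T because \<open>t m = t m'\<close>. Among the
  functionals of index below \<open>N\<close> only \<Lambda>_m sees its values, and \<Lambda>_m'
  vanishes on \<tau>^j for j > m'; this is the triangularity needed.\<close>

lemma ex_dual:
  assumes p: "p \<in> flag_pairs" and s: "N - 1 \<le> s"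
  shows "\<exists>F\<in>maps_upto s. \<Lambda> (snd p) (F (fst p)) = 1 \<and>
    (\<forall>p'\<in>flag_pairs. p' \<noteq> p \<longrightarrow> fst p \<le> fst p' \<longrightarrow> \<Lambda> (snd p') (F (fst p')) = 0)"
proof -
  obtain m' m where p_eq: "p = (m', m)" by (cases p)
  have m: "m < m'" "m' < N" "m mod d = m' mod d" using p by (auto simp: p_eq flag_pairs_def)
  obtain y where y: "degree y \<le> N - 1" "\<And>n. n < N \<Longrightarrow> \<Lambda> n y = (if n = m then 1 else 0)"
    using ex_\<Lambda>[of "\<lambda>n. if n = m then 1 else 0"] by auto
  define F where "F = extension (\<lambda>i. smult (\<Lambda> m' (monom 1 i)) y)"
  have F: "T_linear F" by (simp add: F_def T_linear_extension)
  have "F \<in> maps_upto s"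
    unfolding maps_upto_def
  proof (intro CollectI conjI allI F, rule T_linear_degree[OF F])
    fix j assume "j < r"
    then show "degree (F j) \<le> j + s"
      unfolding F_def using y(1) s degree_smult_le[of "\<Lambda> m' (monom 1 j)" y] by (simp add: extension_less)
  qed
  have "eig m (\<lambda>j. \<Lambda> m' (monom 1 j))"
    using eig_\<Lambda>[OF T_linear_id m(2)] eig_cong[of m m'] t_eq_iff m by blast
  \<comment> \<open>Both sides solve the same recursion and agree for \<open>j < r\<close>, where
    \<open>F\<close> is prescribed. For larger \<open>j\<close> the value \<open>F j\<close> is not
    explicit, but its functionals are.\<close>
  then have \<Lambda>F: "\<Lambda> n (F j) = (if n = m then \<Lambda> m' (monom 1 j) else 0)" if "n < N" for n j
  proof (cases "n = m")
    case True
    have "\<Lambda> m (F j) = \<Lambda> m' (monom 1 j)"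
    proof (rule eig_unique)
      show "eig m (\<lambda>j. \<Lambda> m (F j))" by (rule eig_\<Lambda>[OF F]) (use m in simp)
      show "eig m (\<lambda>j. \<Lambda> m' (monom 1 j))" by fact
      fix j assume "j < r"
      then show "\<Lambda> m (F j) = \<Lambda> m' (monom 1 j)"
        using y(2)[of m] m by (simp add: F_def extension_less \<Lambda>_smult)
    qed
    then show ?thesis using True by simp
  next
    case False
    have "\<Lambda> n (F j) = 0"
    proof (rule eig_unique)
      show "eig n (\<lambda>j. \<Lambda> n (F j))" by (rule eig_\<Lambda>[OF F that])
      show "eig n (\<lambda>j. 0)" by (simp add: eig_def)
      fix j assume "j < r"
      then show "\<Lambda> n (F j) = 0"
        using y(2)[OF that] False by (simp add: F_def extension_less \<Lambda>_smult)
    qed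
    then show ?thesis using False by simp
  qed
  show ?thesis
  proof (intro bexI[of _ F] conjI ballI impI)
    show "\<Lambda> (snd p) (F (fst p)) = 1"
      using \<Lambda>F[of m m'] m by (simp add: p_eq \<Lambda>_monom)
    fix p' assume p': "p' \<in> flag_pairs" "p' \<noteq> p" "fst p \<le> fst p'"
    obtain n' n where p'_eq: "p' = (n', n)" by (cases p')
    have n: "n < n'" "n' < N" "m' \<le> n'" using p' by (auto simp: p'_eq p_eq flag_pairs_def)
    show "\<Lambda> (snd p') (F (fst p')) = 0"
    proof (cases "n = m")
      case True
      then have "m' < n'" using p' n by (simp add: p_eq p'_eq)
      then show ?thesis using \<Lambda>F[of n n'] n True by (simp add: p'_eq \<Lambda>_monom_less)
    qed (use \<Lambda>F[of n n'] n in \<open>simp add: p'_eq\<close>)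
  qed fact
qed

lemma basis_chain_maps_upto:
  "\<exists>B. finite B \<and> sc.independent B \<and> sc.span B = chain_maps_upto s \<and> r * (s + 1) + flag_codim \<le> card B + d * flag_codim \<and>
     (N - 1 \<le> s \<longrightarrow> r * (s + 1) + flag_codim = card B + d * flag_codim)"
proof -
  from basis_maps_upto[of s] obtain B where B: "finite B \<and> sc.independent B \<and> sc.span B = maps_upto s \<and>
    card B = r * (s + 1) + flag_codim" ..
  define l where "l = (\<lambda>p (F :: nat \<Rightarrow> 'k poly). \<Lambda> (snd p) (F (fst p)))"
  have lin: "linear_form sc (l p)" for p
    by (simp add: linear_form_def l_def sc_def \<Lambda>_add \<Lambda>_smult)
  from B have "finite B" "sc.independent B" by auto
  \<comment> \<open>The weights are negative because the dual map of a pair is controlled on pairs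
    with an equal or larger first index.\<close>
  from sc.kernel_of_functionals[OF this finite_flag_pairs, of l "\<lambda>p. - int (fst p)"] lin
  obtain B' where B': "finite B' \<and> sc.independent B' \<and>
      sc.span B' = {x \<in> sc.span B. \<forall>i\<in>flag_pairs. l i x = 0} \<and>
      card B \<le> card B' + card flag_pairs \<and>
      ((\<forall>i\<in>flag_pairs. \<exists>e\<in>sc.span B. l i e \<noteq> 0 \<and>
            (\<forall>j\<in>flag_pairs. j \<noteq> i \<longrightarrow> - int (fst j) \<le> - int (fst i) \<longrightarrow> l j e = 0)) \<longrightarrow>
       card B = card B' + card flag_pairs)" by auto
  have "sc.span B' = chain_maps_upto s" using B B' by (simp add: chain_maps_upto_eq l_def)
  moreover have "card B = card B' + card flag_pairs" if s: "N - 1 \<le> s"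
  proof -
    have "\<exists>e\<in>sc.span B. l i e \<noteq> 0 \<and>
            (\<forall>j\<in>flag_pairs. j \<noteq> i \<longrightarrow> - int (fst j) \<le> - int (fst i) \<longrightarrow> l j e = 0)" if "i \<in> flag_pairs" for i
    proof -
      from ex_dual[OF that s] obtain F where "F \<in> maps_upto s" "\<Lambda> (snd i) (F (fst i)) = 1"
        "\<forall>p'\<in>flag_pairs. p' \<noteq> i \<longrightarrow> fst i \<le> fst p' \<longrightarrow> \<Lambda> (snd p') (F (fst p')) = 0" by auto
      then show ?thesis using B by (intro bexI[of _ F]) (auto simp: l_def)
    qed
    then show ?thesis using B' by auto
  qed
  ultimately show ?thesis using B B' card_flag_pairs by (intro exI[of _ B']) auto
qed

end

lemma card_additive_image:
  fixes f :: "'a::ab_group_add \<Rightarrow> 'b::ab_group_add"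
  assumes "finite A" and diff: "\<And>x y. x \<in> A \<Longrightarrow> y \<in> A \<Longrightarrow> x - y \<in> A"
    and f: "\<And>x y. x \<in> A \<Longrightarrow> y \<in> A \<Longrightarrow> f (x - y) = f x - f y"
  shows "card A = card (f ` A) * card {x \<in> A. f x = 0}"
proof -
  define g where "g = inv_into A f"
  have g: "g y \<in> A" "f (g y) = y" if "y \<in> f ` A" for y
    using that by (auto simp: g_def inv_into_into f_inv_into_f)
  have add: "x + y \<in> A \<and> f (x + y) = f x + f y" if "x \<in> A" "y \<in> A" for x y
  proof -
    have "0 \<in> A" "f 0 = 0" using diff[OF that(1) that(1)] f[OF that(1) that(1)] by auto
    then have "- y \<in> A" "f (- y) = - f y" using diff[of 0 y] f[of 0 y] that by auto
    then show ?thesis using diff[of x "- y"] f[of x "- y"] that by auto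
  qed
  have "bij_betw (\<lambda>x. (f x, x - g (f x))) A (f ` A \<times> {x \<in> A. f x = 0})"
  proof (rule bij_betwI[where g = "\<lambda>(y, z). g y + z"])
    show "(\<lambda>x. (f x, x - g (f x))) \<in> A \<rightarrow> f ` A \<times> {x \<in> A. f x = 0}"
      using g diff f by auto
    show "(\<lambda>(y, z). g y + z) \<in> f ` A \<times> {x \<in> A. f x = 0} \<rightarrow> A"
      using g add by auto
    show "(case (f x, x - g (f x)) of (y, z) \<Rightarrow> g y + z) = x" if "x \<in> A" for x
      by simp
    show "(f (case p of (y, z) \<Rightarrow> g y + z), (case p of (y, z) \<Rightarrow> g y + z) -
        g (f (case p of (y, z) \<Rightarrow> g y + z))) = p" if "p \<in> f ` A \<times> {x \<in> A. f x = 0}" for p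
    proof -
      obtain y z where p: "p = (y, z)" by (cases p)
      then have "y \<in> f ` A" "z \<in> A" "f z = 0" using that by auto
      then have "f (g y + z) = y" using g[of y] add[of "g y" z] by simp
      then show ?thesis by (simp add: p)
    qed
  qed
  then show ?thesis by (simp add: bij_betw_same_card card_cartesian_product)
qed

section \<open>Descent from chain-preserving maps to endomorphisms\<close>

context supersingular_drinfeld
begin

lemma T_linear_at_0: "T_linear F \<Longrightarrow> (\<Sum>k\<le>r. smult (g k) (F k)) = R (F 0)"
  unfolding T_linear_def by (drule spec[of _ 0]) simp

definition qroot :: "'k \<Rightarrow> 'k" where "qroot y = (SOME x. x ^ q = y)"

lemma qroot: "qroot y ^ q = y"
  unfolding qroot_def by (rule someI_ex) (rule ex_root, simp)

lemma qroot_0: "qroot 0 = 0"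
  using qroot[of 0] by simp

definition tau :: "'k poly \<Rightarrow> 'k poly" where "tau x = tmult q (monom 1 1) x"

lemma tau_add: "tau (x + y) = tau x + tau y"
  and tau_diff: "tau (x - y) = tau x - tau y"
  and tau_0 [simp]: "tau 0 = 0"
  and tau_sum: "tau (\<Sum>i\<in>S. f i) = (\<Sum>i\<in>S. tau (f i))"
  by (simp_all add: tau_def tmult_add_right tmult_diff_right tmult_sum_right)

lemma tau_eq_0_iff: "tau x = 0 \<longleftrightarrow> x = 0"
  by (simp add: tau_def tmult_eq_0_iff monom_eq_0_iff)

definition untau :: "'k poly \<Rightarrow> 'k poly" where
  "untau x = (\<Sum>n\<le>degree x. monom (qroot (coeff x (Suc n))) n)"

lemma coeff_untau: "coeff (untau x) n = qroot (coeff x (Suc n))"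
proof (cases "n \<le> degree x")
  case False
  then show ?thesis by (simp add: untau_def coeff_sum coeff_eq_0 qroot_0)
qed (simp add: untau_def coeff_sum)

lemma coeff_tau: "coeff (tau x) n = (if n = 0 then 0 else coeff x (n - 1) ^ q)"
proof (cases n)
  case (Suc m)
  have "coeff (tau x) n = (\<Sum>i\<in>{1}. coeff (monom 1 1) i * coeff x (n - i) ^ (q ^ i))"
    unfolding tau_def coeff_tmult by (intro sum.mono_neutral_right) (auto simp: Suc)
  then show ?thesis by (simp add: Suc)
qed (simp add: tau_def coeff_tmult)

lemma tau_untau: "coeff x 0 = 0 \<Longrightarrow> tau (untau x) = x"
  by (rule poly_eqI) (auto simp: coeff_tau coeff_untau qroot)

lemma tau_inj: "tau x = tau y \<longleftrightarrow> x = y"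
  using tau_eq_0_iff[of "x - y"] by (simp add: tau_diff)

lemma tau_smult: "tau (smult c x) = smult (c ^ q) (tau x)"
  by (rule poly_eqI) (simp add: coeff_tau power_mult_distrib)

lemma tau_R: "tau (R x) = R (tau x)"
  by (simp add: R_def tau_def tmult_assoc)

lemma tau_monom: "tmult q (monom 1 (Suc j)) x = tau (tmult q (monom 1 j) x)"
  by (simp add: tau_def tmult_assoc[symmetric] tmult_monom)

text \<open>This is \<tau>^(-1) F \<tau>; on chain-preserving maps the value at \<tau>^(j+1) is
  divisible by \<tau> on the left. A fixed map satisfies F(\<tau>^(j+1)) = \<tau> F(\<tau>^j), so it
  is right multiplication by its value at 1.\<close>

definition \<rho> :: "(nat \<Rightarrow> 'k poly) \<Rightarrow> nat \<Rightarrow> 'k poly" where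
  "\<rho> F j = untau (F (Suc j))"

lemma chain_maps_uptoD:
  assumes "F \<in> chain_maps_upto s"
  shows "T_linear F" "degree (F j) \<le> j + s" "below j (F j)"
  using assms by (auto simp: chain_maps_upto_def)

lemma tau_\<rho>: "F \<in> chain_maps_upto s \<Longrightarrow> tau (\<rho> F j) = F (Suc j)"
  unfolding \<rho>_def using chain_maps_uptoD(3)[of F s "Suc j"] by (intro tau_untau) (simp add: below_def)

lemma subspace_chain_maps_upto: "sc.subspace (chain_maps_upto s)"
  using basis_chain_maps_upto[of s] sc.subspace_span by metis

lemma \<rho>_chain_maps_upto:
  assumes F: "F \<in> chain_maps_upto s"
  shows "\<rho> F \<in> chain_maps_upto s"
  unfolding chain_maps_upto_def
proof (intro CollectI conjI allI)
  note \<tau> = tau_\<rho>[OF F]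
  show "T_linear (\<rho> F)"
    unfolding T_linear_def
  proof
    fix j
    have "tau (\<Sum>k\<le>r. smult (g k ^ (q ^ j)) (\<rho> F (j + k))) =
        (\<Sum>k\<le>r. smult (g k ^ (q ^ Suc j)) (F (Suc j + k)))"
      by (simp add: tau_sum tau_smult \<tau> mult.commute flip: power_mult)
    also have "\<dots> = tau (R (\<rho> F j))"
      using chain_maps_uptoD(1)[OF F] by (simp only: T_linear_def tau_R \<tau>)
    finally show "(\<Sum>k\<le>r. smult (g k ^ (q ^ j)) (\<rho> F (j + k))) = R (\<rho> F j)"
      unfolding tau_inj .
  qed
  fix j
  show "degree (\<rho> F j) \<le> j + s"
  proof (cases "\<rho> F j = 0")
    case False
    then have "degree (F (Suc j)) = 1 + degree (\<rho> F j)"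
      unfolding \<tau>[symmetric] tau_def
      by (subst degree_tmult) (auto simp: degree_monom_eq monom_eq_0_iff)
    then show ?thesis using chain_maps_uptoD(2)[OF F, of "Suc j"] by simp
  qed simp
  show "below j (\<rho> F j)"
    using chain_maps_uptoD(3)[OF F, of "Suc j"] unfolding \<tau>[symmetric]
    by (auto simp: below_def coeff_tau)
qed

lemma semilinear: "semilinear_map \<gamma> q sc (chain_maps_upto s) \<rho>"
proof unfold_locales
  show "sc.subspace (chain_maps_upto s)" by (rule subspace_chain_maps_upto)
  fix F assume F: "F \<in> chain_maps_upto s"
  show "\<rho> F \<in> chain_maps_upto s" using F by (rule \<rho>_chain_maps_upto)
  show "\<rho> (F + G) = \<rho> F + \<rho> G" if G: "G \<in> chain_maps_upto s" for G
  proof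
    fix j
    have "tau (\<rho> (F + G) j) = tau ((\<rho> F + \<rho> G) j)"
      using tau_\<rho>[OF F] tau_\<rho>[OF G] tau_\<rho>[OF sc.subspace_add[OF subspace_chain_maps_upto F G]]
      by (simp add: tau_add)
    then show "\<rho> (F + G) j = (\<rho> F + \<rho> G) j" by (simp only: tau_inj)
  qed
  show "\<rho> (sc (c ^ q) F) = sc c (\<rho> F)" for c
  proof
    fix j
    have "tau (\<rho> (sc (c ^ q) F) j) = sc (c ^ q) F (Suc j)"
      by (rule tau_\<rho>[OF sc.subspace_scale[OF subspace_chain_maps_upto F]])
    then have "tau (\<rho> (sc (c ^ q) F) j) = tau (sc c (\<rho> F) j)"
      by (simp add: sc_def tau_smult tau_\<rho>[OF F])
    then show "\<rho> (sc (c ^ q) F) j = sc c (\<rho> F) j" by (simp only: tau_inj)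
  qed
  assume "\<rho> F = 0"
  then have F_Suc: "F (Suc j) = 0" for j using tau_\<rho>[OF F, of j] by simp
  have "F j = 0" if "0 < j" for j using F_Suc[of "j - 1"] that by simp
  then have "(\<Sum>k\<le>r. smult (g k ^ (q ^ 0)) (F (0 + k))) = (\<Sum>k\<in>{0}. smult (g k) (F k))"
    by (intro sum.mono_neutral_cong_right) auto
  then have R: "R (F 0) = smult (g 0) (F 0)"
    using T_linear_at_0[OF chain_maps_uptoD(1)[OF F]] by simp
  \<comment> \<open>The relation has collapsed to \<open>R (F 0) = smult (g 0) (F 0)\<close>, which
    is impossible for a nonzero \<open>F 0\<close> because \<open>R\<close> raises degrees by
    \<open>r\<close>.\<close>
  have "F 0 = 0"
  proof (rule ccontr)
    assume "F 0 \<noteq> 0"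
    then have "degree (R (F 0)) = degree (F 0) + r"
      by (simp add: R_def degree_tmult P_nonzero degree_P)
    then show False
      using degree_smult_le[of "g 0" "F 0"] r_pos unfolding R by simp
  qed
  then have "F j = 0" for j using F_Suc by (cases j) auto
  then show "F = 0" by (simp add: fun_eq_iff)
qed

text \<open>The strict bound makes \<open>End_below 0\<close> trivial, so that sizes can be built up
  degree by degree from \<open>n = 0\<close>.\<close>

definition End_below :: "nat \<Rightarrow> 'k poly set" where
  "End_below n = {u. tmult q u P = tmult q P u \<and> (\<forall>i\<ge>n. coeff u i = 0)}"

lemma End_upto_eq: "End_upto \<phi> s = End_below (Suc s)"
proof -
  have "u \<in> End_ring \<phi> \<and> degree u \<le> s \<longleftrightarrow> u \<in> End_below (Suc s)" for u
    by (auto simp: End_below_def End_ring_iff coeff_eq_0 Suc_le_eq intro!: degree_le)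
  moreover have "0 \<in> End_below (Suc s)" by (simp add: End_below_def)
  ultimately show ?thesis unfolding End_upto_def by blast
qed

lemma Fix_eq: "{F \<in> chain_maps_upto s. \<rho> F = F} = (\<lambda>u j. tmult q (monom 1 j) u) ` End_below (Suc s)"
proof (intro equalityI subsetI)
  fix F assume "F \<in> {F \<in> chain_maps_upto s. \<rho> F = F}"
  then have F: "F \<in> chain_maps_upto s" and \<rho>F: "\<rho> F = F" by auto
  define u where "u = F 0"
  have F_eq: "F j = tmult q (monom 1 j) u" for j
  proof (induction j)
    case (Suc j)
    then show ?case using tau_\<rho>[OF F, of j] by (simp add: \<rho>F tau_monom)
  qed (simp add: u_def tmult_const_left monom_0)
  \<comment> \<open>The relation of \<open>T_linear\<close> at \<open>j = 0\<close> is exactly the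
    commutation of \<open>u\<close> with \<open>P\<close>.\<close>
  have "tmult q P u = (\<Sum>k\<le>r. smult (g k) (F k))"
    by (subst P_sum) (simp add: tmult_sum_left F_eq smult_monom flip: tmult_smult_left)
  also have "\<dots> = R u"
    using T_linear_at_0[OF chain_maps_uptoD(1)[OF F]] by (simp add: u_def)
  finally have "tmult q u P = tmult q P u" by (simp add: R_def)
  moreover have "degree u \<le> s" using chain_maps_uptoD(2)[OF F, of 0] by (simp add: u_def)
  ultimately have "u \<in> End_below (Suc s)" by (auto simp: End_below_def coeff_eq_0 Suc_le_eq)
  then show "F \<in> (\<lambda>u j. tmult q (monom 1 j) u) ` End_below (Suc s)"
    using F_eq by (intro image_eqI[of _ _ u]) auto
next
  fix F assume "F \<in> (\<lambda>u j. tmult q (monom 1 j) u) ` End_below (Suc s)"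
  then obtain u where u: "u \<in> End_below (Suc s)" and F: "F = (\<lambda>j. tmult q (monom 1 j) u)" by blast
  have comm: "tmult q u P = tmult q P u" using u by (simp add: End_below_def)
  have deg: "degree u \<le> s" using u by (auto simp: End_below_def Suc_le_eq intro!: degree_le)
  have "F \<in> chain_maps_upto s"
    unfolding chain_maps_upto_def
  proof (intro CollectI conjI allI)
    show "T_linear F"
      unfolding T_linear_def
    proof
      fix j
      have "R (F j) = tmult q (tmult q (monom 1 j) P) u"
        by (simp add: R_def F tmult_assoc comm)
      also have "tmult q (monom 1 j) P = (\<Sum>k\<le>r. smult (g k ^ (q ^ j)) (monom 1 (j + k)))"
        by (subst P_sum) (simp add: tmult_sum_right tmult_monom smult_monom)
      finally show "(\<Sum>k\<le>r. smult (g k ^ (q ^ j)) (F (j + k))) = R (F j)"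
        by (simp add: F tmult_sum_left tmult_smult_left)
    qed
    fix j
    show "degree (F j) \<le> j + s"
      using degree_tmult_le[of "monom 1 j" u] degree_monom_le[of "1 :: 'k" j] deg by (simp add: F)
    show "below j (F j)"
      unfolding F by (intro below_tmult below_monom order_refl)
  qed
  moreover have "\<rho> F j = F j" for j
    using tau_\<rho>[OF \<open>F \<in> chain_maps_upto s\<close>, of j] unfolding F tau_monom tau_inj .
  ultimately show "F \<in> {F \<in> chain_maps_upto s. \<rho> F = F}" by auto
qed

lemma card_End_below:
  "\<exists>D. card (End_below (Suc s)) = q ^ D \<and> r * Suc s + flag_codim \<le> D + d * flag_codim \<and>
     (N \<le> Suc s \<longrightarrow> r * Suc s + flag_codim = D + d * flag_codim)"
proof -
  from basis_chain_maps_upto[of s] obtain B where B: "finite B" "sc.independent B" "sc.span B = chain_maps_upto s"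
    "r * (s + 1) + flag_codim \<le> card B + d * flag_codim" "N - 1 \<le> s \<longrightarrow> r * (s + 1) + flag_codim = card B + d * flag_codim"
    by (elim exE conjE)
  interpret sl: semilinear_map \<gamma> q sc "chain_maps_upto s" \<rho> by (rule semilinear)
  have "inj_on (\<lambda>u j. tmult q (monom 1 j) u) (End_below (Suc s))"
  proof (rule inj_onI)
    fix u v :: "'k poly"
    assume "(\<lambda>j. tmult q (monom 1 j) u) = (\<lambda>j. tmult q (monom 1 j) v)"
    from fun_cong[OF this, of 0] show "u = v" by (simp add: monom_0 tmult_const_left)
  qed
  then have "card (End_below (Suc s)) = card {F \<in> chain_maps_upto s. \<rho> F = F}"
    unfolding Fix_eq by (simp add: card_image)
  also have "\<dots> = q ^ card B" by (rule sl.card_Fix[OF B(1-3)])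
  finally show ?thesis using B(4,5) by (intro exI[of _ "card B"]) auto
qed

lemma finite_End_below_Suc: "finite (End_below (Suc s))"
proof -
  obtain D where "card (End_below (Suc s)) = q ^ D" using card_End_below by blast
  then have "0 < card (End_below (Suc s))" using q_pos by simp
  then show ?thesis by (rule card_ge_0_finite)
qed

lemma End_below_mono: "m \<le> n \<Longrightarrow> End_below m \<subseteq> End_below n"
  by (auto simp: End_below_def)

lemma finite_End_below: "finite (End_below n)"
  using finite_End_below_Suc[of n] End_below_mono[of n "Suc n"] finite_subset by auto

lemma End_below_0: "End_below 0 = {0}"
  by (auto simp: End_below_def poly_eq_iff)

lemma End_below_diff: "u \<in> End_below n \<Longrightarrow> v \<in> End_below n \<Longrightarrow> u - v \<in> End_below n"
  by (auto simp: End_below_def tmult_diff_left tmult_diff_right)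

lemma End_below_smult:
  assumes "u \<in> End_below n"
  shows "smult (emb c) u \<in> End_below n"
proof -
  have "tmult q P (smult (emb c) u) = smult (emb c) (tmult q P u)"
    by (simp only: tmult_emb_right[symmetric] tmult_assoc)
  then show ?thesis using assms by (simp add: End_below_def tmult_smult_left)
qed

lemma degree_End_below: "u \<in> End_below (Suc n) \<Longrightarrow> degree u \<le> n"
  by (auto simp: End_below_def Suc_le_eq intro!: degree_le)

section \<open>Leading coefficients and their deficiency\<close>

definition lead_coeffs :: "nat \<Rightarrow> 'k set" where "lead_coeffs n = (\<lambda>u. coeff u n) ` End_below (Suc n)"

lemma card_End_below_Suc: "card (End_below (Suc n)) = card (lead_coeffs n) * card (End_below n)"
proof -
  have "{u \<in> End_below (Suc n). coeff u n = 0} = End_below n"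
    by (auto simp: End_below_def le_Suc_eq) (metis Suc_leI le_neq_implies_less)
  then show ?thesis
    unfolding lead_coeffs_def
    using card_additive_image[OF finite_End_below, of "Suc n" "\<lambda>u. coeff u n"] by (simp add: End_below_diff)
qed

lemma lead_coeffs_eq:
  assumes "x \<in> lead_coeffs n"
  shows "x * g r ^ (q ^ n) = g r * x ^ (q ^ r)"
proof -
  obtain u where u: "u \<in> End_below (Suc n)" "x = coeff u n" using assms by (auto simp: lead_coeffs_def)
  have "coeff (tmult q u P) (n + r) = coeff (tmult q P u) (r + n)"
    using u by (simp add: End_below_def add.commute)
  then show ?thesis
    using u degree_End_below[OF u(1)] by (simp add: coeff_tmult_bound degree_P g_def)
qed

text \<open>Comparing the top coefficients of u P and P u makes every leading coefficient a root of
  one polynomial of degree q^r.\<close>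

lemma card_lead_coeffs_le: "card (lead_coeffs n) \<le> q ^ r"
proof -
  let ?P = "monom (g r) (q ^ r) - monom (g r ^ (q ^ n)) 1"
  have q1: "1 < q ^ r" using q_gt_1 r_pos by (rule one_less_power)
  then have "coeff ?P (q ^ r) \<noteq> 0" using g_r by simp
  then have nz: "?P \<noteq> 0" by (metis coeff_0)
  have "degree ?P \<le> q ^ r"
    using q1 by (intro degree_diff_le order_trans[OF degree_monom_le]) auto
  moreover have "lead_coeffs n \<subseteq> {x. poly ?P x = 0}"
  proof
    fix x assume "x \<in> lead_coeffs n"
    from lead_coeffs_eq[OF this] show "x \<in> {x. poly ?P x = 0}" by (simp add: poly_monom mult.commute)
  qed
  then have "card (lead_coeffs n) \<le> card {x. poly ?P x = 0}"
    by (rule card_mono[OF poly_roots_finite[OF nz]])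
  ultimately show ?thesis using card_poly_roots_bound[OF nz] by simp
qed

lemma finite_lead_coeffs: "finite (lead_coeffs n)"
  using finite_End_below by (simp add: lead_coeffs_def)

text \<open>Multiplying an endomorphism by \<open>P\<close> gives an endomorphism again; the degree
  bound rises by \<open>r\<close> and leading coefficients are scaled by a nonzero constant.\<close>

lemma card_lead_coeffs_add: "card (lead_coeffs n) \<le> card (lead_coeffs (n + r))"
proof -
  let ?f = "\<lambda>x. x * g r ^ (q ^ n)"
  have "?f x \<in> lead_coeffs (n + r)" if "x \<in> lead_coeffs n" for x
  proof -
    obtain u where u: "u \<in> End_below (Suc n)" "x = coeff u n"
      using \<open>x \<in> lead_coeffs n\<close> unfolding lead_coeffs_def by blast
    have "tmult q u P \<in> End_below (Suc (n + r))"
      using u degree_tmult_le[of u P] degree_End_below[OF u(1)]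
      by (auto simp: End_below_def degree_P tmult_assoc intro!: coeff_eq_0)
    moreover have "?f x = coeff (tmult q u P) (n + r)"
      using u degree_End_below[OF u(1)] by (simp add: coeff_tmult_bound degree_P g_def)
    ultimately show ?thesis by (auto simp: lead_coeffs_def)
  qed
  moreover have "inj_on ?f (lead_coeffs n)" using g_r by (auto simp: inj_on_def)
  ultimately show ?thesis
    using card_inj_on_le[of ?f "lead_coeffs n" "lead_coeffs (n + r)"] finite_lead_coeffs by auto
qed

end

text \<open>If \<delta> is nonzero at i, it is positive at i, i - r, i - 2r, and so on, which makes
  i div r + 1 terms. For i at least r c these alone exceed the total c. The threshold r c is the
  constant r^2 (r - 1) (d - 1) / 2 of the theorem.\<close>

lemma deficiency_bound:
  fixes \<delta> :: "nat \<Rightarrow> nat"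
  assumes r: "0 < r" and mono: "\<And>i. \<delta> (i + r) \<le> \<delta> i"
    and sum: "\<And>n. N \<le> n \<Longrightarrow> (\<Sum>i<n. \<delta> i) = c"
    and n: "r * c \<le> n"
  shows "(\<Sum>i<n. \<delta> i) = c"
proof -
  have zero: "\<delta> i = 0" if i: "r * c \<le> i" for i
  proof (rule ccontr)
    assume nz: "\<delta> i \<noteq> 0"
    have pos: "0 < \<delta> (i - r * l)" if "l \<le> i div r" for l
      using that
    proof (induction l)
      case (Suc l)
      have "r * Suc l \<le> r * (i div r)" using Suc.prems by (intro mult_le_mono2)
      also have "\<dots> \<le> i" by (rule times_div_less_eq_dividend)
      finally have "i - r * l = i - r * Suc l + r" by simp
      then show ?case using mono[of "i - r * Suc l"] Suc by simp
    qed (use nz in simp)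
    let ?f = "\<lambda>l. i - r * l"
    let ?I = "?f ` {..i div r}"
    have inj: "inj_on ?f {..i div r}"
    proof (rule inj_onI)
      fix l l' assume l: "l \<in> {..i div r}" "l' \<in> {..i div r}" "?f l = ?f l'"
      have "r * l \<le> r * (i div r)" "r * l' \<le> r * (i div r)"
        using l by (auto intro: mult_le_mono2)
      then have "r * l \<le> i" "r * l' \<le> i"
        using times_div_less_eq_dividend[of r i] by linarith+
      then have "r * l = r * l'" using l by linarith
      then show "l = l'" using r by simp
    qed
    have "c \<le> i div r" using i r by (simp add: less_eq_div_iff_mult_less_eq mult.commute)
    then have "c < card ?I" using inj by (simp add: card_image)
    also have "\<dots> \<le> (\<Sum>j\<in>?I. \<delta> j)"
      unfolding card_eq_sum by (intro sum_mono) (use pos in \<open>force simp: Suc_le_eq\<close>)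
    also have "\<dots> \<le> (\<Sum>j<max (Suc i) N. \<delta> j)"
      by (intro sum_mono2) (auto simp: less_max_iff_disj)
    also have "\<dots> = c" by (rule sum) simp
    finally show False by simp
  qed
  have "(\<Sum>i<n. \<delta> i) = (\<Sum>i<max n N. \<delta> i)"
    by (intro sum.mono_neutral_left) (use zero n in auto)
  also have "\<dots> = c" by (rule sum) simp
  finally show ?thesis .
qed

context supersingular_drinfeld
begin

theorem card_End_upto:
  assumes "r * ((d - 1) * flag_codim) \<le> Suc s"
  shows "\<exists>D. card (End_upto \<phi> s) = q ^ D \<and> D + (d - 1) * flag_codim = r * Suc s"
proof -
  define c where "c = (d - 1) * flag_codim"
  have dsr: "d * flag_codim = c + flag_codim" using d_pos by (cases d) (auto simp: c_def)
  have "\<exists>D. card (End_below n) = q ^ D \<and> (N \<le> n \<longrightarrow> D + c = r * n)" for n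
  proof (cases n)
    case 0
    then show ?thesis using N_pos by (intro exI[of _ 0]) (simp add: End_below_0)
  next
    case (Suc s)
    then show ?thesis using card_End_below[of s] dsr by auto
  qed
  then have "\<forall>n. \<exists>D. card (End_below n) = q ^ D \<and> (N \<le> n \<longrightarrow> D + c = r * n)" by blast
  from choice[OF this] obtain D where
    D: "\<And>n. card (End_below n) = q ^ D n" "\<And>n. N \<le> n \<Longrightarrow> D n + c = r * n" by blast
  have "q ^ D 0 = q ^ 0" using D(1)[of 0] by (simp add: End_below_0)
  then have D_0: "D 0 = 0" unfolding power_inject_exp[OF q_gt_1] .
  have D_mono: "D n \<le> D (Suc n)" for n
    using card_mono[OF finite_End_below End_below_mono, of n "Suc n"] q_gt_1 by (simp add: D)
  have card_lead_coeffs: "card (lead_coeffs n) = q ^ (D (Suc n) - D n)" for n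
  proof -
    have "card (lead_coeffs n) * q ^ D n = q ^ (D (Suc n) - D n) * q ^ D n"
      using card_End_below_Suc[of n] D_mono[of n] by (simp add: D flip: power_add)
    then show ?thesis using q_pos by simp
  qed
  \<comment> \<open>\<open>\<delta> n\<close> is the base-\<open>q\<close> logarithm of the factor
    by which \<open>lead_coeffs n\<close> misses the maximal size q^r. Its partial sums compare
    \<open>card (End_below n)\<close> with q^(r n), so they equal \<open>c\<close> from
    \<open>N\<close> on.\<close>
  define \<delta> where "\<delta> n = r - (D (Suc n) - D n)" for n
  have step: "D (Suc n) - D n \<le> r" for n
    using card_lead_coeffs_le[of n] q_gt_1 by (simp add: card_lead_coeffs)
  have \<delta>_sum: "D n + (\<Sum>i<n. \<delta> i) = r * n" for n
  proof (induction n)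
    case (Suc n)
    then show ?case using step[of n] D_mono[of n] by (simp add: \<delta>_def)
  qed (simp add: D_0)
  have "(\<Sum>i<Suc s. \<delta> i) = c"
  proof (rule deficiency_bound[of r])
    show "\<delta> (i + r) \<le> \<delta> i" for i
      using card_lead_coeffs_add[of i] q_gt_1 by (simp add: card_lead_coeffs \<delta>_def)
    show "(\<Sum>i<n. \<delta> i) = c" if "N \<le> n" for n
      using \<delta>_sum[of n] D(2)[OF that] by simp
  qed (use r_pos assms in \<open>auto simp: c_def\<close>)
  then have "D (Suc s) + c = r * Suc s" using \<delta>_sum[of "Suc s"] by simp
  then show ?thesis using D(1)[of "Suc s"] by (auto simp: End_upto_eq c_def)
qed

end

section \<open>Torsion and ranks\<close>

context A_field
begin

abbreviation K :: "nat \<Rightarrow> 'k set" where "K m \<equiv> Fqm q m"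

lemma K_0 [simp]: "0 \<in> K m"
  and K_1 [simp]: "1 \<in> K m"
  and K_add: "x \<in> K m \<Longrightarrow> y \<in> K m \<Longrightarrow> x + y \<in> K m"
  and K_diff: "x \<in> K m \<Longrightarrow> y \<in> K m \<Longrightarrow> x - y \<in> K m"
  and K_mult: "x \<in> K m \<Longrightarrow> y \<in> K m \<Longrightarrow> x * y \<in> K m"
  and K_divide: "x \<in> K m \<Longrightarrow> y \<in> K m \<Longrightarrow> x / y \<in> K m"
  by (simp_all add: Fqm_def frob_add_pow frob_diff power_mult_distrib power_divide)

lemma K_uminus: "x \<in> K m \<Longrightarrow> - x \<in> K m"
  using K_diff[of 0 m x] by simp

lemma K_sum: "(\<And>i. i \<in> I \<Longrightarrow> f i \<in> K m) \<Longrightarrow> (\<Sum>i\<in>I. f i) \<in> K m"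
  by (induction I rule: infinite_finite_induct) (auto intro: K_add)

lemma card_residue_field:
  assumes \<theta>: "is_residue_iso \<gamma> m \<qq> \<theta>" and "degree \<qq> = m" "0 < m"
  shows "finite (K m)" "card (K m) = q ^ m"
proof -
  show fin: "finite (K m)" using card_Fqm_le[OF \<open>0 < m\<close>] by simp
  obtain S where "S \<subseteq> K m" "card S = q ^ m"
    using ex_residue_representatives[of \<theta> \<qq>] assms unfolding is_residue_iso_def q_eq by auto
  then have "q ^ m \<le> card (K m)" using card_mono[OF fin, of S] by simp
  then show "card (K m) = q ^ m" using card_Fqm_le[OF \<open>0 < m\<close>] by simp
qed

definition indep_columns :: "nat \<Rightarrow> nat \<Rightarrow> (nat \<Rightarrow> nat \<Rightarrow> 'k) \<Rightarrow> nat set \<Rightarrow> bool" where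
  "indep_columns m r X J \<longleftrightarrow> J \<subseteq> {..<r} \<and>
     (\<forall>c. (\<forall>l\<in>J. c l \<in> K m) \<and> (\<forall>j<r. (\<Sum>l\<in>J. c l * X j l) = 0) \<longrightarrow> (\<forall>l\<in>J. c l = 0))"

lemma rank_over_eq: "rank_over (K m) r X = Max (card ` {J. indep_columns m r X J})"
  unfolding rank_over_def indep_columns_def image_Collect ..

lemma finite_indep: "finite {J. indep_columns m r X J}"
  by (rule finite_subset[of _ "Pow {..<r}"]) (auto simp: indep_columns_def)

lemma card_le_rank: "indep_columns m r X J \<Longrightarrow> card J \<le> rank_over (K m) r X"
  unfolding rank_over_eq using finite_indep by (intro Max_ge) auto

lemma rank_attained: "\<exists>J. indep_columns m r X J \<and> card J = rank_over (K m) r X"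
proof -
  have "indep_columns m r X {}" by (simp add: indep_columns_def)
  then have "rank_over (K m) r X \<in> card ` {J. indep_columns m r X J}"
    unfolding rank_over_eq using finite_indep by (intro Max_in) auto
  then show ?thesis by auto
qed

text \<open>This serves the Singleton bound, where a difference of codewords vanishes on a
  prescribed set of columns.\<close>

lemma rank_le_nonzero_columns:
  "rank_over (K m) r X \<le> card {l. l < r \<and> (\<exists>j<r. X j l \<noteq> 0)}"
proof -
  obtain J where J: "indep_columns m r X J" "card J = rank_over (K m) r X"
    using rank_attained by blast
  have fin: "finite J" using J finite_subset[of J "{..<r}"] by (auto simp: indep_columns_def)
  have "J \<subseteq> {l. l < r \<and> (\<exists>j<r. X j l \<noteq> 0)}"
  proof (rule ccontr)
    assume "\<not> ?thesis"
    then obtain l where l': "l \<in> J" "l \<notin> {l. l < r \<and> (\<exists>j<r. X j l \<noteq> 0)}" by blast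
    then have l: "l \<in> J" "\<forall>j<r. X j l = 0"
      using J(1) by (auto simp: indep_columns_def)
    define c where "c l' = (if l' = l then 1 else 0 :: 'k)" for l'
    have "(\<Sum>l'\<in>J. c l' * X j l') = 0" if "j < r" for j
      using l that by (intro sum.neutral) (auto simp: c_def)
    moreover have "\<forall>l'\<in>J. c l' \<in> K m" by (simp add: c_def)
    ultimately have "c l = 0"
      using J(1) l(1) unfolding indep_columns_def by blast
    then show False by (simp add: c_def)
  qed
  then show ?thesis
    unfolding J(2)[symmetric] by (intro card_mono) auto
qed

lemma rank_le: "rank_over (K m) r X \<le> r"
proof -
  have "card {l. l < r \<and> (\<exists>j<r. X j l \<noteq> 0)} \<le> card {..<r}" by (intro card_mono) auto
  then show ?thesis using rank_le_nonzero_columns[of m r X] by simp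
qed

lemma column_in_span:
  assumes J: "indep_columns m r X J" "card J = rank_over (K m) r X" and l: "l < r" "l \<notin> J"
  shows "\<exists>c. (\<forall>l'\<in>J. c l' \<in> K m) \<and> (\<forall>j<r. X j l = (\<Sum>l'\<in>J. c l' * X j l'))"
proof -
  have fin: "finite J" using J finite_subset[of J "{..<r}"] by (auto simp: indep_columns_def)
  have "\<not> indep_columns m r X (insert l J)"
  proof
    assume "indep_columns m r X (insert l J)"
    from card_le_rank[OF this] show False using J(2) l(2) fin by simp
  qed
  moreover have "insert l J \<subseteq> {..<r}" using J l by (simp add: indep_columns_def)
  ultimately obtain c where c: "\<forall>l'\<in>insert l J. c l' \<in> K m"
    "\<forall>j<r. (\<Sum>l'\<in>insert l J. c l' * X j l') = 0" "\<exists>l'\<in>insert l J. c l' \<noteq> 0"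
    unfolding indep_columns_def by blast
  have sum: "c l * X j l + (\<Sum>l'\<in>J. c l' * X j l') = 0" if "j < r" for j
    using c(2) that fin l(2) by simp
  have "c l \<noteq> 0"
  proof
    assume "c l = 0"
    then have "\<forall>j<r. (\<Sum>l'\<in>J. c l' * X j l') = 0" using sum by simp
    then have "\<forall>l'\<in>J. c l' = 0"
      using J(1) c(1) unfolding indep_columns_def by blast
    then show False using c(3) \<open>c l = 0\<close> by simp
  qed
  show ?thesis
  proof (intro exI[of _ "\<lambda>l'. - c l' / c l"] conjI ballI allI impI)
    fix l' assume "l' \<in> J"
    then show "- c l' / c l \<in> K m" using c(1) by (intro K_divide K_uminus) auto
  next
    fix j assume "j < r"
    have "(\<Sum>l'\<in>J. - c l' / c l * X j l') = - (\<Sum>l'\<in>J. c l' * X j l') / c l"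
      by (simp add: sum_divide_distrib sum_negf)
    also have "- (\<Sum>l'\<in>J. c l' * X j l') = c l * X j l"
      using sum[OF \<open>j < r\<close>] by (simp add: neg_eq_iff_add_eq_0 add.commute)
    also have "c l * X j l / c l = X j l" using \<open>c l \<noteq> 0\<close> by simp
    finally show "X j l = (\<Sum>l'\<in>J. - c l' / c l * X j l')" by simp
  qed
qed

text \<open>Coordinates outside a maximal set \<open>J\<close> of independent columns can be
  prescribed freely, and those in \<open>J\<close> are then solved for.\<close>

lemma card_kernel_ge:
  assumes fin: "finite (K m)"
  shows "card (K m) ^ (r - rank_over (K m) r X) \<le>
    card {w \<in> {..<r} \<rightarrow>\<^sub>E K m. \<forall>j<r. (\<Sum>l<r. w l * X j l) = 0}" (is "_ \<le> card ?Z")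
proof -
  obtain J where J: "indep_columns m r X J" "card J = rank_over (K m) r X"
    using rank_attained by blast
  have Jr: "J \<subseteq> {..<r}" using J by (simp add: indep_columns_def)
  have finJ: "finite J" using Jr finite_subset by blast
  have "\<forall>l. \<exists>c. l < r \<and> l \<notin> J \<longrightarrow> (\<forall>l'\<in>J. c l' \<in> K m) \<and> (\<forall>j<r. X j l = (\<Sum>l'\<in>J. c l' * X j l'))"
    using column_in_span[OF J] by blast
  from choice[OF this] obtain c where c: "\<And>l l'. l < r \<Longrightarrow> l \<notin> J \<Longrightarrow> l' \<in> J \<Longrightarrow> c l l' \<in> K m"
    "\<And>l j. l < r \<Longrightarrow> l \<notin> J \<Longrightarrow> j < r \<Longrightarrow> X j l = (\<Sum>l'\<in>J. c l l' * X j l')" by blast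
  define I where "I = {..<r} - J"
  define h where "h v = (\<lambda>l\<in>{..<r}. if l \<in> J then - (\<Sum>l'\<in>I. v l' * c l' l) else v l)"
    for v :: "nat \<Rightarrow> 'k"
  have inj: "inj_on h (I \<rightarrow>\<^sub>E K m)"
  proof (rule inj_onI)
    fix v v' assume v: "v \<in> I \<rightarrow>\<^sub>E K m" "v' \<in> I \<rightarrow>\<^sub>E K m" "h v = h v'"
    show "v = v'"
    proof (rule PiE_ext[OF v(1,2)])
      fix l assume "l \<in> I"
      then show "v l = v' l" using fun_cong[OF v(3), of l] by (simp add: h_def I_def)
    qed
  qed
  have "h v \<in> ?Z" if v: "v \<in> I \<rightarrow>\<^sub>E K m" for v
  proof (intro CollectI conjI allI impI)
    have "- (\<Sum>l'\<in>I. v l' * c l' l) \<in> K m" if "l \<in> J" for l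
      using that v c by (intro K_uminus K_sum K_mult) (auto simp: I_def)
    moreover have "v l \<in> K m" if "l < r" "l \<notin> J" for l
      using that v by (auto simp: I_def)
    ultimately show "h v \<in> {..<r} \<rightarrow>\<^sub>E K m"
      by (auto simp: h_def)
    fix j assume j: "j < r"
    have "(\<Sum>l<r. h v l * X j l) = (\<Sum>l\<in>I \<union> J. h v l * X j l)"
      using Jr by (intro sum.cong) (auto simp: I_def)
    also have "\<dots> = (\<Sum>l\<in>I. h v l * X j l) + (\<Sum>l\<in>J. h v l * X j l)"
      using finJ by (intro sum.union_disjoint) (auto simp: I_def)
    also have "(\<Sum>l\<in>I. h v l * X j l) = (\<Sum>l\<in>I. v l * (\<Sum>l'\<in>J. c l l' * X j l'))"
      by (intro sum.cong refl) (use c(2) j in \<open>auto simp: h_def I_def\<close>)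
    also have "(\<Sum>l\<in>J. h v l * X j l) = (\<Sum>l\<in>J. - (\<Sum>l'\<in>I. v l' * c l' l) * X j l)"
      by (intro sum.cong refl) (use Jr in \<open>auto simp: h_def\<close>)
    also have "\<dots> = - (\<Sum>l'\<in>I. \<Sum>l\<in>J. v l' * c l' l * X j l)"
      by (simp add: sum_negf sum_distrib_right) (rule sum.swap)
    also have "(\<Sum>l\<in>I. v l * (\<Sum>l'\<in>J. c l l' * X j l')) = (\<Sum>l'\<in>I. \<Sum>l\<in>J. v l' * c l' l * X j l)"
      by (simp add: sum_distrib_left mult.assoc)
    finally show "(\<Sum>l<r. h v l * X j l) = 0" by simp
  qed
  moreover have "finite ?Z"
    using fin by (intro finite_subset[of ?Z "{..<r} \<rightarrow>\<^sub>E K m"] finite_PiE) auto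
  ultimately have "card (I \<rightarrow>\<^sub>E K m) \<le> card ?Z"
    using inj by (intro card_inj_on_le[of h]) auto
  moreover have "card I = r - card J"
    using Jr finJ by (simp add: I_def card_Diff_subset)
  ultimately show ?thesis
    by (simp add: card_PiE I_def J(2)[symmetric])
qed

end

section \<open>Endomorphisms acting on torsion points\<close>

locale drinfeld_code = drinfeld \<gamma> q \<phi> r
  for \<gamma> :: "'f::{field,finite} poly \<Rightarrow> 'k::alg_closed_field" and q \<phi> r +
  fixes m ell :: nat and \<qq> :: "nat \<Rightarrow> 'f poly" and \<theta> :: "nat \<Rightarrow> 'f poly \<Rightarrow> 'k"
    and \<beta> :: "nat \<Rightarrow> nat \<Rightarrow> 'k"
  assumes m_pos: "0 < m"
    and \<qq>: "i < ell \<Longrightarrow> lead_coeff (\<qq> i) = 1" "i < ell \<Longrightarrow> degree (\<qq> i) = m"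
    and inj_\<qq>: "inj_on \<qq> {..<ell}"
    and iso: "i < ell \<Longrightarrow> is_residue_iso \<gamma> m (\<qq> i) (\<theta> i)"
    and basis: "i < ell \<Longrightarrow> is_torsion_basis \<phi> r (\<qq> i) (\<beta> i)"
begin

definition act :: "'f poly \<Rightarrow> 'k \<Rightarrow> 'k" where "act a x = tapply q (\<phi> a) x"

lemma act_add_left: "act (a + b) x = act a x + act b x"
  and act_diff_left: "act (a - b) x = act a x - act b x"
  and act_diff: "act a (x - y) = act a x - act a y"
  and act_0 [simp]: "act a 0 = 0"
  and act_mult: "act (a * b) x = act a (act b x)"
  and act_sum: "act a (\<Sum>i\<in>I. f i) = (\<Sum>i\<in>I. act a (f i))"
  and act_1 [simp]: "act 1 x = x"
  and act_const: "act [:c:] x = emb c * x"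
  using tapply_const[of 1 x]
  by (simp_all add: act_def \<phi>_add \<phi>_diff tapply_add_left tapply_diff_left tapply_add tapply_diff
      \<phi>_mult tapply_tmult tapply_sum \<phi>_const tapply_const flip: one_pCons)

lemma act_sum_left: "act (\<Sum>i\<in>I. f i) x = (\<Sum>i\<in>I. act (f i) x)"
  by (induction I rule: infinite_finite_induct) (auto simp: act_add_left, auto simp: act_def)

lemma act_End:
  assumes "u \<in> End_ring \<phi>"
  shows "tapply q u (act a x) = act a (tapply q u x)"
proof -
  have "tmult q u (\<phi> a) = tmult q (\<phi> a) u"
    using assms unfolding End_ring_def q_eq by blast
  then show ?thesis unfolding act_def by (metis tapply_tmult)
qed

lemma torsion_iff: "x \<in> torsion \<phi> a \<longleftrightarrow> act a x = 0"
  by (simp add: torsion_def act_def q_eq[symmetric])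

lemma A_comb_eq: "A_comb \<phi> r b a = (\<Sum>j<r. act (a j) (b j))"
  by (simp add: A_comb_def act_def q_eq[symmetric])

lemma A_comb_diff: "A_comb \<phi> r b (\<lambda>j. a j - a' j) = A_comb \<phi> r b a - A_comb \<phi> r b a'"
  by (simp add: A_comb_eq act_diff_left sum_subtractf)

lemma act_A_comb: "act c (A_comb \<phi> r b a) = A_comb \<phi> r b (\<lambda>j. c * a j)"
  by (simp add: A_comb_eq act_sum act_mult)

definition ker :: "nat \<Rightarrow> 'k poly \<Rightarrow> 'k set" where
  "ker i u = {x. tapply q u x = 0 \<and> act (\<qq> i) x = 0}"

context
  fixes i assumes i: "i < ell"
begin

lemma \<theta>_add: "\<theta> i (a + b) = \<theta> i a + \<theta> i b"
  and \<theta>_mult: "\<theta> i (a * b) = \<theta> i a * \<theta> i b"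
  and \<theta>_1: "\<theta> i 1 = 1"
  and \<theta>_const: "\<theta> i [:c:] = emb c"
  and \<theta>_eq_0_iff: "\<theta> i a = 0 \<longleftrightarrow> \<qq> i dvd a"
  and range_\<theta>: "range (\<theta> i) = K m"
  using iso[OF i] unfolding is_residue_iso_def is_ring_hom_def emb_def q_eq by auto

lemma \<theta>_diff: "\<theta> i (a - b) = \<theta> i a - \<theta> i b"
  using \<theta>_add[of "a - b" b] by simp

lemma \<theta>_sum: "\<theta> i (\<Sum>l\<in>I. f l) = (\<Sum>l\<in>I. \<theta> i (f l))"
  by (induction I rule: infinite_finite_induct) (auto simp: \<theta>_add \<theta>_eq_0_iff)

lemma \<theta>_prod: "\<theta> i (\<Prod>l\<in>I. f l) = (\<Prod>l\<in>I. \<theta> i (f l))"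
  by (induction I rule: infinite_finite_induct) (auto simp: \<theta>_mult \<theta>_1)

lemma \<theta>_in_K: "\<theta> i a \<in> K m"
  using range_\<theta> by auto

lemma \<beta>_torsion: "j < r \<Longrightarrow> act (\<qq> i) (\<beta> i j) = 0"
  and torsion_A_comb: "act (\<qq> i) x = 0 \<Longrightarrow> \<exists>a. x = A_comb \<phi> r (\<beta> i) a"
  and A_comb_eq_0D: "A_comb \<phi> r (\<beta> i) a = 0 \<Longrightarrow> j < r \<Longrightarrow> \<qq> i dvd a j"
  using basis[OF i] by (auto simp: is_torsion_basis_def torsion_iff Ball_def)

lemma A_comb_eq_0:
  assumes "\<And>j. j < r \<Longrightarrow> \<qq> i dvd a j"
  shows "A_comb \<phi> r (\<beta> i) a = 0"
  unfolding A_comb_eq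
proof (intro sum.neutral ballI)
  fix j assume j: "j \<in> {..<r}"
  then obtain c where "a j = \<qq> i * c" using assms by (auto elim: dvdE)
  then have "a j = c * \<qq> i" by (simp add: mult.commute)
  then show "act (a j) (\<beta> i j) = 0" using j by (simp add: act_mult \<beta>_torsion)
qed

lemma torsion_coord_eq:
  assumes "x = A_comb \<phi> r (\<beta> i) a" "j < r"
  shows "torsion_coord \<phi> r (\<theta> i) (\<beta> i) x j = \<theta> i (a j)"
proof -
  define a' where "a' = (SOME a. x = A_comb \<phi> r (\<beta> i) a)"
  have "\<exists>a. x = A_comb \<phi> r (\<beta> i) a" using assms by blast
  from someI_ex[OF this] have "x = A_comb \<phi> r (\<beta> i) a'" unfolding a'_def .
  then have "A_comb \<phi> r (\<beta> i) (\<lambda>j. a' j - a j) = 0" using assms by (simp add: A_comb_diff)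
  then have "\<theta> i (a' j - a j) = 0" using assms(2) unfolding \<theta>_eq_0_iff by (rule A_comb_eq_0D)
  then show ?thesis by (simp add: torsion_coord_def a'_def[symmetric] \<theta>_diff)
qed

lemma torsion_coord_in_K: "torsion_coord \<phi> r (\<theta> i) (\<beta> i) x j \<in> K m"
  unfolding torsion_coord_def by (rule \<theta>_in_K)

lemma act_A_comb_torsion: "act (\<qq> i) (A_comb \<phi> r (\<beta> i) a) = 0"
  unfolding act_A_comb by (rule A_comb_eq_0) simp

lemma End_torsion:
  assumes "u \<in> End_ring \<phi>" "l < r"
  shows "\<exists>a. tapply q u (\<beta> i l) = A_comb \<phi> r (\<beta> i) a"
  by (rule torsion_A_comb) (simp add: \<beta>_torsion assms flip: act_End[OF assms(1)])

lemma restriction_eq: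
  assumes "tapply q u (\<beta> i l) = A_comb \<phi> r (\<beta> i) a" "j < r" "l < r"
  shows "restriction \<phi> r ell \<theta> \<beta> u i j l = \<theta> i (a j)"
  using assms i torsion_coord_eq[OF assms(1,2)] by (simp add: restriction_def q_eq[symmetric])

text \<open>Columns are images of basis vectors and \<open>u\<close> is A-linear. A relation among
  the columns says that the coefficients of the image of
  \<open>A_comb \<phi> r (\<beta> i) a\<close> are divisible by \<open>\<qq> i\<close>, which kills
  the basis.\<close>

lemma restriction_kernel:
  assumes u: "u \<in> End_ring \<phi>"
    and a: "\<And>j. j < r \<Longrightarrow> (\<Sum>l<r. \<theta> i (a l) * restriction \<phi> r ell \<theta> \<beta> u i j l) = 0"
  shows "tapply q u (A_comb \<phi> r (\<beta> i) a) = 0"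
proof -
  have "\<forall>l. \<exists>c. l < r \<longrightarrow> tapply q u (\<beta> i l) = A_comb \<phi> r (\<beta> i) c"
    using End_torsion[OF u] by blast
  from choice[OF this] obtain c where
    c: "\<And>l. l < r \<Longrightarrow> tapply q u (\<beta> i l) = A_comb \<phi> r (\<beta> i) (c l)" by blast
  have "tapply q u (A_comb \<phi> r (\<beta> i) a) = (\<Sum>l<r. act (a l) (tapply q u (\<beta> i l)))"
    by (simp add: A_comb_eq tapply_sum act_End[OF u])
  also have "\<dots> = (\<Sum>l<r. \<Sum>j<r. act (a l * c l j) (\<beta> i j))"
    by (intro sum.cong refl) (simp add: c A_comb_eq act_sum act_mult)
  also have "\<dots> = A_comb \<phi> r (\<beta> i) (\<lambda>j. \<Sum>l<r. a l * c l j)"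
    unfolding A_comb_eq act_sum_left by (rule sum.swap)
  also have "\<dots> = 0"
  proof (rule A_comb_eq_0)
    fix j assume j: "j < r"
    have "\<theta> i (\<Sum>l<r. a l * c l j) = (\<Sum>l<r. \<theta> i (a l) * restriction \<phi> r ell \<theta> \<beta> u i j l)"
      unfolding \<theta>_sum \<theta>_mult by (intro sum.cong refl) (use c j in \<open>simp add: restriction_eq\<close>)
    then show "\<qq> i dvd (\<Sum>l<r. a l * c l j)" using a[OF j] by (simp add: \<theta>_eq_0_iff)
  qed
  finally show ?thesis .
qed

lemma finite_K: "finite (K m)" and card_K: "card (K m) = q ^ m"
  using card_residue_field[OF iso[OF i] \<qq>(2)[OF i] m_pos] by auto

text \<open>Column relations over \<open>Fqm q m\<close> are lifted through
  \<open>\<theta> i\<close> to coefficients in A. Distinct relations give distinct points because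
  the basis is independent modulo \<open>\<qq> i\<close>.\<close>

lemma card_ker_ge:
  assumes u: "u \<in> End_ring \<phi>" "u \<noteq> 0"
  shows "q ^ (m * (r - rank_over (K m) r (restriction \<phi> r ell \<theta> \<beta> u i))) \<le> card (ker i u)"
proof -
  let ?X = "restriction \<phi> r ell \<theta> \<beta> u i"
  let ?Z = "{w \<in> {..<r} \<rightarrow>\<^sub>E K m. \<forall>j<r. (\<Sum>l<r. w l * ?X j l) = 0}"
  define lift where "lift y = (SOME a. \<theta> i a = y)" for y
  have lift: "\<theta> i (lift y) = y" if "y \<in> K m" for y
    unfolding lift_def by (rule someI_ex) (use that range_\<theta> in \<open>metis imageE\<close>)
  let ?h = "\<lambda>w. A_comb \<phi> r (\<beta> i) (\<lambda>l. lift (w l))"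
  have "inj_on ?h ?Z"
  proof (rule inj_onI)
    fix w w' assume w: "w \<in> ?Z" "w' \<in> ?Z" "?h w = ?h w'"
    then have *: "A_comb \<phi> r (\<beta> i) (\<lambda>l. lift (w l) - lift (w' l)) = 0"
      by (simp add: A_comb_diff)
    have ww: "w \<in> {..<r} \<rightarrow>\<^sub>E K m" "w' \<in> {..<r} \<rightarrow>\<^sub>E K m" using w by auto
    show "w = w'"
    proof (rule PiE_ext[OF ww])
      fix l assume l: "l \<in> {..<r}"
      then have "\<theta> i (lift (w l) - lift (w' l)) = 0"
        using A_comb_eq_0D[OF *] by (simp add: \<theta>_eq_0_iff)
      moreover have "w l \<in> K m" "w' l \<in> K m" using ww l by auto
      ultimately show "w l = w' l" by (simp add: \<theta>_diff lift)
    qed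
  qed
  moreover have "?h ` ?Z \<subseteq> ker i u"
  proof (rule image_subsetI)
    fix w assume w: "w \<in> ?Z"
    have "tapply q u (?h w) = 0"
    proof (rule restriction_kernel[OF u(1)])
      fix j assume "j < r"
      have "(\<Sum>l<r. \<theta> i (lift (w l)) * ?X j l) = (\<Sum>l<r. w l * ?X j l)"
        by (intro sum.cong refl) (use w lift in auto)
      then show "(\<Sum>l<r. \<theta> i (lift (w l)) * ?X j l) = 0" using w \<open>j < r\<close> by simp
    qed
    then show "?h w \<in> ker i u" by (simp add: ker_def act_A_comb_torsion)
  qed
  moreover have "finite (ker i u)"
    using card_tapply_roots(1)[OF u(2)] by (rule rev_finite_subset) (auto simp: ker_def)
  ultimately have "card ?Z \<le> card (ker i u)" by (rule card_inj_on_le)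
  then show ?thesis
    using card_kernel_ge[OF finite_K, of r ?X] by (simp add: card_K power_mult)
qed

end

end

section \<open>The evaluation code\<close>

text \<open>Puncturing: outside a set of \<open>ell * r + 1 - d\<close> columns only d - 1 columns
  remain, d being the distance. Codewords agreeing on that set differ by a tuple of weight below d,
  so they coincide, and each kept column has \<open>r\<close> entries in a field of size
  q^m.\<close>

lemma (in A_field) singleton_bound:
  assumes C: "C \<subseteq> mat_tuples (K m) r ell" "\<forall>X\<in>C. \<forall>Y\<in>C. X - Y \<in> C"
    and nz: "X0 \<in> C" "X0 \<noteq> 0" and K: "finite (K m)" "card (K m) = q ^ m"
  shows "\<exists>X\<in>C. X \<noteq> 0 \<and> wt_SR (K m) r ell X = d_SR (K m) r ell C"
    and "d_SR (K m) r ell C \<le> ell * r"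
    and "0 < d_SR (K m) r ell C \<Longrightarrow> card C \<le> q ^ (m * (r * (ell * r + 1 - d_SR (K m) r ell C)))"
proof -
  let ?wt = "wt_SR (K m) r ell"
  let ?d = "d_SR (K m) r ell C"
  let ?W = "{?wt X | X. X \<in> C \<and> X \<noteq> 0}"
  have le: "?wt X \<le> ell * r" for X
  proof -
    have "?wt X \<le> (\<Sum>i<ell. r)"
      unfolding wt_SR_def by (intro sum_mono rank_le)
    then show ?thesis by simp
  qed
  have fW: "finite ?W"
    by (rule finite_subset[of _ "{..ell * r}"]) (use le in auto)
  have min: "?d \<le> ?wt X" if "X \<in> C" "X \<noteq> 0" for X
    unfolding d_SR_def using fW by (rule Min_le) (use that in blast)
  have "?d \<in> ?W"
    unfolding d_SR_def using fW by (rule Min_in) (use nz in blast)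
  then show ex: "\<exists>X\<in>C. X \<noteq> 0 \<and> ?wt X = ?d" by auto
  then show d_le: "?d \<le> ell * r" using le by metis
  assume d_pos: "0 < ?d"
  define A where "A = {..<ell} \<times> {..<r}"
  have fA: "finite A" "card A = ell * r" by (auto simp: A_def card_cartesian_product)
  obtain T where T: "T \<subseteq> A" "card T = ell * r + 1 - ?d" "finite T"
    by (rule obtain_subset_with_card_n[of "ell * r + 1 - ?d" A]) (use fA d_pos in auto)
  define h where "h X = (\<lambda>p\<in>T \<times> {..<r}. X (fst (fst p)) (snd p) (snd (fst p)))" for X :: "'k mat_tuple"
  have "inj_on h C"
  proof (rule inj_onI, rule ccontr)
    fix X Y assume XY: "X \<in> C" "Y \<in> C" "h X = h Y" "X \<noteq> Y"
    let ?Z = "X - Y"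
    have "?Z \<in> C" "?Z \<noteq> 0" using C(2) XY by auto
    then have "?d \<le> ?wt ?Z" by (rule min)
    also have "\<dots> \<le> (\<Sum>i<ell. card {l. l < r \<and> (\<exists>j<r. ?Z i j l \<noteq> 0)})"
      unfolding wt_SR_def by (intro sum_mono rank_le_nonzero_columns)
    also have "\<dots> = card (SIGMA i:{..<ell}. {l. l < r \<and> (\<exists>j<r. ?Z i j l \<noteq> 0)})"
      by (rule card_SigmaI[symmetric]) auto
    also have "\<dots> \<le> card (A - T)"
    proof (rule card_mono)
      have "X i j l = Y i j l" if "(i, l) \<in> T" "j < r" for i j l
        using fun_cong[OF XY(3), of "((i, l), j)"] that by (simp add: h_def)
      then show "(SIGMA i:{..<ell}. {l. l < r \<and> (\<exists>j<r. ?Z i j l \<noteq> 0)}) \<subseteq> A - T"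
        by (auto simp: A_def)
    qed (use fA in simp)
    also have "\<dots> = ell * r - (ell * r + 1 - ?d)"
      using T fA by (simp add: card_Diff_subset)
    also have "\<dots> < ?d" using d_pos d_le by simp
    finally show False by simp
  qed
  moreover have "h ` C \<subseteq> T \<times> {..<r} \<rightarrow>\<^sub>E K m"
  proof (rule image_subsetI)
    fix X assume "X \<in> C"
    then have "X i j l \<in> K m" for i j l using C(1) unfolding mat_tuples_def by blast
    then show "h X \<in> T \<times> {..<r} \<rightarrow>\<^sub>E K m" unfolding h_def restrict_PiE_iff by blast
  qed
  moreover have "finite (T \<times> {..<r} \<rightarrow>\<^sub>E K m)"
    using T K by (intro finite_PiE) auto
  ultimately have "card C \<le> card (T \<times> {..<r} \<rightarrow>\<^sub>E K m)"
    by (rule card_inj_on_le)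
  also have "\<dots> = q ^ (m * (r * (ell * r + 1 - ?d)))"
    using T K by (simp add: card_PiE card_cartesian_product power_mult mult.commute)
  finally show "card C \<le> q ^ (m * (r * (ell * r + 1 - ?d)))" .
qed

lemma (in A_field) vector_space_Fq_scale: "vector_space (Fq_scale \<gamma> :: 'f \<Rightarrow> 'k mat_tuple \<Rightarrow> _)"
  by unfold_locales
    (auto simp: Fq_scale_def fun_eq_iff emb_add emb_mult algebra_simps simp flip: emb_def)

section \<open>Independence of the torsion modules and the weight bound\<close>

context drinfeld_code
begin

lemma \<qq>_not_dvd:
  assumes "i < ell" "j < ell" "i \<noteq> j"
  shows "\<not> \<qq> i dvd \<qq> j"
proof
  assume "\<qq> i dvd \<qq> j"
  then obtain w where w: "\<qq> j = \<qq> i * w" by (rule dvdE)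
  have nz: "\<qq> i \<noteq> 0" "w \<noteq> 0" using \<qq>[OF assms(1)] \<qq>[OF assms(2)] w by auto
  have "degree w = 0"
    using degree_mult_eq[OF nz] \<qq>(2)[OF assms(1)] \<qq>(2)[OF assms(2)] by (simp flip: w)
  moreover have "lead_coeff w = 1"
    using lead_coeff_mult[of "\<qq> i" w] \<qq>(1)[OF assms(1)] \<qq>(1)[OF assms(2)] by (simp flip: w)
  ultimately have "w = 1" by (metis degree_0_id one_pCons of_nat_1 degree_eq_zeroE lead_coeff_pCons(2))
  then show False using w inj_onD[OF inj_\<qq>, of j i] assms by simp
qed

text \<open>The product of the other primes kills every other summand, while on the torsion of
  \<open>\<qq> i\<close> it acts invertibly because it is nonzero modulo
  \<open>\<qq> i\<close>.\<close>

lemma torsion_independent: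
  assumes z: "\<And>i. i < ell \<Longrightarrow> act (\<qq> i) (z i) = 0" and sum: "(\<Sum>i<ell. z i) = 0" and i: "i < ell"
  shows "z i = 0"
proof -
  define c where "c = (\<Prod>j\<in>{..<ell} - {i}. \<qq> j)"
  have "act c (z j) = 0" if "j < ell" "j \<noteq> i" for j
  proof -
    have "\<qq> j dvd c" unfolding c_def by (rule dvd_prodI) (use that in auto)
    then obtain w where "c = \<qq> j * w" by (rule dvdE)
    then have "c = w * \<qq> j" by (simp only: mult.commute)
    then show ?thesis using z[OF that(1)] by (simp add: act_mult)
  qed
  then have "(\<Sum>j<ell. act c (z j)) = (\<Sum>j\<in>{i}. act c (z j))"
    using i by (intro sum.mono_neutral_right) auto
  then have cz: "act c (z i) = 0" using sum by (simp flip: act_sum)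
  have "\<theta> i c \<noteq> 0"
    unfolding c_def \<theta>_prod[OF i] using \<qq>_not_dvd[OF i] by (auto simp: \<theta>_eq_0_iff[OF i])
  have "1 / \<theta> i c \<in> range (\<theta> i)"
    unfolding range_\<theta>[OF i] by (intro K_divide K_1 \<theta>_in_K[OF i])
  then obtain w where w: "\<theta> i w = 1 / \<theta> i c" by auto
  have "\<theta> i (w * c - 1) = 0"
    using \<open>\<theta> i c \<noteq> 0\<close> w by (simp add: \<theta>_diff[OF i] \<theta>_mult[OF i] \<theta>_1[OF i])
  then have "\<qq> i dvd w * c - 1" unfolding \<theta>_eq_0_iff[OF i] .
  then obtain v where "w * c - 1 = \<qq> i * v" by (rule dvdE)
  then have v: "w * c - 1 = v * \<qq> i" by (simp only: mult.commute)
  have "act w (act c (z i)) - z i = act v (act (\<qq> i) (z i))"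
    unfolding act_mult[symmetric] v[symmetric] act_diff_left act_1 ..
  then show ?thesis using cz z[OF i] by simp
qed

lemma weight_bound:
  assumes u: "u \<in> End_ring \<phi>" "u \<noteq> 0"
  shows "m * (\<Sum>i<ell. r - rank_over (K m) r (restriction \<phi> r ell \<theta> \<beta> u i)) \<le> degree u"
proof -
  let ?rk = "\<lambda>i. rank_over (K m) r (restriction \<phi> r ell \<theta> \<beta> u i)"
  let ?T = "Pi\<^sub>E {..<ell} (\<lambda>i. ker i u)"
  let ?U = "{x. tapply q u x = 0}"
  let ?h = "\<lambda>z. \<Sum>i<ell. z i"
  have inj: "inj_on ?h ?T"
  proof (rule inj_onI)
    fix z z' assume z: "z \<in> ?T" "z' \<in> ?T" "?h z = ?h z'"
    show "z = z'"
    proof (rule PiE_ext[OF z(1,2)])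
      fix i assume "i \<in> {..<ell}"
      then have i: "i < ell" by simp
      have "z i - z' i = 0"
      proof (rule torsion_independent[OF _ _ i])
        show "act (\<qq> j) (z j - z' j) = 0" if "j < ell" for j
        proof -
          have "z j \<in> ker j u" "z' j \<in> ker j u" using z that by auto
          then show ?thesis by (simp add: ker_def act_diff)
        qed
        show "(\<Sum>j<ell. z j - z' j) = 0" using z(3) by (simp add: sum_subtractf)
      qed
      then show "z i = z' i" by simp
    qed
  qed
  have "?h ` ?T \<subseteq> ?U"
  proof (rule image_subsetI)
    fix z assume z: "z \<in> ?T"
    have "tapply q u (z i) = 0" if "i < ell" for i
    proof -
      have "z i \<in> ker i u" using z that by auto
      then show ?thesis by (simp add: ker_def)
    qed
    then show "?h z \<in> ?U" by (simp add: tapply_sum)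
  qed
  from card_inj_on_le[OF inj this card_tapply_roots(1)[OF u(2)]]
  have 1: "(\<Prod>i<ell. card (ker i u)) \<le> q ^ degree u"
    using card_tapply_roots(2)[OF u(2)] by (simp add: card_PiE)
  have "q ^ (m * (\<Sum>i<ell. r - ?rk i)) = (\<Prod>i<ell. q ^ (m * (r - ?rk i)))"
    by (simp add: power_sum sum_distrib_left)
  also have "\<dots> \<le> (\<Prod>i<ell. card (ker i u))"
    by (intro prod_mono) (use card_ker_ge u in auto)
  also note 1
  finally show ?thesis using q_gt_1 by simp
qed

abbreviation Res :: "'k poly \<Rightarrow> 'k mat_tuple" where "Res \<equiv> restriction \<phi> r ell \<theta> \<beta>"

lemma Res_in: "Res u \<in> mat_tuples (K m) r ell"
  using torsion_coord_in_K by (auto simp: mat_tuples_def restriction_def)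

lemma Res_outside: "\<not> (i < ell \<and> j < r \<and> l < r) \<Longrightarrow> Res u i j l = 0"
  by (auto simp: restriction_def)

lemma Res_diff:
  assumes u: "u \<in> End_ring \<phi>" and v: "v \<in> End_ring \<phi>"
  shows "Res (u - v) = Res u - Res v"
proof (intro ext)
  fix i j l
  show "Res (u - v) i j l = (Res u - Res v) i j l"
  proof (cases "i < ell \<and> j < r \<and> l < r")
    case True
    then have i: "i < ell" and j: "j < r" and l: "l < r" by auto
    obtain a b where ab: "tapply q u (\<beta> i l) = A_comb \<phi> r (\<beta> i) a"
      "tapply q v (\<beta> i l) = A_comb \<phi> r (\<beta> i) b"
      using End_torsion[OF i u l] End_torsion[OF i v l] by blast
    then have "tapply q (u - v) (\<beta> i l) = A_comb \<phi> r (\<beta> i) (\<lambda>j. a j - b j)"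
      by (simp add: tapply_diff_left A_comb_diff)
    from restriction_eq[OF i this j l] restriction_eq[OF i ab(1) j l] restriction_eq[OF i ab(2) j l]
    show ?thesis by (simp add: \<theta>_diff[OF i])
  qed (simp add: Res_outside)
qed

lemma Res_smult:
  assumes u: "u \<in> End_ring \<phi>"
  shows "Res (smult (emb c) u) = Fq_scale \<gamma> c (Res u)"
proof (intro ext)
  fix i j l
  show "Res (smult (emb c) u) i j l = Fq_scale \<gamma> c (Res u) i j l"
  proof (cases "i < ell \<and> j < r \<and> l < r")
    case True
    then have i: "i < ell" and j: "j < r" and l: "l < r" by auto
    obtain a where a: "tapply q u (\<beta> i l) = A_comb \<phi> r (\<beta> i) a"
      using End_torsion[OF i u l] by blast
    have "tapply q (smult (emb c) u) (\<beta> i l) = act [:c:] (A_comb \<phi> r (\<beta> i) a)"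
      unfolding a[symmetric] act_const by (simp add: tapply_tmult tapply_const flip: tmult_const_left)
    from restriction_eq[OF i this[unfolded act_A_comb] j l] restriction_eq[OF i a j l]
    show ?thesis by (simp only: \<theta>_mult[OF i] \<theta>_const[OF i] Fq_scale_def emb_def)
  qed (simp add: Res_outside Fq_scale_def)
qed

end

section \<open>The code of a supersingular module\<close>

locale supersingular_code = supersingular_drinfeld \<gamma> q \<phi> r \<pp> d + drinfeld_code \<gamma> q \<phi> r m ell \<qq> \<theta> \<beta>
  for \<gamma> :: "'f::{field,finite} poly \<Rightarrow> 'k::alg_closed_field" and q \<phi> r \<pp> d m ell \<qq> \<theta> \<beta> +
  fixes t\<^sub>0 :: nat
  assumes t_pos: "1 \<le> t\<^sub>0" and t_le: "t\<^sub>0 \<le> ell * r"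
    and t_large: "r * ((d - 1) * flag_codim) < t\<^sub>0 * m"
begin

definition s :: nat where "s = t\<^sub>0 * m - 1"

lemma Suc_s: "Suc s = t\<^sub>0 * m"
  using t_pos m_pos by (simp add: s_def)

lemma ell_pos: "0 < ell" using t_pos t_le by (cases ell) auto

lemma End_upto_End_ring: "u \<in> End_upto \<phi> s \<Longrightarrow> u \<in> End_ring \<phi>"
  unfolding End_upto_eq by (simp add: End_below_def End_ring_iff)

lemma End_upto_diff: "u \<in> End_upto \<phi> s \<Longrightarrow> v \<in> End_upto \<phi> s \<Longrightarrow> u - v \<in> End_upto \<phi> s"
  unfolding End_upto_eq by (rule End_below_diff)

lemma End_upto_0: "0 \<in> End_upto \<phi> s"
  by (simp add: End_upto_def)

lemma wt_ge:
  assumes "u \<in> End_upto \<phi> s" "u \<noteq> 0"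
  shows "ell * r + 1 \<le> wt_SR (K m) r ell (Res u) + t\<^sub>0"
proof -
  let ?rk = "\<lambda>i. rank_over (K m) r (Res u i)"
  have "m * (\<Sum>i<ell. r - ?rk i) \<le> degree u"
    using weight_bound End_upto_End_ring assms by blast
  also have "\<dots> \<le> s" using assms degree_End_below unfolding End_upto_eq by blast
  \<comment> \<open>\<open>s = t\<^sub>0 * m - 1\<close> is the largest degree for which division by
    \<open>m\<close> leaves the sum of the coranks below \<open>t\<^sub>0\<close>.\<close>
  also have "s < m * t\<^sub>0" using Suc_s by (simp only: mult.commute lessI)
  finally have "(\<Sum>i<ell. r - ?rk i) < t\<^sub>0" by (rule mult_less_cancel1[THEN iffD1, THEN conjunct2])
  moreover have "(\<Sum>i<ell. r - ?rk i) + (\<Sum>i<ell. ?rk i) = (\<Sum>i<ell. r)"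
    unfolding sum.distrib[symmetric] by (intro sum.cong refl) (use rank_le in simp)
  ultimately show ?thesis by (simp add: wt_SR_def)
qed

lemma Res_0: "Res 0 = 0"
  using Res_diff[of 0 0] End_upto_End_ring[OF End_upto_0] by simp

lemma wt_0: "wt_SR (K m) r ell 0 = 0"
proof -
  have "rank_over (K m) r (0 :: nat \<Rightarrow> nat \<Rightarrow> 'k) = 0"
    using rank_le_nonzero_columns[of m r 0] by simp
  then show ?thesis by (simp add: wt_SR_def)
qed

text \<open>As \<open>t\<^sub>0 \<le> ell * r\<close>, the weight bound for a nonzero endomorphism
  is at least 1.\<close>

lemma Res_eq_0_iff: "u \<in> End_upto \<phi> s \<Longrightarrow> Res u = 0 \<longleftrightarrow> u = 0"
  using wt_ge[of u] t_le wt_0 Res_0 by (cases "u = 0") auto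

lemma inj_Res: "inj_on Res (End_upto \<phi> s)"
proof (rule inj_onI)
  fix u v assume uv: "u \<in> End_upto \<phi> s" "v \<in> End_upto \<phi> s" "Res u = Res v"
  then have "Res (u - v) = 0" by (simp add: Res_diff End_upto_End_ring)
  then show "u = v" using Res_eq_0_iff[OF End_upto_diff[OF uv(1,2)]] by simp
qed

abbreviation "C \<equiv> code \<phi> r ell \<theta> \<beta> s"

lemma C_in: "C \<subseteq> mat_tuples (K m) r ell"
  unfolding code_def by (rule image_subsetI) (rule Res_in)

lemma C_diff:
  assumes "X \<in> C" "Y \<in> C"
  shows "X - Y \<in> C"
proof -
  obtain u v where uv: "X = Res u" "u \<in> End_upto \<phi> s" "Y = Res v" "v \<in> End_upto \<phi> s"
    using assms unfolding code_def by blast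
  then have "X - Y = Res (u - v)" by (simp add: Res_diff End_upto_End_ring)
  then show ?thesis unfolding code_def using End_upto_diff uv by blast
qed

lemma C_0: "0 \<in> C"
  unfolding code_def by (rule image_eqI[of _ _ 0]) (simp_all add: Res_0 End_upto_0)

interpretation fq: vector_space "Fq_scale \<gamma> :: 'f \<Rightarrow> 'k mat_tuple \<Rightarrow> _"
  by (rule vector_space_Fq_scale)

lemma subspace_C: "fq.subspace C"
proof (rule fq.subspaceI)
  show "0 \<in> C" by (rule C_0)
  fix X Y assume XY: "X \<in> C" "Y \<in> C"
  have "X - (0 - Y) \<in> C" by (intro C_diff XY C_0)
  then show "X + Y \<in> C" by simp
next
  fix c X assume "X \<in> C"
  then obtain u where u: "u \<in> End_upto \<phi> s" "X = Res u" by (auto simp: code_def)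
  have "smult (emb c) u \<in> End_upto \<phi> s" using u(1) unfolding End_upto_eq by (rule End_below_smult)
  moreover have "Fq_scale \<gamma> c X = Res (smult (emb c) u)"
    using u Res_smult[OF End_upto_End_ring] by simp
  ultimately show "Fq_scale \<gamma> c X \<in> C" unfolding code_def by blast
qed

theorem code_properties:
  shows "inj_on Res (End_upto \<phi> s)"
    and "additive_code \<gamma> m r ell C"
    and "dim_Fq \<gamma> C + (d - 1) * flag_codim = r * (t\<^sub>0 * m)"
    and "0 < dim_Fq \<gamma> C"
    and "ell * r + 1 \<le> d_SR (K m) r ell C + t\<^sub>0"
    and "d_SR (K m) r ell C \<le> ell * r"
    and "dim_Fq \<gamma> C \<le> m * (r * (ell * r + 1 - d_SR (K m) r ell C))"
proof -
  show "inj_on Res (End_upto \<phi> s)" by (rule inj_Res)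
  show "additive_code \<gamma> m r ell C"
    unfolding additive_code_def q_eq[symmetric] using C_in subspace_C by blast
  obtain D where D: "card (End_upto \<phi> s) = q ^ D" "D + (d - 1) * flag_codim = r * Suc s"
    using card_End_upto[of s] t_large Suc_s by auto
  have cC: "card C = q ^ D"
    unfolding code_def by (simp add: card_image inj_Res D)
  then have "0 < card C" by simp
  then have fC: "finite C" by (rule card_ge_0_finite)
  \<comment> \<open>The count of endomorphisms is a cardinality; the dimension over F_q is read off
    from it as the exponent of \<open>q\<close>.\<close>
  have "q ^ D = q ^ dim_Fq \<gamma> C"
    using fq.card_subspace[OF fC subspace_C] cC by (simp add: q_eq)
  then have dim: "dim_Fq \<gamma> C = D" unfolding power_inject_exp[OF q_gt_1] by simp
  show "dim_Fq \<gamma> C + (d - 1) * flag_codim = r * (t\<^sub>0 * m)"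
    using D(2) by (simp only: dim Suc_s)
  \<comment> \<open>Positive dimension makes the code nonzero, so that \<open>d_SR\<close> is a
    minimum over a nonempty set.\<close>
  have "1 * (t\<^sub>0 * m) \<le> r * (t\<^sub>0 * m)" using r_pos by (intro mult_le_mono1) simp
  moreover have "1 * ((d - 1) * flag_codim) \<le> r * ((d - 1) * flag_codim)" using r_pos by (intro mult_le_mono1) simp
  ultimately show D_pos: "0 < dim_Fq \<gamma> C"
    using D(2) t_large unfolding dim Suc_s by linarith
  then have "q ^ 0 < card C" unfolding cC dim by (intro power_strict_increasing q_gt_1)
  then have "C \<noteq> {0}" by auto
  then obtain X0 where X0: "X0 \<in> C" "X0 \<noteq> 0" using C_0 by blast
  have "\<forall>X\<in>C. \<forall>Y\<in>C. X - Y \<in> C" using C_diff by blast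
  note sb = singleton_bound[OF C_in this X0 finite_K[OF ell_pos] card_K[OF ell_pos]]
  show "d_SR (K m) r ell C \<le> ell * r" by (rule sb(2))
  obtain X where X: "X \<in> C" "X \<noteq> 0" "wt_SR (K m) r ell X = d_SR (K m) r ell C"
    using sb(1) by blast
  then obtain u where u: "u \<in> End_upto \<phi> s" "X = Res u" by (auto simp: code_def)
  then show le: "ell * r + 1 \<le> d_SR (K m) r ell C + t\<^sub>0"
    using wt_ge[of u] X Res_0 by (cases "u = 0") auto
  then have "0 < d_SR (K m) r ell C" using t_le by linarith
  from sb(3)[OF this] show "dim_Fq \<gamma> C \<le> m * (r * (ell * r + 1 - d_SR (K m) r ell C))"
    unfolding cC dim by (rule power_le_imp_le_exp[OF q_gt_1])
qed

end

section \<open>Parameters as real numbers and the asymptotic statement\<close>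

lemma sum_lessThan_id: "2 * (\<Sum>i<n. i) = n * (n - 1 :: nat)"
proof (induction n)
  case (Suc n)
  then show ?case by (cases n) auto
qed simp

lemma code_setup_properties:
  fixes \<gamma> :: "'f::{field,finite} poly \<Rightarrow> 'k::alg_closed_field"
  assumes cs: "code_setup r d \<pp> \<gamma> \<phi> m ell \<qq> \<theta> \<beta> t"
    and c: "c = real (r * (r - 1) * (d - 1)) / 2"
  defines "C \<equiv> code \<phi> r ell \<theta> \<beta> (t * m - 1)"
  defines "d_act \<equiv> d_SR (Fqm CARD('f) m) r ell C"
  shows "inj_on (restriction \<phi> r ell \<theta> \<beta>) (End_upto \<phi> (t * m - 1))"
    and "additive_code \<gamma> m r ell C"
    and "real (dim_Fq \<gamma> C) = real (m * r * t) - c"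
    and "0 < dim_Fq \<gamma> C"
    and "real (ell * r) - real t + 1 \<le> real d_act"
    and "real (dim_Fq \<gamma> C) \<le> real (m * r) * (real (ell * r) - real d_act + 1)"
proof -
  define flag_codim where "flag_codim = (\<Sum>i<r. i)"
  have flag_codim: "r * (r - 1) = 2 * flag_codim" using sum_lessThan_id[of r] by (simp add: flag_codim_def)
  have c': "c = real ((d - 1) * flag_codim)"
    unfolding c flag_codim by simp
  have "1 \<le> t" "t \<le> ell * r" using cs by (auto simp: code_setup_def)
  then have ell: "0 < ell" by (cases ell) auto
  interpret sd: supersingular_drinfeld \<gamma> "CARD('f)" \<phi> r \<pp> d
    using cs by unfold_locales (auto simp: code_setup_def is_residue_closure_def)
  have "r\<^sup>2 * (r - 1) * (d - 1) = r * (r * (r - 1)) * (d - 1)"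
    by (simp only: power2_eq_square mult.assoc)
  also have "\<dots> = 2 * (r * ((d - 1) * flag_codim))"
    unfolding flag_codim by (simp only: mult_ac)
  finally have e: "r\<^sup>2 * (r - 1) * (d - 1) = 2 * (r * ((d - 1) * flag_codim))" .
  have "real (r\<^sup>2 * (r - 1) * (d - 1)) / 2 \<le> real (t * m) - 1"
    using cs unfolding code_setup_def by blast
  then have "real (r * ((d - 1) * flag_codim)) \<le> real (t * m) - 1"
    unfolding e of_nat_mult[of 2] by simp
  \<comment> \<open>Over the integers the real hypothesis t m - 1 \<ge> r c becomes the strict
    inequality r c < t m, which in turn forces \<open>m\<close> to be positive.\<close>
  then have large: "r * ((d - 1) * flag_codim) < t * m" by linarith
  have m: "0 < m"
  proof (rule ccontr)
    assume "\<not> 0 < m"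
    then show False using large by simp
  qed
  interpret supersingular_code \<gamma> "CARD('f)" \<phi> r \<pp> d m ell \<qq> \<theta> \<beta> t
    using cs m large sd.flag_codim_def
    by unfold_locales (auto simp: code_setup_def flag_codim_def)
  have s: "t * m - 1 = s" by (simp add: s_def)
  note code_properties' = code_properties[folded s, folded C_def, folded d_act_def]
  show "inj_on (restriction \<phi> r ell \<theta> \<beta>) (End_upto \<phi> (t * m - 1))"
    and "additive_code \<gamma> m r ell C"
    and "0 < dim_Fq \<gamma> C"
    by (rule code_properties')+
  have "real (dim_Fq \<gamma> C + (d - 1) * flag_codim) = real (r * (t * m))"
    using code_properties'(3) sd.flag_codim_def unfolding flag_codim_def by simp
  then show "real (dim_Fq \<gamma> C) = real (m * r * t) - c"
    unfolding c' by (simp add: algebra_simps)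
  have "real (ell * r + 1) \<le> real (d_act + t)"
    using code_properties'(5) by (rule of_nat_mono)
  then show "real (ell * r) - real t + 1 \<le> real d_act" by simp
  have "real (dim_Fq \<gamma> C) \<le> real (m * (r * (ell * r + 1 - d_act)))"
    using code_properties'(7) by (rule of_nat_mono)
  also have "\<dots> = real (m * r) * (real (ell * r) - real d_act + 1)"
    using code_properties'(6) by (simp add: of_nat_diff)
  finally show "real (dim_Fq \<gamma> C) \<le> real (m * r) * (real (ell * r) - real d_act + 1)" .
qed

theorem theorem3p8:
  fixes r d :: nat and c :: real
  assumes r: "2 \<le> r"
    and c: "c = real (r * (r - 1) * (d - 1)) / 2"
  shows
    "(\<forall>(\<pp> :: 'f::{field,finite} poly) (\<gamma> :: 'f poly \<Rightarrow> 'k::alg_closed_field)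
        (\<phi> :: 'f poly \<Rightarrow> 'k poly) m ell \<qq> \<theta> \<beta> t.
        code_setup r d \<pp> \<gamma> \<phi> m ell \<qq> \<theta> \<beta> t \<longrightarrow>
        (let s = t * m - 1;
             C = code \<phi> r ell \<theta> \<beta> s;
             d_act = d_SR (Fqm CARD('f) m) r ell C;
             \<Delta>_act = real (m * r) * (real (ell * r) - real d_act + 1) - (real (m * r * t) - c)
         in inj_on (restriction \<phi> r ell \<theta> \<beta>) (End_upto \<phi> s)
          \<and> additive_code \<gamma> m r ell C
          \<and> real (dim_Fq \<gamma> C) = real (m * r * t) - c
          \<and> real d_act \<ge> real (ell * r) - real t + 1
          \<and> 0 \<le> \<Delta>_act \<and> \<Delta>_act \<le> c
          \<and> 0 < real (m * r * t) - c
          \<and> 0 \<le> \<Delta>_act / (real (m * r * t) - c)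
          \<and> \<Delta>_act / (real (m * r * t) - c) \<le> c / (real (m * r * t) - c)))
   \<and> ((\<lambda>(m, t). c / (real (m * r * t) - c)) \<longlongrightarrow> 0)
        (filtercomap (\<lambda>(m, t). m * t) at_top)
   \<and> (\<forall>\<epsilon>>0. \<exists>N. \<forall>(\<pp> :: 'f poly) (\<gamma> :: 'f poly \<Rightarrow> 'k) (\<phi> :: 'f poly \<Rightarrow> 'k poly) m ell \<qq> \<theta> \<beta> t.
        code_setup r d \<pp> \<gamma> \<phi> m ell \<qq> \<theta> \<beta> t \<and> N \<le> m * t \<longrightarrow>
        (let C = code \<phi> r ell \<theta> \<beta> (t * m - 1);
             d_act = d_SR (Fqm CARD('f) m) r ell C;
             \<Delta>_act = real (m * r) * (real (ell * r) - real d_act + 1) - real (dim_Fq \<gamma> C)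
         in \<bar>\<Delta>_act / real (dim_Fq \<gamma> C)\<bar> < \<epsilon>))"
proof -
  have first: "inj_on (restriction \<phi> r ell \<theta> \<beta>) (End_upto \<phi> (t * m - 1))
          \<and> additive_code \<gamma> m r ell (code \<phi> r ell \<theta> \<beta> (t * m - 1))
          \<and> real (dim_Fq \<gamma> (code \<phi> r ell \<theta> \<beta> (t * m - 1))) = real (m * r * t) - c
          \<and> real d_act \<ge> real (ell * r) - real t + 1
          \<and> 0 \<le> \<Delta>_act \<and> \<Delta>_act \<le> c
          \<and> 0 < real (m * r * t) - c
          \<and> 0 \<le> \<Delta>_act / (real (m * r * t) - c)
          \<and> \<Delta>_act / (real (m * r * t) - c) \<le> c / (real (m * r * t) - c)"
    if cs: "code_setup r d \<pp> \<gamma> \<phi> m ell \<qq> \<theta> \<beta> t"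
      and d_act: "d_act = d_SR (Fqm CARD('f) m) r ell (code \<phi> r ell \<theta> \<beta> (t * m - 1))"
      and \<Delta>: "\<Delta>_act = real (m * r) * (real (ell * r) - real d_act + 1) - (real (m * r * t) - c)"
    for \<pp> :: "'f poly" and \<gamma> :: "'f poly \<Rightarrow> 'k" and \<phi> m ell \<qq> \<theta> \<beta> t d_act \<Delta>_act
  proof -
    note props = code_setup_properties[OF cs c, folded d_act]
    have pos: "0 < real (m * r * t) - c" using props(3,4) by linarith
    \<comment> \<open>The Singleton bound gives the lower estimate. The upper one follows from the
      distance bound, which makes the first term of \<open>\<Delta>_act\<close> at most m r
      t.\<close>
    have ge: "0 \<le> \<Delta>_act" using props(3,6) unfolding \<Delta> by linarith
    have "real (m * r) * (real (ell * r) - real d_act + 1) \<le> real (m * r) * real t"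
      using props(5) by (intro mult_left_mono) auto
    then have le: "\<Delta>_act \<le> c" unfolding \<Delta> by simp
    show ?thesis
      using props(1,2,3,5) pos ge le by (auto intro: divide_right_mono divide_nonneg_pos)
  qed
  have lim: "(\<lambda>n. c / (real r * real n - c)) \<longlonglongrightarrow> 0"
  proof (rule tendsto_divide_0[OF tendsto_const filterlim_at_top_imp_at_infinity])
    have "filterlim (\<lambda>n. real r * real n) at_top sequentially"
      using r by (intro filterlim_tendsto_pos_mult_at_top[OF tendsto_const _ filterlim_real_sequentially]) simp
    from filterlim_tendsto_add_at_top[OF tendsto_const[of "- c"] this]
    show "filterlim (\<lambda>n. real r * real n - c) at_top sequentially" by (simp add: algebra_simps)
  qed
  \<comment> \<open>\<open>m\<close> and \<open>t\<close> enter only through their product, so the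
    limit along the filter is that of a sequence in n = m t.\<close>
  have second: "((\<lambda>(m, t). c / (real (m * r * t) - c)) \<longlongrightarrow> 0) (filtercomap (\<lambda>(m, t). m * t) at_top)"
    using filterlim_compose[OF lim filterlim_filtercomap[of "\<lambda>(m, t). m * t" at_top]]
    by (simp add: case_prod_unfold algebra_simps)
  have third: "\<exists>N. \<forall>(\<pp> :: 'f poly) (\<gamma> :: 'f poly \<Rightarrow> 'k) (\<phi> :: 'f poly \<Rightarrow> 'k poly) m ell \<qq> \<theta> \<beta> t.
        code_setup r d \<pp> \<gamma> \<phi> m ell \<qq> \<theta> \<beta> t \<and> N \<le> m * t \<longrightarrow>
        (let C = code \<phi> r ell \<theta> \<beta> (t * m - 1);
             d_act = d_SR (Fqm CARD('f) m) r ell C;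
             \<Delta>_act = real (m * r) * (real (ell * r) - real d_act + 1) - real (dim_Fq \<gamma> C)
         in \<bar>\<Delta>_act / real (dim_Fq \<gamma> C)\<bar> < \<epsilon>)" if "0 < \<epsilon>" for \<epsilon>
  proof -
    \<comment> \<open>\<open>N\<close> depends only on \<open>r\<close>, \<open>c\<close> and
      \<open>\<epsilon>\<close>, so it serves all modules and all evaluation data at once.\<close>
    from LIMSEQ_D[OF lim that] obtain N where N: "\<And>n. N \<le> n \<Longrightarrow> \<bar>c / (real r * real n - c)\<bar> < \<epsilon>"
      by auto
    show ?thesis
    proof (intro exI[of _ N] allI impI)
      fix \<pp> :: "'f poly" and \<gamma> :: "'f poly \<Rightarrow> 'k" and \<phi> :: "'f poly \<Rightarrow> 'k poly" and m ell \<qq> \<theta> \<beta> t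
      assume "code_setup r d \<pp> \<gamma> \<phi> m ell \<qq> \<theta> \<beta> t \<and> N \<le> m * t"
      then have cs: "code_setup r d \<pp> \<gamma> \<phi> m ell \<qq> \<theta> \<beta> t" and mt: "N \<le> m * t" by auto
      note f = first[OF cs refl refl]
      have dim: "real (dim_Fq \<gamma> (code \<phi> r ell \<theta> \<beta> (t * m - 1))) = real (m * r * t) - c"
        using f by (elim conjE)
      have "\<bar>c / (real (m * r * t) - c)\<bar> < \<epsilon>"
        using N[OF mt] by (simp add: algebra_simps)
      with f show "let C = code \<phi> r ell \<theta> \<beta> (t * m - 1);
             d_act = d_SR (Fqm CARD('f) m) r ell C;
             \<Delta>_act = real (m * r) * (real (ell * r) - real d_act + 1) - real (dim_Fq \<gamma> C)
         in \<bar>\<Delta>_act / real (dim_Fq \<gamma> C)\<bar> < \<epsilon>"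
        unfolding Let_def dim by (elim conjE) linarith
    qed
  qed
  show ?thesis
    unfolding Let_def using first[OF _ refl refl] second third[unfolded Let_def] by blast
qed

end
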